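(* Fix any constants $c_0,c_1\in(0,1)$. The following holds for each of: the $\mathbb{Z}_2$ Synchronization model; the Censored Block Model; and the binary symmetric Stochastic Block Model with $0<c_0p\le q<p\le1-c_1$, along a sequence $n\to\infty$ with parameters allowed to depend on $n$ as specified in the model. If $nI^*\to\infty$, then with probability $1-o(1)$, every $\widehat Y\in\mathcal{Y}(A)$ satisfies $$\frac1n\|\widehat Y-Y^*\|_1\le\Big\lfloor n\exp\left[-\big(1-o(1)\big)\bar nI^*\right]\Big\rfloor\quad\text{and}\quad \mathrm{err}(\widehat\sigma^{\mathrm{sdp}},\sigma^* )\le\exp\left[-\big(1-o(1)\big)\bar nI^*\right],$$ where $\widehat\sigma^{\mathrm{sdp}}\in\{\pm1\}^n$ is the vector of entrywise signs of a top eigenvector of $\widehat Y$, and the $o(1)$ terms are deterministic sequences tending to $0$ as $n\to\infty$ (not depending on $\widehat Y$).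
   Context: Models. $\sigma^*\in\{\pm1\}^n$ is the (deterministic) ground-truth label vector, $Y^*=\sigma^*(\sigma^* )^\top$. The observed matrix $A\in\mathbb{R}^{n\times n}$ is symmetric with independent entries $\{A_{ij}:i\le j\}$: - $\mathbb{Z}_2$ Synchronization: $A_{ij}\sim N(\sigma_i^*\sigma_j^*,\tau^2)$, $\tau>0$ (may depend on $n$). - Censored Block Model: $A_{ij}=\sigma_i^*\sigma_j^*$ w.p. $\alpha(1-\epsilon)$, $-\sigma_i^*\sigma_j^*$ w.p. $\alpha\epsilon$, $0$ w.p. $1-\alpha$; $\alpha\in(0,1]$ may depend on $n$, $\epsilon\in(0,\frac12)$ is a constant. - Binary symmetric Stochastic Block Model: $\sum_i\sigma_i^*=0$, and $A_{ij}\sim\mathrm{Ber}(p)$ if $\sigma_i^*\sigma_j^*=1$, $A_{ij}\sim\mathrm{Ber}(q)$ if $\sigma_i^*\sigma_j^*=-1$; $0<q<p<1$ may depend on $n$. $I^*=(2\tau^2)^{-1}$, resp. $I^*=(\sqrt{\alpha(1-\epsilon)}-\sqrt{\alpha\epsilon})^2$, resp. $I^*=-2\log[\sqrt{pq}+\sqrt{(1-p)(1-q)}]$ for the three models. $\bar n=n$ for the first two models and $\bar n=n/2$ for the Stochastic Block Model. SDP: maximize $\langle A,Y\rangle=\sum_{i,j}A_{ij}Y_{ij}$ over $Y\in\mathbb{R}^{n\times n}$ with $Y\succeq0$ (symmetric positive semidefinite), $Y_{ii}=1$ for all $i$, and, for the Stochastic Block Model only, additionally $\sum_{i,j}Y_{ij}=0$.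 The sublevel set is $\mathcal{Y}(A)=\{Y: Y\text{ is feasible for the SDP},\ \langle A,Y\rangle\ge\langle A,Y^*\rangle\}$. $\|M\|_1=\sum_{i,j}|M_{ij}|$. $\mathrm{err}(\sigma,\sigma')=\min_{g\in\{\pm1\}}\frac1n\sum_{i=1}^n\mathbf{1}\{g\sigma_i\ne\sigma'_i\}$. The sign of $0$ is taken to be $1$; a top eigenvector is an eigenvector for the largest eigenvalue. *)

theory Defs
  imports
    "HOL-Probability.Probability"
    "Jordan_Normal_Form.Char_Poly"
begin

unbundle no vec_syntax and no inner_syntax

section \<open>Label vectors and random symmetric matrices\<close>

definition label_vec :: "nat \<Rightarrow> real Matrix.vec \<Rightarrow> bool" where
  "label_vec n \<sigma> \<longleftrightarrow> \<sigma> \<in> carrier_vec n \<and> (\<forall>i<n. \<sigma> $ i \<in> {-1, 1})"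

definition label_mat :: "real Matrix.vec \<Rightarrow> real Matrix.mat" where
  "label_mat \<sigma> = Matrix.mat (dim_vec \<sigma>) (dim_vec \<sigma>) (\<lambda>(i, j). \<sigma> $ i * \<sigma> $ j)"

definition symmetric_random_mat ::
    "'w measure \<Rightarrow> nat \<Rightarrow> ('w \<Rightarrow> real Matrix.mat) \<Rightarrow> bool" where
  "symmetric_random_mat M n A \<longleftrightarrow>
     prob_space M \<and>
     (\<forall>\<omega>\<in>space M. A \<omega> \<in> carrier_mat n n \<and> transpose_mat (A \<omega>) = A \<omega>) \<and>
     prob_space.indep_vars M (\<lambda>_. borel) (\<lambda>(i, j) \<omega>. A \<omega> $$ (i, j)) {(i, j). i \<le> j \<and> j < n}"

section \<open>The three models\<close>

definition z2_synchronization ::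
    "'w measure \<Rightarrow> nat \<Rightarrow> real Matrix.vec \<Rightarrow> real \<Rightarrow> ('w \<Rightarrow> real Matrix.mat) \<Rightarrow> bool" where
  "z2_synchronization M n \<sigma> \<tau> A \<longleftrightarrow>
     label_vec n \<sigma> \<and> 0 < \<tau> \<and> symmetric_random_mat M n A \<and>
     (\<forall>i j. i \<le> j \<and> j < n \<longrightarrow>
        distributed M lborel (\<lambda>\<omega>. A \<omega> $$ (i, j)) (normal_density (\<sigma> $ i * \<sigma> $ j) \<tau>))"

definition censored_block_model ::
    "'w measure \<Rightarrow> nat \<Rightarrow> real Matrix.vec \<Rightarrow> real \<Rightarrow> real \<Rightarrow> ('w \<Rightarrow> real Matrix.mat) \<Rightarrow> bool" where
  "censored_block_model M n \<sigma> \<alpha> \<epsilon> A \<longleftrightarrow>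
     label_vec n \<sigma> \<and> 0 < \<alpha> \<and> \<alpha> \<le> 1 \<and> 0 < \<epsilon> \<and> \<epsilon> < 1 / 2 \<and> symmetric_random_mat M n A \<and>
     (\<forall>i j. i \<le> j \<and> j < n \<longrightarrow>
        measure M {\<omega> \<in> space M. A \<omega> $$ (i, j) = \<sigma> $ i * \<sigma> $ j} = \<alpha> * (1 - \<epsilon>) \<and>
        measure M {\<omega> \<in> space M. A \<omega> $$ (i, j) = - (\<sigma> $ i * \<sigma> $ j)} = \<alpha> * \<epsilon> \<and>
        measure M {\<omega> \<in> space M. A \<omega> $$ (i, j) = 0} = 1 - \<alpha>)"

definition stochastic_block_model ::
    "'w measure \<Rightarrow> nat \<Rightarrow> real Matrix.vec \<Rightarrow> real \<Rightarrow> real \<Rightarrow> ('w \<Rightarrow> real Matrix.mat) \<Rightarrow> bool" where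
  "stochastic_block_model M n \<sigma> p q A \<longleftrightarrow>
     label_vec n \<sigma> \<and> (\<Sum>i<n. \<sigma> $ i) = 0 \<and> 0 < q \<and> q < p \<and> p < 1 \<and> symmetric_random_mat M n A \<and>
     (\<forall>i j. i \<le> j \<and> j < n \<longrightarrow>
        (let r = (if \<sigma> $ i * \<sigma> $ j = 1 then p else q) in
          measure M {\<omega> \<in> space M. A \<omega> $$ (i, j) = 1} = r \<and>
          measure M {\<omega> \<in> space M. A \<omega> $$ (i, j) = 0} = 1 - r))"

definition z2_info :: "real \<Rightarrow> real" where
  "z2_info \<tau> = 1 / (2 * \<tau>\<^sup>2)"

definition cbm_info :: "real \<Rightarrow> real \<Rightarrow> real" where
  "cbm_info \<alpha> \<epsilon> = (sqrt (\<alpha> * (1 - \<epsilon>)) - sqrt (\<alpha> * \<epsilon>))\<^sup>2"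

definition sbm_info :: "real \<Rightarrow> real \<Rightarrow> real" where
  "sbm_info p q = - 2 * ln (sqrt (p * q) + sqrt ((1 - p) * (1 - q)))"

section \<open>The semidefinite program\<close>

definition mat_inner :: "nat \<Rightarrow> real Matrix.mat \<Rightarrow> real Matrix.mat \<Rightarrow> real" where
  "mat_inner n A Y = (\<Sum>i<n. \<Sum>j<n. A $$ (i, j) * Y $$ (i, j))"

definition entrywise_l1_norm :: "real Matrix.mat \<Rightarrow> real" where
  "entrywise_l1_norm B = (\<Sum>i<dim_row B. \<Sum>j<dim_col B. \<bar>B $$ (i, j)\<bar>)"

definition pos_semidef :: "nat \<Rightarrow> real Matrix.mat \<Rightarrow> bool" where
  "pos_semidef n Y \<longleftrightarrow>
     Y \<in> carrier_mat n n \<and> transpose_mat Y = Y \<and>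
     (\<forall>x \<in> carrier_vec n. 0 \<le> scalar_prod x (Y *\<^sub>v x))"

definition sdp_feasible :: "nat \<Rightarrow> real Matrix.mat set" where
  "sdp_feasible n = {Y. pos_semidef n Y \<and> (\<forall>i<n. Y $$ (i, i) = 1)}"

definition balanced_sdp_feasible :: "nat \<Rightarrow> real Matrix.mat set" where
  "balanced_sdp_feasible n = {Y \<in> sdp_feasible n. (\<Sum>i<n. \<Sum>j<n. Y $$ (i, j)) = 0}"

definition sdp_sublevel ::
    "(nat \<Rightarrow> real Matrix.mat set) \<Rightarrow> nat \<Rightarrow> real Matrix.vec \<Rightarrow> real Matrix.mat \<Rightarrow> real Matrix.mat set" where
  "sdp_sublevel F n \<sigma> A = {Y \<in> F n. mat_inner n A Y \<ge> mat_inner n A (label_mat \<sigma>)}"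

section \<open>Label estimation and exponential error rates\<close>

definition top_eigenvector :: "real Matrix.mat \<Rightarrow> real Matrix.vec \<Rightarrow> bool" where
  "top_eigenvector Y v \<longleftrightarrow> (\<exists>l. eigenvector Y v l \<and> (\<forall>\<mu>. eigenvalue Y \<mu> \<longrightarrow> \<mu> \<le> l))"

text \<open>Not \<^const>\<open>sgn\<close>: here the sign of 0 is 1.\<close>

definition sign_vec :: "real Matrix.vec \<Rightarrow> real Matrix.vec" where
  "sign_vec v = map_vec (\<lambda>x. if 0 \<le> x then 1 else - 1) v"

definition label_err :: "nat \<Rightarrow> real Matrix.vec \<Rightarrow> real Matrix.vec \<Rightarrow> real" where
  "label_err n \<sigma> \<sigma>' =
     Min ((\<lambda>g. 1 / real n * (\<Sum>i<n. of_bool (g * \<sigma> $ i \<noteq> \<sigma>' $ i))) ` {-1, 1 :: real})"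

text \<open>
  All arguments except \<open>F\<close> are sequences, indexed by the position \<open>k\<close> in the asymptotic regime;
  \<open>nbar\<close> and \<open>I\<close> are the effective size and the information. The vanishing terms
  \<open>\<delta>\<close>, \<open>\<eta>\<close>, \<open>\<eta>'\<close> are chosen before the random outcome and before \<open>Y\<close>.
  ``With probability at least \<open>1 - \<delta> k\<close>'' means that the property holds on some measurable event
  of at least that probability, so it does not presuppose that the set of all good outcomes,
  which involves a quantifier over matrices, is measurable.
\<close>

definition sdp_exponential_recovery ::
    "(nat \<Rightarrow> real Matrix.mat set) \<Rightarrow> (nat \<Rightarrow> 'w measure) \<Rightarrow> (nat \<Rightarrow> nat) \<Rightarrow> (nat \<Rightarrow> real) \<Rightarrow>
     (nat \<Rightarrow> real) \<Rightarrow> (nat \<Rightarrow> real Matrix.vec) \<Rightarrow> (nat \<Rightarrow> 'w \<Rightarrow> real Matrix.mat) \<Rightarrow> bool" where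
  "sdp_exponential_recovery F M n nbar I \<sigma> A \<longleftrightarrow>
     (\<exists>\<delta> \<eta> \<eta>' :: nat \<Rightarrow> real.
        \<delta> \<longlonglongrightarrow> 0 \<and> \<eta> \<longlonglongrightarrow> 0 \<and> \<eta>' \<longlonglongrightarrow> 0 \<and>
        (\<forall>k. \<exists>E \<in> sets (M k). measure (M k) E \<ge> 1 - \<delta> k \<and>
           (\<forall>\<omega>\<in>E. \<forall>Y \<in> sdp_sublevel F (n k) (\<sigma> k) (A k \<omega>).
              1 / real (n k) * entrywise_l1_norm (Y - label_mat (\<sigma> k))
                \<le> of_int \<lfloor>real (n k) * exp (- (1 - \<eta> k) * nbar k * I k)\<rfloor> \<and>
              (\<forall>v. top_eigenvector Y v \<longrightarrow>
                 label_err (n k) (sign_vec v) (\<sigma> k)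
                   \<le> exp (- (1 - \<eta>' k) * nbar k * I k)))))"

end

theory Submission
  imports Defs "HOL-Real_Asymp.Real_Asymp"
begin

text \<open>
  Flipping signs by \<open>\<sigma>\<close>, we may take the truth to be the all-ones matrix and the data to have mean
  \<open>\<mu>\<close> off the diagonal, with noise \<open>W\<close> and row sums \<open>d\<^sub>i\<close>. Let \<open>v\<^sub>i\<close> be Gram vectors of a feasible \<open>Y\<close>, \<open>w\<^sub>i\<close>
  their deviations from the mean vector and \<open>q\<^sub>i = |w\<^sub>i|\<^sup>2 \<le> 4\<close>. Then the entrywise error is \<open>n \<Sum> q\<^sub>i\<close>, and \<open>Y\<close> lies in the
  sublevel set only if \<open>\<Sum> d\<^sub>i q\<^sub>i \<le> \<Sum> W\<^sub>i\<^sub>j \<langle>w\<^sub>i, w\<^sub>j\<rangle>\<close>. If \<open>W\<close> has spectral norm at most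
  \<open>\<theta>/2\<close> with \<open>\<theta> = o(1) \<mu> n\<close>, this yields \<open>\<Sum> q\<^sub>i \<le> (8/\<theta>) \<Sum> max 0 (\<theta> - d\<^sub>i)\<close>, whose
  exponential moments are given by Chernoff's bound with the optimal exponent, \<open>exp (- (1 - o(1)) nbar I)\<close>.

  The spectral bound follows for Gaussian noise from a union bound over integer vectors. In the sparse models
  it holds for the submatrix of vertices of bounded degree, by the argument of Feige and Ofek: pairs
  with a small product of coordinates obey the union bound, the remaining ones are controlled by the
  discrepancy of the random graph. Vertices of large degree are so rare that they
  contribute less than the claimed error.

  For the labels, the top eigenvalue is at least the Rayleigh quotient at \<open>\<sigma>\<close>, so a top eigenvector is close to a multiple
  of \<open>\<sigma>\<close>, and every wrong sign costs a fixed amount of squared distance.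
\<close>

section \<open>Gram vectors and the sublevel inequality\<close>

text \<open>The assumption lets \<open>n * I\<close> grow arbitrarily slowly, so the average degree
  need not be of order log n. A few vertices may then have a degree far above average, the norm of
  the full noise matrix is too large, and rows have to be removed. The choice of \<theta> has room
  because of one ratio. On bounded degrees the noise has norm of order sqrt (n * p), the signal is
  \<mu> * n, and the square of signal over noise is of the order of nbar * I, since I is of order
  \<mu>^2 / p in the sparse models and 1 / \<tau>^2 in the Gaussian one. Hence a small multiple of
  \<mu> * n still beats the noise. The optimal Chernoff parameter \<open>lam\<close> makes
  \<open>lam\<close> * \<mu> * n comparable to nbar * I, so the shift by \<theta> spends only a
  small fraction of the exponent. All estimates are made for a fixed accuracy \<open>e\<close> and
  large indices; the vanishing sequences arise from them by a diagonal argument.\<close>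

text \<open>Cholesky factorisation: a rank-one term removes the last row and column, and the
  remaining Schur complement is again positive semidefinite because it is the minimum of the form
  over the last coordinate.\<close>

lemma psd_gram:
  fixes Y :: "nat \<Rightarrow> nat \<Rightarrow> real"
  assumes "\<And>i j. i < n \<Longrightarrow> j < n \<Longrightarrow> Y i j = Y j i"
    and "\<And>x. 0 \<le> (\<Sum>i<n. \<Sum>j<n. x i * Y i j * x j)"
  shows "\<exists>V. \<forall>i<n. \<forall>j<n. Y i j = (\<Sum>k<n. V k i * V k j)"
  using assms
proof (induction n arbitrary: Y)
  case 0
  then show ?case by simp
next
  case (Suc n)
  note sym = Suc.prems(1) and psd = Suc.prems(2)
  have expand: "(\<Sum>i<Suc n. \<Sum>j<Suc n. x i * Y i j * x j) =
      (\<Sum>i<n. \<Sum>j<n. x i * Y i j * x j) + 2 * x n * (\<Sum>i<n. Y n i * x i) + Y n n * (x n)\<^sup>2" for x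
  proof -
    have "(\<Sum>i<n. x i * Y i n * x n) = x n * (\<Sum>i<n. Y n i * x i)"
      unfolding sum_distrib_left by (intro sum.cong) (auto simp: sym[of _ n])
    moreover have "(\<Sum>j<n. x n * Y n j * x j) = x n * (\<Sum>i<n. Y n i * x i)"
      unfolding sum_distrib_left by (intro sum.cong) auto
    ultimately show ?thesis by (simp add: sum.distrib power2_eq_square)
  qed
  have nn: "0 \<le> Y n n"
  proof -
    have "(\<Sum>i<n. Y n i * (if i = n then 1 else 0)) = 0" by (intro sum.neutral) auto
    moreover have "(\<Sum>i<n. \<Sum>j<n. (if i = n then 1 else 0) * Y i j * (if j = n then 1 else 0)) = 0"
      by (intro sum.neutral) auto
    ultimately show ?thesis using psd[of "\<lambda>i. if i = n then 1 else 0"] unfolding expand by simp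
  qed
  have zero: "Y n i = 0" if "Y n n = 0" "i < n" for i
  proof (rule ccontr)
    assume ne: "Y n i \<noteq> 0"
    \<comment> \<open>On the \<open>i\<close>-th unit vector plus \<open>t\<close> times the
      \<open>n\<close>-th one the form is \<open>Y i i + 2 * t * Y n i\<close>; this
      \<open>t\<close> makes it -1.\<close>
    define t where "t = - (Y i i + 1) / (2 * Y n i)"
    let ?x = "\<lambda>j. if j = i then 1 else if j = n then t else 0"
    have 1: "(\<Sum>j<n. Y n j * ?x j) = Y n i"
    proof -
      have "(\<Sum>j<n. Y n j * ?x j) = (\<Sum>j\<in>{i}. Y n j * ?x j)"
        using that by (intro sum.mono_neutral_right) auto
      then show ?thesis by simp
    qed
    have 2: "(\<Sum>k<n. \<Sum>j<n. ?x k * Y k j * ?x j) = Y i i"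
    proof -
      have "(\<Sum>k<n. \<Sum>j<n. ?x k * Y k j * ?x j) = (\<Sum>k\<in>{i}. \<Sum>j\<in>{i}. ?x k * Y k j * ?x j)"
        using that by (intro sum.mono_neutral_cong_right sum.cong) auto
      then show ?thesis by simp
    qed
    have "0 \<le> Y i i + 2 * t * Y n i"
      using psd[of ?x] that unfolding expand 1 2 by simp
    also have "\<dots> = -1" using ne by (simp add: t_def field_simps)
    finally show False by simp
  qed
  \<comment> \<open>The Schur complement. If \<open>Y n n = 0\<close>, division by zero makes the
    correction vanish, which is right because the last row is then zero by
    \<open>zero\<close>.\<close>
  define Z where "Z i j = Y i j - Y n i * Y n j / Y n n" for i j
  have "\<exists>V. \<forall>i<n. \<forall>j<n. Z i j = (\<Sum>k<n. V k i * V k j)"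
  proof (rule Suc.IH)
    fix i j assume "i < n" "j < n"
    then show "Z i j = Z j i" using sym[of i j] by (simp add: Z_def)
  next
    fix x :: "nat \<Rightarrow> real"
    define s where "s = (\<Sum>i<n. Y n i * x i)"
    have "(\<Sum>i<n. \<Sum>j<n. x i * Z i j * x j) = (\<Sum>i<n. \<Sum>j<n. x i * Y i j * x j) - s\<^sup>2 / Y n n"
      unfolding Z_def s_def power2_eq_square sum_product sum_divide_distrib sum_subtractf[symmetric]
      by (intro sum.cong) (auto simp: field_simps)
    moreover have "0 \<le> (\<Sum>i<n. \<Sum>j<n. x i * Y i j * x j) - s\<^sup>2 / Y n n"
    proof (cases "Y n n = 0")
      case True
      then show ?thesis using psd[of "x(n := 0)"] unfolding expand by simp
    next
      case False
      \<comment> \<open>\<open>- s / Y n n\<close> is the last coordinate that minimises the form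
        for the given first \<open>n\<close> coordinates.\<close>
      have 1: "(\<Sum>i<n. Y n i * (x(n := - s / Y n n)) i) = s" unfolding s_def by (intro sum.cong) auto
      have 2: "(\<Sum>i<n. \<Sum>j<n. (x(n := - s / Y n n)) i * Y i j * (x(n := - s / Y n n)) j)
        = (\<Sum>i<n. \<Sum>j<n. x i * Y i j * x j)" by (intro sum.cong) auto
      show ?thesis using psd[of "x(n := - s / Y n n)"] False unfolding expand 1 2
        by (simp add: power2_eq_square field_simps)
    qed
    ultimately show "0 \<le> (\<Sum>i<n. \<Sum>j<n. x i * Z i j * x j)" by simp
  qed
  then obtain V where V: "\<And>i j. i < n \<Longrightarrow> j < n \<Longrightarrow> Z i j = (\<Sum>k<n. V k i * V k j)" by blast
  define U where "U k i = (if k = n then Y n i / sqrt (Y n n) else if i = n then 0 else V k i)" for k i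
  have "Y i j = (\<Sum>k<Suc n. U k i * U k j)" if "i < Suc n" "j < Suc n" for i j
  proof -
    have sq: "sqrt (Y n n) * sqrt (Y n n) = Y n n" using nn by simp
    have 1: "(\<Sum>k<n. U k i * U k j) = (if i = n \<or> j = n then 0 else Z i j)"
      using that V by (auto simp: U_def intro!: sum.neutral)
    have 2: "U n i * U n j = Y n i * Y n j / Y n n" using sq by (simp add: U_def field_simps)
    show ?thesis
    proof (cases "Y n n = 0")
      case True
      then have "Y n i = 0" "Y n j = 0" "Y i n = 0" using zero sym[of i n] that less_Suc_eq by auto
      then show ?thesis unfolding sum.lessThan_Suc 1 2 by (auto simp: Z_def True)
    next
      case False
      then show ?thesis unfolding sum.lessThan_Suc 1 2 using sym[of i n] that by (auto simp: Z_def)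
    qed
  qed
  then show ?case by blast
qed

text \<open>The gauged Gram vectors of a competitor \<open>Y\<close> are centred to \<open>w\<^sub>i\<close> with \<open>q\<^sub>i = |w\<^sub>i|\<^sup>2\<close>. The
  objective difference is a Laplacian form, which is blind to the centring, so the mean part of \<open>B\<close>
  drops out and the sublevel condition becomes \<open>\<Sum> d\<^sub>i q\<^sub>i \<le> \<Sum> W\<^sub>i\<^sub>j \<langle>w\<^sub>i, w\<^sub>j\<rangle>\<close>.\<close>

lemma sdp_core:
  fixes B W V :: "nat \<Rightarrow> nat \<Rightarrow> real" and \<mu> \<theta> :: real and h :: "nat \<Rightarrow> real"
  assumes unit: "\<And>i. i < n \<Longrightarrow> (\<Sum>k<m. (V k i)\<^sup>2) = 1"
    and Bsym: "\<And>i j. i < n \<Longrightarrow> j < n \<Longrightarrow> B i j = B j i"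
    and Wsym: "\<And>i j. i < n \<Longrightarrow> j < n \<Longrightarrow> W i j = W j i"
    and BW: "\<And>i j. i < n \<Longrightarrow> j < n \<Longrightarrow> B i j = (if i = j then 0 else \<mu>) + W i j"
    and \<mu>: "0 \<le> \<mu>" and \<theta>: "0 \<le> \<theta>" and n: "0 < n"
    and sub: "(\<Sum>i<n. \<Sum>j<n. B i j * (1 - (\<Sum>k<m. V k i * V k j))) \<le> 0"
    and spec: "\<And>x. (\<And>i. i < n \<Longrightarrow> i \<notin> G \<Longrightarrow> x i = 0) \<Longrightarrow>
        (\<Sum>i<n. \<Sum>j<n. W i j * x i * x j) \<le> \<theta> / 2 * (\<Sum>i<n. (x i)\<^sup>2)"
    and h: "\<And>i. i < n \<Longrightarrow> i \<notin> G \<Longrightarrow> (\<Sum>j<n. \<bar>W i j\<bar>) \<le> h i"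
  shows "\<theta> / 2 * ((\<Sum>i<n. \<Sum>j<n. 1 - (\<Sum>k<m. V k i * V k j)) / n)
     \<le> 4 * (\<Sum>i<n. max 0 (\<theta> - (\<Sum>j<n. B i j))) + 8 * (\<Sum>i\<in>{..<n} - G. h i)"
proof -
  define c where "c k = (\<Sum>i<n. V k i) / n" for k
  define w where "w k i = V k i - c k" for k i
  define q where "q i = (\<Sum>k<m. (w k i)\<^sup>2)" for i
  define g where "g i j = (\<Sum>k<m. w k i * w k j)" for i j
  define d where "d i = (\<Sum>j<n. B i j)" for i
  have w0: "(\<Sum>i<n. w k i) = 0" for k using n by (simp add: w_def c_def sum_subtractf)
  have q0: "0 \<le> q i" for i by (simp add: q_def sum_nonneg)
  \<comment> \<open>Distances between Gram vectors survive the shift by the mean; this is where the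
    form becomes one in \<open>w\<close>.\<close>
  have gq: "1 - (\<Sum>k<m. V k i * V k j) = (q i + q j) / 2 - g i j" if "i < n" "j < n" for i j
  proof -
    have "2 - 2 * (\<Sum>k<m. V k i * V k j) = (\<Sum>k<m. (V k i)\<^sup>2) + (\<Sum>k<m. (V k j)\<^sup>2) - 2 * (\<Sum>k<m. V k i * V k j)"
      using unit that by simp
    also have "\<dots> = (\<Sum>k<m. (V k i - V k j)\<^sup>2)"
      by (simp add: power2_diff sum.distrib sum_subtractf sum_distrib_left algebra_simps)
    also have "\<dots> = (\<Sum>k<m. (w k i - w k j)\<^sup>2)" by (simp add: w_def)
    also have "\<dots> = q i + q j - 2 * g i j" unfolding q_def g_def
      by (simp add: power2_diff sum.distrib sum_subtractf sum_distrib_left algebra_simps)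
    finally show ?thesis by (simp add: field_simps)
  qed
  have gabs: "\<bar>g i j\<bar> \<le> (q i + q j) / 2" for i j
  proof -
    have "\<bar>g i j\<bar> \<le> (\<Sum>k<m. \<bar>w k i * w k j\<bar>)" unfolding g_def by (rule sum_abs)
    also have "\<dots> \<le> (\<Sum>k<m. ((w k i)\<^sup>2 + (w k j)\<^sup>2) / 2)"
    proof (rule sum_mono)
      fix k
      show "\<bar>w k i * w k j\<bar> \<le> ((w k i)\<^sup>2 + (w k j)\<^sup>2) / 2"
        using sum_squares_bound[of "w k i" "w k j"] sum_squares_bound[of "w k i" "- w k j"]
        by (simp add: abs_if)
    qed
    also have "\<dots> = (q i + q j) / 2" by (simp add: q_def sum.distrib sum_divide_distrib add_divide_distrib)
    finally show ?thesis .
  qed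
  have gsum: "(\<Sum>i<n. \<Sum>j<n. g i j) = 0"
  proof -
    have "(\<Sum>i<n. \<Sum>j<n. g i j) = (\<Sum>i<n. \<Sum>k<m. \<Sum>j<n. w k i * w k j)"
      unfolding g_def by (intro sum.cong sum.swap) auto
    also have "\<dots> = 0" by (simp add: sum_distrib_left[symmetric] w0)
    finally show ?thesis .
  qed
  have gii: "g i i = q i" for i by (simp add: g_def q_def power2_eq_square)
  have qsum: "(\<Sum>i<n. \<Sum>j<n. 1 - (\<Sum>k<m. V k i * V k j)) / n = (\<Sum>i<n. q i)"
  proof -
    have "(\<Sum>i<n. \<Sum>j<n. 1 - (\<Sum>k<m. V k i * V k j)) = (\<Sum>i<n. \<Sum>j<n. (q i + q j) / 2 - g i j)"
      by (intro sum.cong) (auto simp: gq)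
    also have "\<dots> = (\<Sum>i<n. \<Sum>j<n. (q i + q j) / 2)" using gsum by (simp add: sum_subtractf)
    also have "\<dots> = n * (\<Sum>i<n. q i)"
      by (simp add: add_divide_distrib sum.distrib sum_distrib_left sum_divide_distrib[symmetric])
    finally show ?thesis using n by simp
  qed
  \<comment> \<open>A mean of unit vectors has norm at most 1, and the squared norm of a difference
    is at most twice the sum of the squared norms: 2 + 2.\<close>
  have q4: "q i \<le> 4" if "i < n" for i
  proof -
    have "(\<Sum>i<n. (w k i)\<^sup>2) = (\<Sum>i<n. (V k i)\<^sup>2) - n * (c k)\<^sup>2" for k
    proof -
      have "(\<Sum>i<n. (w k i)\<^sup>2) = (\<Sum>i<n. (V k i)\<^sup>2) - 2 * c k * (\<Sum>i<n. V k i) + n * (c k)\<^sup>2"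
        by (simp add: w_def power2_diff sum.distrib sum_subtractf sum_distrib_left algebra_simps)
      also have "(\<Sum>i<n. V k i) = n * c k" using n by (simp add: c_def)
      finally show ?thesis by (simp add: power2_eq_square)
    qed
    then have "(\<Sum>k<m. \<Sum>i<n. (w k i)\<^sup>2) = (\<Sum>k<m. \<Sum>i<n. (V k i)\<^sup>2) - n * (\<Sum>k<m. (c k)\<^sup>2)"
      by (simp add: sum_subtractf sum_distrib_left)
    moreover have "(\<Sum>k<m. \<Sum>i<n. (V k i)\<^sup>2) = n" by (subst sum.swap) (simp add: unit)
    moreover have "0 \<le> (\<Sum>k<m. \<Sum>i<n. (w k i)\<^sup>2)" by (intro sum_nonneg) auto
    ultimately have "real n * (\<Sum>k<m. (c k)\<^sup>2) \<le> real n * 1" by simp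
    then have c1: "(\<Sum>k<m. (c k)\<^sup>2) \<le> 1" using n by simp
    have "q i \<le> (\<Sum>k<m. 2 * (V k i)\<^sup>2 + 2 * (c k)\<^sup>2)" unfolding q_def
    proof (rule sum_mono)
      fix k
      have "0 \<le> (V k i + c k)\<^sup>2" by simp
      then show "(w k i)\<^sup>2 \<le> 2 * (V k i)\<^sup>2 + 2 * (c k)\<^sup>2"
        unfolding w_def power2_diff power2_sum by linarith
    qed
    also have "\<dots> = 2 + 2 * (\<Sum>k<m. (c k)\<^sup>2)"
      by (simp add: sum.distrib sum_distrib_left[symmetric] unit[OF that])
    finally show ?thesis using c1 by simp
  qed
  have dq: "(\<Sum>i<n. d i * q i) \<le> (\<Sum>i<n. \<Sum>j<n. B i j * g i j)"
  proof -
    have 1: "(\<Sum>i<n. \<Sum>j<n. B i j * q i) = (\<Sum>i<n. d i * q i)"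
      by (simp add: d_def sum_distrib_right)
    have 2: "(\<Sum>i<n. \<Sum>j<n. B i j * q j) = (\<Sum>i<n. d i * q i)"
      unfolding 1[symmetric] by (subst sum.swap, intro sum.cong) (auto simp: Bsym)
    have "(\<Sum>i<n. \<Sum>j<n. B i j * (1 - (\<Sum>k<m. V k i * V k j))) =
       (\<Sum>i<n. \<Sum>j<n. (B i j * q i + B i j * q j) / 2 - B i j * g i j)"
      by (intro sum.cong) (auto simp: gq algebra_simps)
    also have "\<dots> = (\<Sum>i<n. d i * q i) - (\<Sum>i<n. \<Sum>j<n. B i j * g i j)"
      by (simp add: sum_subtractf sum_divide_distrib[symmetric] sum.distrib 1 2)
    finally show ?thesis using sub by simp
  qed
  \<comment> \<open>The constant part \<mu> is annihilated by \<open>gsum\<close>; only its missing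
    diagonal is left, and that has the favourable sign.\<close>
  have Bg: "(\<Sum>i<n. \<Sum>j<n. B i j * g i j) = (\<Sum>i<n. \<Sum>j<n. W i j * g i j) - \<mu> * (\<Sum>i<n. q i)"
  proof -
    have "(\<Sum>i<n. \<Sum>j<n. B i j * g i j) = (\<Sum>i<n. \<Sum>j<n. W i j * g i j + \<mu> * g i j - (if i = j then \<mu> * q i else 0))"
      by (intro sum.cong) (auto simp: BW gii algebra_simps)
    also have "\<dots> = (\<Sum>i<n. \<Sum>j<n. W i j * g i j) + \<mu> * (\<Sum>i<n. \<Sum>j<n. g i j) - (\<Sum>i<n. \<mu> * q i)"
      by (simp add: sum.distrib sum_subtractf sum_distrib_left)
    finally show ?thesis by (simp add: gsum sum_distrib_left)
  qed
  have Wg: "(\<Sum>i<n. \<Sum>j<n. W i j * g i j) \<le> \<theta> / 2 * (\<Sum>i<n. q i) + 8 * (\<Sum>i\<in>{..<n} - G. h i)"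
  proof -
    \<comment> \<open>\<open>u\<close> lives on the rows in \<open>G\<close>, where the spectral
      bound applies. \<open>a\<close> holds every pair that touches a removed row; it is bounded by
      |g| \<le> 4 and charged to each removed endpoint, hence the factor 8.\<close>
    define u where "u k i = (if i \<in> G then w k i else 0)" for k i
    define a where "a i j = (if i \<notin> G \<or> j \<notin> G then W i j * g i j else 0)" for i j
    have 1: "(\<Sum>k<m. \<Sum>i<n. \<Sum>j<n. W i j * u k i * u k j) \<le> \<theta> / 2 * (\<Sum>i<n. q i)"
    proof -
      have sp: "\<theta> / 2 * (\<Sum>i<n. (u k i)\<^sup>2) \<le> \<theta> / 2 * (\<Sum>i<n. (w k i)\<^sup>2)" for k
        using \<theta> by (intro mult_left_mono sum_mono) (auto simp: u_def)
      have "(\<Sum>k<m. \<Sum>i<n. \<Sum>j<n. W i j * u k i * u k j) \<le> (\<Sum>k<m. \<theta> / 2 * (\<Sum>i<n. (w k i)\<^sup>2))"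
        by (rule sum_mono, rule order_trans[OF spec sp]) (auto simp: u_def)
      also have "\<dots> = \<theta> / 2 * (\<Sum>i<n. q i)"
        unfolding q_def sum.swap[of _ "{..<m}" "{..<n}"] sum_distrib_left ..
      finally show ?thesis .
    qed
    have 2: "(\<Sum>i<n. \<Sum>j<n. a i j) \<le> 8 * (\<Sum>i\<in>{..<n} - G. h i)"
    proof -
      have al: "a i j \<le> (if i \<notin> G then 4 * \<bar>W i j\<bar> else 0) + (if j \<notin> G then 4 * \<bar>W j i\<bar> else 0)"
        if "i < n" "j < n" for i j
      proof -
        have "\<bar>g i j\<bar> \<le> 4" using gabs[of i j] q4[OF that(1)] q4[OF that(2)] by simp
        then have "W i j * g i j \<le> \<bar>W i j\<bar> * 4"
          by (metis abs_ge_self abs_ge_zero abs_mult mult_left_mono order_trans)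
        then show ?thesis using Wsym[OF that] by (auto simp: a_def)
      qed
      have R: "(\<Sum>i<n. \<Sum>j<n. (if i \<notin> G then 4 * \<bar>W i j\<bar> else 0)) \<le> 4 * (\<Sum>i\<in>{..<n} - G. h i)"
      proof -
        have "(\<Sum>i<n. \<Sum>j<n. (if i \<notin> G then 4 * \<bar>W i j\<bar> else 0)) =
           (\<Sum>i\<in>{..<n} - G. \<Sum>j<n. (if i \<notin> G then 4 * \<bar>W i j\<bar> else 0))"
          by (intro sum.mono_neutral_right) auto
        also have "\<dots> \<le> (\<Sum>i\<in>{..<n} - G. 4 * h i)"
          using h by (intro sum_mono) (auto simp: sum_distrib_left[symmetric])
        finally show ?thesis by (simp add: sum_distrib_left)
      qed
      have "(\<Sum>i<n. \<Sum>j<n. a i j) \<le> (\<Sum>i<n. \<Sum>j<n. (if i \<notin> G then 4 * \<bar>W i j\<bar> else 0)) +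
          (\<Sum>i<n. \<Sum>j<n. (if j \<notin> G then 4 * \<bar>W j i\<bar> else 0))"
        unfolding sum.distrib[symmetric] by (intro sum_mono al) auto
      also have "(\<Sum>i<n. \<Sum>j<n. (if j \<notin> G then 4 * \<bar>W j i\<bar> else 0)) =
         (\<Sum>i<n. \<Sum>j<n. (if i \<notin> G then 4 * \<bar>W i j\<bar> else 0))" by (rule sum.swap)
      finally show ?thesis using R by simp
    qed
    have "(\<Sum>k<m. \<Sum>i<n. \<Sum>j<n. W i j * u k i * u k j) = (\<Sum>i<n. \<Sum>j<n. \<Sum>k<m. W i j * u k i * u k j)"
      by (subst sum.swap, intro sum.cong refl sum.swap)
    moreover have "(\<Sum>i<n. \<Sum>j<n. W i j * g i j) = (\<Sum>i<n. \<Sum>j<n. \<Sum>k<m. W i j * u k i * u k j) + (\<Sum>i<n. \<Sum>j<n. a i j)"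
      unfolding sum.distrib[symmetric]
      by (intro sum.cong refl) (auto simp: a_def u_def g_def sum_distrib_left mult.assoc)
    ultimately show ?thesis using 1 2 by simp
  qed
  have "(\<Sum>i<n. d i * q i) \<ge> \<theta> * (\<Sum>i<n. q i) - 4 * (\<Sum>i<n. max 0 (\<theta> - d i))"
  proof -
    \<comment> \<open>Rows with d i \<ge> \<theta> pay for themselves; any other row loses at most 4
      times its shortfall.\<close>
    have "\<theta> * q i - 4 * max 0 (\<theta> - d i) \<le> d i * q i" if "i < n" for i
    proof -
      have "(\<theta> - d i) * q i \<le> max 0 (\<theta> - d i) * q i" by (intro mult_right_mono q0) auto
      also have "\<dots> \<le> max 0 (\<theta> - d i) * 4" by (intro mult_left_mono q4 that) auto
      finally show ?thesis by (simp add: algebra_simps)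
    qed
    then show ?thesis unfolding sum_distrib_left sum_subtractf[symmetric] by (intro sum_mono) auto
  qed
  moreover have "0 \<le> \<mu> * (\<Sum>i<n. q i)" using \<mu> q0 by (intro mult_nonneg_nonneg sum_nonneg) auto
  ultimately show ?thesis using dq Wg Bg unfolding qsum d_def[symmetric]
    by (simp add: algebra_simps)
qed

section \<open>Edges between vertices with large coordinates\<close>

text \<open>A geometric sum is dominated by its largest term, whatever the number \<open>m\<close>
  of levels. Sums over dyadic levels collapse in this way to the extreme admissible level.\<close>

lemma sum_power2_below:
  fixes x :: real
  assumes "0 \<le> x"
  shows "(\<Sum>a | a < m \<and> 2 ^ a \<le> x. 2 ^ a) \<le> 2 * x"
proof (induction m)
  case 0
  then show ?case using assms by simp
next
  case (Suc m)
  show ?case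
  proof (cases "2 ^ m \<le> x")
    case True
    have "{a. a < Suc m \<and> 2 ^ a \<le> x} = {..<Suc m}"
      using True by (auto intro: order_trans[OF power_increasing[of _ m]])
    moreover have "(\<Sum>a<Suc m. (2::real) ^ a) \<le> 2 * 2 ^ m"
      using sum_gp_strict[of "2::real" "Suc m"] by simp
    ultimately show ?thesis using True by simp
  next
    case False
    then have "{a. a < Suc m \<and> 2 ^ a \<le> x} = {a. a < m \<and> 2 ^ a \<le> x}"
      by (auto simp: less_Suc_eq)
    then show ?thesis using Suc.IH by simp
  qed
qed

text \<open>Young's inequality for the entropy function. With \<open>y\<close> equal to the index of
  a dyadic level it trades the logarithm of an unknown mass \<beta> for terms that can be summed
  over the levels.\<close>

lemma mult_ln_inverse_le:
  fixes \<beta> y :: real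
  assumes "0 < \<beta>"
  shows "\<beta> * ln (1 / \<beta>) \<le> \<beta> * y + exp (- y)"
proof -
  have "\<beta> * (ln (1 / \<beta>) - y) \<le> \<beta> * exp (ln (1 / \<beta>) - y)"
    using exp_ge_add_one_self[of "ln (1 / \<beta>) - y"] assms by (intro mult_left_mono) linarith+
  also have "\<dots> = exp (- y)" using assms by (simp add: exp_diff exp_minus field_simps)
  finally show ?thesis by (simp add: algebra_simps)
qed

lemma sum_exp_neg_le_two: "(\<Sum>b<m. exp (- real b)) \<le> (2::real)"
proof -
  have "(\<Sum>b<m. exp (- real b)) = (\<Sum>b<m. (exp (-1)) ^ b)"
    by (intro sum.cong) (auto simp: exp_of_nat_mult[symmetric])
  also have "\<dots> = (1 - exp (-1) ^ m) / (1 - exp (-1))"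
    by (subst sum_gp_strict) auto
  also have "\<dots> \<le> 1 / (1 - exp (-1))" by (intro divide_right_mono) auto
  also have "\<dots> \<le> 2"
  proof -
    have "exp (-1) \<le> (1/2::real)"
      using exp_ge_add_one_self[of "1::real"] by (simp add: exp_minus field_simps)
    then show ?thesis by (simp add: field_simps)
  qed
  finally show ?thesis .
qed

lemma Suc_le_two_sqrt_power2: "real b + 1 \<le> 2 * sqrt (2 ^ b)"
proof -
  have "(b + 1)\<^sup>2 \<le> 4 * 2 ^ b"
  proof (induction b)
    case (Suc b)
    show ?case
    proof (cases "b \<le> 1")
      case True
      then have "b = 0 \<or> b = 1" by auto
      then show ?thesis by (auto simp: power2_eq_square)
    next
      case False
      then have "2 \<le> b * b" using mult_le_mono[of 2 b 2 b] by simp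
      then have "(Suc b + 1)\<^sup>2 \<le> 2 * (b + 1)\<^sup>2 "
        using False by (simp add: power2_eq_square)
      then show ?thesis using Suc by simp
    qed
  qed simp
  then have "real ((b + 1)\<^sup>2) \<le> real (4 * 2 ^ b)" by (rule of_nat_mono)
  then have "sqrt ((real b + 1)\<^sup>2) \<le> sqrt (4 * 2 ^ b)"
    by (intro real_sqrt_le_mono) (simp add: add.commute)
  then show ?thesis by (simp add: real_sqrt_mult)
qed

lemma dyadic_level:
  fixes x :: real
  assumes "1 \<le> x" "x < 2 ^ m"
  shows "\<exists>a<m. 2 ^ a \<le> x \<and> x < 2 ^ Suc a"
proof -
  define a where "a = (GREATEST a. 2 ^ a \<le> x)"
  have b: "a' \<le> m" if "2 ^ a' \<le> x" for a'
  proof (rule ccontr)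
    assume "\<not> a' \<le> m"
    then have "(2::real) ^ m \<le> 2 ^ a'" by (intro power_increasing) auto
    with that assms show False by simp
  qed
  have 1: "2 ^ a \<le> x" unfolding a_def
    by (rule GreatestI_nat[where k = 0 and b = m]) (use assms b in auto)
  have 2: "\<not> 2 ^ Suc a \<le> x"
  proof
    assume "2 ^ Suc a \<le> x"
    then have "Suc a \<le> a" unfolding a_def by (intro Greatest_le_nat[where b = m]) (use b a_def in auto)
    then show False by simp
  qed
  have "a < m"
  proof (rule ccontr)
    assume "\<not> a < m"
    then have "(2::real) ^ m \<le> 2 ^ a" by (intro power_increasing) auto
    with 1 assms show False by simp
  qed
  with 1 2 show ?thesis by auto
qed

text \<open>The standard upper bound for the logarithm of the number of subsets of an
  \<open>n\<close>-set with at most \<open>t\<close> elements, see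
  \<open>card_subsets_entropy\<close>.\<close>

definition set_entropy :: "nat \<Rightarrow> nat \<Rightarrow> real" where
  "set_entropy n t = t * ln (exp 1 * n / t)"

text \<open>Unordered pairs between two sets that may overlap, each stored once with the smaller
  endpoint in front, since only these entries are independent. With S = {i} and T = {..<n} this is
  the star at \<open>i\<close>.\<close>

definition edge_pairs :: "nat \<Rightarrow> nat set \<Rightarrow> nat set \<Rightarrow> (nat \<times> nat) set" where
  "edge_pairs n S T = {(i, j). i < j \<and> j < n \<and> (i \<in> S \<and> j \<in> T \<or> i \<in> T \<and> j \<in> S)}"

lemma finite_edge_pairs [simp]: "finite (edge_pairs n S T)"
  by (rule finite_subset[of _ "{..<n} \<times> {..<n}"]) (auto simp: edge_pairs_def)

text \<open>Orienting each pair from \<open>S\<close> to \<open>T\<close> is injective, because the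
  order of the endpoints recovers the pair.\<close>

lemma card_edge_pairs:
  assumes "finite S" "finite T"
  shows "card (edge_pairs n S T) \<le> card S * card T"
proof -
  let ?f = "\<lambda>(i, j). if i \<in> S \<and> j \<in> T then (i, j) else (j, i)"
  have "card (edge_pairs n S T) = card (?f ` edge_pairs n S T)"
    by (intro card_image[symmetric] inj_onI) (auto simp: edge_pairs_def split: if_splits)
  also have "\<dots> \<le> card (S \<times> T)"
    using assms by (intro card_mono) (auto simp: edge_pairs_def split: if_splits)
  finally show ?thesis by (simp add: card_cartesian_product)
qed

text \<open>\<open>N\<close> counts edges; \<open>p\<close> bounds the edge probability.\<close>

definition discrepancy :: "nat \<Rightarrow> real \<Rightarrow> (nat \<times> nat \<Rightarrow> real) \<Rightarrow> bool" where
  "discrepancy n p N \<longleftrightarrow> (\<forall>S T. S \<subseteq> {..<n} \<longrightarrow> T \<subseteq> {..<n} \<longrightarrow> S \<noteq> {} \<longrightarrow> card S \<le> card T \<longrightarrow>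
     sum N (edge_pairs n S T) \<le> 8 * p * card S * card T \<or>
     sum N (edge_pairs n S T) * ln (sum N (edge_pairs n S T) / (p * card S * card T)) \<le> 16 * set_entropy n (card T))"

text \<open>A level of normalised mass \<beta> has t = n * \<beta> / 4 ^ b vertices, so its entropy
  involves 1 + b * ln 4 + ln (1 / \<beta>); the last logarithm is removed by
  \<open>mult_ln_inverse_le\<close> with y = b.\<close>

lemma set_entropy_le:
  assumes n: "0 < n" and t: "0 < t"
    and \<beta>: "real t * 4 ^ b = n * \<beta>"
  shows "set_entropy n t \<le> n / 4 ^ b * (3 * \<beta> * (real b + 1) + exp (- real b))"
proof -
  have \<beta>0: "0 < \<beta>" using n t \<beta> by (metis mult_pos_pos of_nat_0_less_iff zero_less_mult_pos zero_less_numeral zero_less_power)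
  have t': "real t = n * \<beta> / 4 ^ b" using \<beta> by (simp add: field_simps)
  have "exp 1 * n / t = exp 1 * 4 ^ b * (1 / \<beta>)" using n \<beta>0 unfolding t' by (simp add: field_simps)
  then have "ln (exp 1 * n / t) = 1 + real b * ln 4 + ln (1 / \<beta>)"
    using \<beta>0 by (simp add: ln_mult ln_realpow ln_div)
  then have "set_entropy n t = n / 4 ^ b * (\<beta> * (1 + real b * ln 4) + \<beta> * ln (1 / \<beta>))"
    unfolding set_entropy_def by (simp add: t' algebra_simps)
  also have "\<dots> \<le> n / 4 ^ b * (\<beta> * (1 + real b * 2) + (\<beta> * b + exp (- real b)))"
  proof -
    have "ln (4::real) = 2 * ln 2" using ln_realpow[of "2::real" 2] by simp
    then have "ln (4::real) \<le> 2" using ln_2_less_1 by simp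
    then have "\<beta> * (1 + real b * ln 4) \<le> \<beta> * (1 + real b * 2)"
      using \<beta>0 by (intro mult_left_mono add_left_mono) auto
    then have "\<beta> * (1 + real b * ln 4) + \<beta> * ln (1 / \<beta>) \<le> \<beta> * (1 + real b * 2) + (\<beta> * b + exp (- real b))"
      using mult_ln_inverse_le[OF \<beta>0, of b] by linarith
    then show ?thesis by (intro mult_left_mono) auto
  qed
  also have "\<dots> \<le> n / 4 ^ b * (3 * \<beta> * (real b + 1) + exp (- real b))"
    using \<beta>0 by (intro mult_left_mono) (auto simp: algebra_simps)
  finally show ?thesis .
qed

lemma sum_le_sum_cover:
  fixes f :: "'a \<Rightarrow> real"
  assumes "finite I" "\<And>i. i \<in> I \<Longrightarrow> finite (A i)" "E \<subseteq> (\<Union>i\<in>I. A i)" "\<And>e. 0 \<le> f e"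
  shows "sum f E \<le> (\<Sum>i\<in>I. sum f (A i))"
proof -
  have "sum f E \<le> sum f (\<Union>i\<in>I. A i)" using assms by (intro sum_mono2) auto
  also have "\<dots> \<le> (\<Sum>i\<in>I. sum f (A i))" using assms(1,2)
  proof (induction I)
    case (insert i I)
    have "sum f (A i \<union> (\<Union>i\<in>I. A i)) \<le> sum f (A i) + sum f (\<Union>i\<in>I. A i)"
      using insert assms(4) by (subst sum_Un) (auto intro!: sum_nonneg)
    with insert show ?case by simp
  qed simp
  finally show ?thesis .
qed

text \<open>Feige and Ofek's bound. Pairs are sorted by the dyadic levels \<open>a\<close>, \<open>b\<close> of their endpoints, \<open>b\<close> being
  the level with more vertices, and \<open>\<beta> b\<close> is the normalised mass of a level. \<open>T1\<close> pays for the expected number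
  of edges; \<open>T2\<close> uses the degree bound when level \<open>a\<close> is much higher; otherwise the number of edges is at most a
  multiple of the entropy, which is affordable if \<open>2 ^ a\<close> is small (\<open>T3\<close>) and is divided by a large
  logarithm if \<open>2 ^ a\<close> is big (\<open>T4\<close>).\<close>

lemma heavy_pairs_bound:
  fixes z :: "nat \<Rightarrow> real" and N :: "nat \<times> nat \<Rightarrow> real"
  assumes disc: "discrepancy n p N" and N: "\<And>e. 0 \<le> N e"
    and n: "0 < n" and D: "D = n * p" "1 \<le> D" and K: "0 \<le> K"
    and z: "(\<Sum>i<n. (z i)\<^sup>2) \<le> 4 * n" "\<And>i. i < n \<Longrightarrow> z i = 0 \<or> 1 \<le> \<bar>z i\<bar>"
    and deg: "\<And>i. i < n \<Longrightarrow> z i \<noteq> 0 \<Longrightarrow> sum N (edge_pairs n {i} {..<n}) \<le> K * D"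
  shows "(\<Sum>(i, j) | i < j \<and> j < n \<and> sqrt D < \<bar>z i * z j\<bar>. N (i, j) * \<bar>z i * z j\<bar>)
    \<le> (9120 + 32 * K) * n * sqrt D"
proof -
  \<comment> \<open>Enough levels: 4 ^ m > 4 * n, and no |z i| exceeds 2 * sqrt n.\<close>
  define m where "m = n + 1"
  define r where "r = sqrt D"
  have r1: "1 \<le> r" and rr: "r * r = D" using D by (auto simp: r_def)
  have p0: "0 < p" using D n by (metis mult_not_zero not_one_le_zero of_nat_0_less_iff order_less_le zero_le_mult_iff not_le mult_nonneg_nonpos2 of_nat_0_le_iff order_trans zero_le_one)
  define S where "S a = {i. i < n \<and> 2 ^ a \<le> \<bar>z i\<bar> \<and> \<bar>z i\<bar> < 2 ^ Suc a}" for a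
  have finS [simp]: "finite (S a)" for a by (simp add: S_def)
  have Sn: "S a \<subseteq> {..<n}" for a by (auto simp: S_def)
  \<comment> \<open>Every vertex of level \<open>a\<close> carries at least 4 ^ a of the squared
    norm, so the masses \<beta> add up to at most 4.\<close>
  define \<beta> where "\<beta> a = real (card (S a)) * 4 ^ a / n" for a
  have \<beta>0: "0 \<le> \<beta> a" for a by (simp add: \<beta>_def)
  have card_S: "real (card (S a)) = n * \<beta> a / 4 ^ a" for a using n by (simp add: \<beta>_def)
  define e where "e a b = sum N (edge_pairs n (S a) (S b))" for a b
  have e0: "0 \<le> e a b" for a b by (simp add: e_def sum_nonneg N)
  \<comment> \<open>A product between levels \<open>a\<close> and \<open>b\<close> is below 2 ^ (a +
    b + 2), so only these pairs of levels can contain heavy pairs. The smaller level is put first,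
    as \<open>discrepancy\<close> requires.\<close>
  define H where "H = {(a, b). a < m \<and> b < m \<and> S a \<noteq> {} \<and> card (S a) \<le> card (S b) \<and> r < 2 ^ (a + b + 2)}"
  have finH: "finite H" by (rule finite_subset[of _ "{..<m} \<times> {..<m}"]) (auto simp: H_def)
  have level: "\<exists>a<m. i \<in> S a" if "i < n" "z i \<noteq> 0" for i
  proof -
    have "(z i)\<^sup>2 \<le> (\<Sum>i<n. (z i)\<^sup>2)" using that by (intro member_le_sum) auto
    also have "\<dots> \<le> 4 * real n" by (rule z)
    also have "4 * real n < real (4 ^ m)"
    proof -
      have "n < 4 ^ n" by (rule less_exp[THEN less_le_trans]) (simp add: power_mono)
      then have "4 * n < 4 ^ m" by (simp add: m_def)
      then show ?thesis by (metis of_nat_less_iff of_nat_mult of_nat_numeral)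
    qed
    also have "real (4 ^ m) = (2 ^ m)\<^sup>2" by (simp add: power2_eq_square power_mult_distrib[symmetric])
    finally have "\<bar>z i\<bar>\<^sup>2 < (2 ^ m)\<^sup>2" by simp
    then have "\<bar>z i\<bar> < 2 ^ m" by (rule power2_less_imp_less) simp
    with z(2)[of i] that dyadic_level[of "\<bar>z i\<bar>" m] show ?thesis by (auto simp: S_def)
  qed
  have \<beta>_sum: "(\<Sum>a<m. \<beta> a) \<le> 4"
  proof -
    have "(\<Sum>a<m. real (card (S a)) * 4 ^ a) \<le> (\<Sum>a<m. \<Sum>i\<in>S a. (z i)\<^sup>2)"
    proof (rule sum_mono)
      fix a
      have "4 ^ a \<le> (z i)\<^sup>2" if "i \<in> S a" for i
      proof -
        have "(2 ^ a)\<^sup>2 \<le> \<bar>z i\<bar>\<^sup>2" using that by (intro power_mono) (auto simp: S_def)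
        also have "((2::real) ^ a)\<^sup>2 = (2\<^sup>2) ^ a" by (metis power_mult mult.commute)
        finally show ?thesis by simp
      qed
      then show "real (card (S a)) * 4 ^ a \<le> (\<Sum>i\<in>S a. (z i)\<^sup>2)"
        using sum_bounded_below[of "S a" "4 ^ a" "\<lambda>i. (z i)\<^sup>2"] by simp
    qed
    also have "\<dots> = (\<Sum>i\<in>(\<Union>a<m. S a). (z i)\<^sup>2)"
    proof (rule sum.UNION_disjoint[symmetric])
      show "\<forall>a\<in>{..<m}. \<forall>b\<in>{..<m}. a \<noteq> b \<longrightarrow> S a \<inter> S b = {}"
      proof (intro ballI impI)
        fix a b :: nat assume "a \<noteq> b"
        have "False" if "i \<in> S a" "i \<in> S b" "a < b" for i a b
        proof -
          have "(2::real) ^ Suc a \<le> 2 ^ b" using that by (intro power_increasing) auto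
          with that show False by (auto simp: S_def)
        qed
        then show "S a \<inter> S b = {}" using \<open>a \<noteq> b\<close> by (metis disjoint_iff nat_neq_iff)
      qed
    qed auto
    also have "\<dots> \<le> (\<Sum>i<n. (z i)\<^sup>2)" using Sn by (intro sum_mono2) auto
    also have "\<dots> \<le> 4 * real n" by (rule z)
    finally show ?thesis using n by (simp add: \<beta>_def sum_divide_distrib[symmetric] field_simps)
  qed
  let ?f = "\<lambda>(i, j). N (i, j) * \<bar>z i * z j\<bar>"
  have "(\<Sum>(i, j) | i < j \<and> j < n \<and> sqrt D < \<bar>z i * z j\<bar>. N (i, j) * \<bar>z i * z j\<bar>)
     \<le> (\<Sum>(a, b)\<in>H. sum ?f (edge_pairs n (S a) (S b)))"
  proof -
    have "{(i, j). i < j \<and> j < n \<and> sqrt D < \<bar>z i * z j\<bar>} \<subseteq> (\<Union>(a, b)\<in>H. edge_pairs n (S a) (S b))"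
    proof clarify
      fix i j assume ij: "i < j" "j < n" "sqrt D < \<bar>z i * z j\<bar>"
      have nz: "z i \<noteq> 0" "z j \<noteq> 0" using ij(3) r1 unfolding r_def by auto
      obtain a b where ab: "a < m" "i \<in> S a" "b < m" "j \<in> S b" using level[of i] level[of j] ij nz by auto
      have "\<bar>z i\<bar> * \<bar>z j\<bar> \<le> 2 ^ Suc a * 2 ^ Suc b" using ab by (intro mult_mono) (auto simp: S_def)
      then have h: "r < 2 ^ (a + b + 2)" using ij(3) by (simp add: abs_mult r_def power_add)
      show "(i, j) \<in> (\<Union>(a, b)\<in>H. edge_pairs n (S a) (S b))"
      proof (cases "card (S a) \<le> card (S b)")
        case True
        then have "(a, b) \<in> H" using ab h by (auto simp: H_def)
        moreover have "(i, j) \<in> edge_pairs n (S a) (S b)" using ab ij by (auto simp: edge_pairs_def)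
        ultimately show ?thesis by blast
      next
        case False
        then have "(b, a) \<in> H" using ab h by (auto simp: H_def add.commute)
        moreover have "(i, j) \<in> edge_pairs n (S b) (S a)" using ab ij by (auto simp: edge_pairs_def)
        ultimately show ?thesis by blast
      qed
    qed
    then show ?thesis
      using sum_le_sum_cover[OF finH, of "\<lambda>(a, b). edge_pairs n (S a) (S b)" _ ?f] N
      by (auto simp: case_prod_unfold)
  qed
  also have "\<dots> \<le> (\<Sum>(a, b)\<in>H. 4 * (2 ^ (a + b) * e a b))"
  proof (rule sum_mono, clarify)
    fix a b
    have "sum ?f (edge_pairs n (S a) (S b)) \<le> (\<Sum>x\<in>edge_pairs n (S a) (S b). N x * (4 * 2 ^ (a + b)))"
    proof (rule sum_mono, clarify)
      fix i j assume "(i, j) \<in> edge_pairs n (S a) (S b)"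
      then have "\<bar>z i\<bar> * \<bar>z j\<bar> \<le> 2 ^ Suc a * 2 ^ Suc b \<or> \<bar>z j\<bar> * \<bar>z i\<bar> \<le> 2 ^ Suc a * 2 ^ Suc b"
        unfolding edge_pairs_def by (auto simp: S_def simp del: power_Suc intro!: mult_mono)
      then have "\<bar>z i * z j\<bar> \<le> 4 * 2 ^ (a + b)" by (auto simp: abs_mult power_add mult.commute)
      then show "N (i, j) * \<bar>z i * z j\<bar> \<le> N (i, j) * (4 * 2 ^ (a + b))" by (intro mult_left_mono N)
    qed
    then show "sum ?f (edge_pairs n (S a) (S b)) \<le> 4 * (2 ^ (a + b) * e a b)"
      by (simp add: e_def sum_distrib_right[symmetric] ac_simps)
  qed
  also have "\<dots> = 4 * (\<Sum>(a, b)\<in>H. 2 ^ (a + b) * e a b)"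
    by (simp add: sum_distrib_left case_prod_unfold)
  finally have main: "(\<Sum>(i, j) | i < j \<and> j < n \<and> sqrt D < \<bar>z i * z j\<bar>. N (i, j) * \<bar>z i * z j\<bar>)
     \<le> 4 * (\<Sum>(a, b)\<in>H. 2 ^ (a + b) * e a b)" .

  define T1 where "T1 a b = 32 * n * r * \<beta> a * \<beta> b" for a b
  define T2 where "T2 a b = (if 2 ^ b \<le> 2 ^ a / r then 2 ^ b * (K * D * n * \<beta> a / 2 ^ a) else 0)" for a b :: nat
  define T3 where "T3 a b = (if 2 ^ a \<le> r * sqrt (2 ^ b) then
     2 ^ a * (n / 2 ^ b * (8 * (3 * \<beta> b * (real b + 1) + exp (- real b)))) else 0)" for a b :: nat
  define T4 where "T4 a b = (if 2 ^ a \<le> r * 2 ^ b then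
     2 ^ a * (n / 2 ^ b * (145 * \<beta> b + 48 * exp (- real b))) else 0)" for a b :: nat
  have T_nonneg: "0 \<le> T1 a b" "0 \<le> T2 a b" "0 \<le> T3 a b" "0 \<le> T4 a b" for a b
    using \<beta>0 r1 K D(2) by (auto simp: T1_def T2_def T3_def T4_def intro!: mult_nonneg_nonneg add_nonneg_nonneg)
  have step: "2 ^ (a + b) * e a b \<le> T1 a b + T2 a b + T3 a b + T4 a b" if "(a, b) \<in> H" for a b
  proof -
    have H: "a < m" "b < m" "S a \<noteq> {}" "card (S a) \<le> card (S b)" "r < 2 ^ (a + b + 2)" using that by (auto simp: H_def)
    have sa: "0 < card (S a)" using H by (simp add: card_gt_0_iff)
    have tb: "0 < card (S b)" using sa H by simp
    have \<beta>pos: "0 < \<beta> a" "0 < \<beta> b" using sa tb n by (auto simp: \<beta>_def)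
    have four: "(4::real) ^ k = 2 ^ k * 2 ^ k" for k by (simp add: power_mult_distrib[symmetric])
    let ?lam = "e a b / (p * card (S a) * card (S b))"
    have den: "0 < p * card (S a) * card (S b)" using p0 sa tb by simp
    consider "e a b \<le> 8 * p * card (S a) * card (S b)"
      | "8 * p * card (S a) * card (S b) < e a b" "2 ^ b \<le> 2 ^ a / r"
      | "8 * p * card (S a) * card (S b) < e a b" "\<not> 2 ^ b \<le> 2 ^ a / r" by linarith
    then show ?thesis
    proof cases
      case 1
      have "2 ^ (a + b) * e a b \<le> 2 ^ (a + b) * (8 * p * card (S a) * card (S b))" using 1 by (intro mult_left_mono) auto
      also have "\<dots> = 8 * n * D * \<beta> a * \<beta> b / 2 ^ (a + b)"
        using n unfolding card_S D(1) four power_add by (simp add: field_simps)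
      \<comment> \<open>Heaviness enters here: r < 2 ^ (a + b + 2) bounds the last quotient by 4 and
        saves one factor sqrt D.\<close>
      also have "\<dots> = 8 * n * r * \<beta> a * \<beta> b * (r / 2 ^ (a + b))" by (simp add: rr[symmetric])
      also have "\<dots> \<le> 8 * n * r * \<beta> a * \<beta> b * 4"
        using H(5) r1 \<beta>0 by (intro mult_left_mono) (auto simp: field_simps)
      also have "\<dots> = T1 a b" by (simp add: T1_def)
      finally show ?thesis using T_nonneg[of a b] by linarith
    next
      case 2
      have "e a b \<le> (\<Sum>i\<in>S a. sum N (edge_pairs n {i} {..<n}))"
        unfolding e_def by (rule sum_le_sum_cover) (auto simp: N, auto simp: edge_pairs_def S_def)
      also have "\<dots> \<le> card (S a) * (K * D)"
      proof (rule sum_bounded_above)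
        fix i assume i: "i \<in> S a"
        have "(0::real) < 2 ^ a" by simp
        with i have "z i \<noteq> 0" by (auto simp: S_def simp del: zero_less_power)
        then show "sum N (edge_pairs n {i} {..<n}) \<le> K * D" using i deg by (auto simp: S_def)
      qed
      finally have "2 ^ (a + b) * e a b \<le> 2 ^ (a + b) * (card (S a) * (K * D))" by (intro mult_left_mono) auto
      also have "\<dots> = T2 a b" using 2 unfolding card_S four power_add T2_def by (simp add: field_simps)
      finally show ?thesis using T_nonneg[of a b] by linarith
    next
      case 3
      have a: "2 ^ a \<le> r * 2 ^ b" using 3 r1 by (simp add: field_simps)
      have lam8: "8 < ?lam" using 3(1) den by (simp add: field_simps)
      have ln8: "2 \<le> ln (8::real)"
      proof -
        have "exp 1 ^ 2 \<le> (272 / 100 :: real)\<^sup>2" using e_less_272 by (intro power_mono) auto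
        then have "exp 2 \<le> (8::real)" using exp_double[of "1::real"] by (simp add: power2_eq_square)
        then show ?thesis by (simp add: ln_ge_iff)
      qed
      then have lnlam: "2 \<le> ln ?lam" using lam8 ln_mono[of 8 ?lam] by linarith
      have "card (S a) \<le> card (S b)" "S a \<subseteq> {..<n}" "S b \<subseteq> {..<n}" using H Sn by auto
      then have "e a b * ln ?lam \<le> 16 * set_entropy n (card (S b))"
        using disc H(3) 3(1) unfolding discrepancy_def e_def by (metis not_le)
      also have "\<dots> \<le> 16 * (n / 4 ^ b * (3 * \<beta> b * (real b + 1) + exp (- real b)))"
        using n tb by (intro mult_left_mono set_entropy_le) (auto simp: \<beta>_def)
      finally have E: "e a b * ln ?lam \<le> 16 * (n / 4 ^ b * (3 * \<beta> b * (real b + 1) + exp (- real b)))" .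
      show ?thesis
      proof (cases "2 ^ a \<le> r * sqrt (2 ^ b)")
        case True
        have "e a b * 2 \<le> e a b * ln ?lam" using lnlam e0 by (intro mult_left_mono) auto
        with E have "e a b \<le> 8 * (n / 4 ^ b * (3 * \<beta> b * (real b + 1) + exp (- real b)))" by linarith
        then have "e a b \<le> n / 4 ^ b * (8 * (3 * \<beta> b * (real b + 1) + exp (- real b)))"
          by (simp only: mult.left_commute[of 8])
        then have "2 ^ (a + b) * e a b \<le> 2 ^ (a + b) * (n / 4 ^ b * (8 * (3 * \<beta> b * (real b + 1) + exp (- real b))))"
          by (intro mult_left_mono) auto
        also have "\<dots> = T3 a b" using True unfolding T3_def four power_add by simp
        finally show ?thesis using T_nonneg[of a b] by linarith
      next
        case False
        \<comment> \<open>If there are at most \<open>card (S b)\<close> edges, the bound holds with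
          the single term \<beta> b, which is the difference between 145 and 144. Otherwise the
          ratio of observed to expected edges exceeds 1 / (p * card (S a)), and its logarithm can be
          used.\<close>
        have "e a b \<le> n / 4 ^ b * (145 * \<beta> b + 48 * exp (- real b))"
        proof (cases "e a b \<le> card (S b)")
          case True
          have "n / 4 ^ b * \<beta> b \<le> n / 4 ^ b * (145 * \<beta> b + 48 * exp (- real b))"
            using \<beta>0[of b] by (intro mult_left_mono) (auto intro: add_increasing2)
          with True show ?thesis unfolding card_S by simp
        next
          case t: False
          have "1 / (p * card (S a)) < ?lam" using t den tb sa p0 by (simp add: field_simps)
          also have "1 / (p * card (S a)) = 4 ^ a / (D * \<beta> a)" using n unfolding card_S D(1) by simp
          finally have 1: "4 ^ a / (D * \<beta> a) < ?lam" .
          have "\<beta> a \<le> (\<Sum>a<m. \<beta> a)" using H(1) \<beta>0 by (intro member_le_sum) auto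
          then have \<beta>4: "\<beta> a \<le> 4" using \<beta>_sum by simp
          have "(r * sqrt (2 ^ b))\<^sup>2 \<le> (2 ^ a)\<^sup>2" using False r1 by (intro power_mono) auto
          then have "D * 2 ^ b \<le> 4 ^ a" using D(2) by (simp add: power_mult_distrib power2_eq_square[of r] rr four power2_eq_square[of "2 ^ a"])
          then have "2 ^ b / 4 \<le> 4 ^ a / (D * 4)" using D(2) by (simp add: field_simps)
          also have "\<dots> \<le> 4 ^ a / (D * \<beta> a)" using D(2) \<beta>4 \<beta>pos by (intro divide_left_mono mult_left_mono) auto
          finally have "2 ^ b / 4 \<le> ?lam" using 1 by linarith
          \<comment> \<open>The ratio exceeds both 8 and 2 ^ b / 4. The product of the two bounds is
            2 ^ (b + 1), so the logarithm of the ratio is at least (b + 1) / 3 and cancels the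
            factor b + 1 of the entropy.\<close>
          then have "8 * (2 ^ b / 4) \<le> ?lam * ?lam" using lam8 by (intro mult_mono) auto
          then have "2 ^ (b + 1) \<le> ?lam * ?lam" by simp
          then have "ln (2 ^ (b + 1)) \<le> ln (?lam * ?lam)" by (intro ln_mono) auto
          also have "ln (?lam * ?lam) = 2 * ln ?lam" using lam8 by (subst ln_mult) auto
          also have "ln (2 ^ (b + 1)) = (real b + 1) * ln (2::real)" by (subst ln_realpow) simp_all
          finally have "(real b + 1) * ln 2 \<le> 2 * ln ?lam" .
          moreover have "(real b + 1) * (2 / 3) \<le> (real b + 1) * ln (2::real)"
            using ln2_ge_two_thirds by (intro mult_left_mono) auto
          ultimately have "(real b + 1) / 3 \<le> ln ?lam" by simp
          then have "e a b * ((real b + 1) / 3) \<le> e a b * ln ?lam" using e0 by (intro mult_left_mono)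
          with E have "e a b * ((real b + 1) / 3) \<le> 16 * (n / 4 ^ b * (3 * \<beta> b * (real b + 1) + exp (- real b)))" by linarith
          then have "e a b * (real b + 1) \<le> 48 * (n / 4 ^ b * (3 * \<beta> b * (real b + 1) + exp (- real b)))" by linarith
          have aux: "48 * (x * (3 * y * c + u * c)) = x * (144 * y + 48 * u) * c" for x y c u :: real
            by (simp add: algebra_simps)
          note \<open>e a b * (real b + 1) \<le> 48 * (n / 4 ^ b * (3 * \<beta> b * (real b + 1) + exp (- real b)))\<close>
          also have "48 * (n / 4 ^ b * (3 * \<beta> b * (real b + 1) + exp (- real b))) \<le> 48 * (n / 4 ^ b * (3 * \<beta> b * (real b + 1) + exp (- real b) * (real b + 1)))"
            by (intro mult_left_mono add_left_mono) auto
          also have "\<dots> = (n / 4 ^ b * (144 * \<beta> b + 48 * exp (- real b))) * (real b + 1)" by (rule aux)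
          finally have "e a b \<le> n / 4 ^ b * (144 * \<beta> b + 48 * exp (- real b))"
            by (rule mult_right_le_imp_le) simp
          also have "\<dots> \<le> n / 4 ^ b * (145 * \<beta> b + 48 * exp (- real b))"
            using \<beta>0 by (intro mult_left_mono add_right_mono mult_right_mono) auto
          finally show ?thesis .
        qed
        then have "2 ^ (a + b) * e a b \<le> 2 ^ (a + b) * (n / 4 ^ b * (145 * \<beta> b + 48 * exp (- real b)))"
          by (intro mult_left_mono) auto
        also have "\<dots> = T4 a b" using a unfolding T4_def four power_add by simp
        finally show ?thesis using T_nonneg[of a b] by linarith
      qed
    qed
  qed
  have S1: "(\<Sum>a<m. \<Sum>b<m. T1 a b) \<le> 512 * n * r"
  proof -
    have "(\<Sum>a<m. \<Sum>b<m. T1 a b) = 32 * n * r * ((\<Sum>a<m. \<beta> a) * (\<Sum>b<m. \<beta> b))"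
      unfolding T1_def sum_product by (simp add: sum_distrib_left mult.assoc)
    also have "\<dots> \<le> 32 * n * r * (4 * 4)"
      using \<beta>_sum r1 \<beta>0 by (intro mult_left_mono mult_mono) (auto intro!: sum_nonneg)
    finally show ?thesis by simp
  qed
  have cond_sum: "(\<Sum>a<m. if 2 ^ a \<le> x then 2 ^ a * c else 0) \<le> 2 * x * c"
    if "0 \<le> x" "0 \<le> c" for x c :: real
  proof -
    have "(\<Sum>a<m. if 2 ^ a \<le> x then 2 ^ a * c else 0) = (\<Sum>a | a < m \<and> 2 ^ a \<le> x. 2 ^ a) * c"
      unfolding sum_distrib_right by (rule sum.mono_neutral_cong_right) auto
    also have "\<dots> \<le> 2 * x * c" using that by (intro mult_right_mono sum_power2_below)
    finally show ?thesis .
  qed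
  \<comment> \<open>For fixed \<open>a\<close> the powers 2 ^ b run up to 2 ^ a / r only, so their
    sum cancels the 2 ^ a in the denominator and turns D into r.\<close>
  have S2: "(\<Sum>a<m. \<Sum>b<m. T2 a b) \<le> 8 * K * n * r"
  proof -
    have "(\<Sum>a<m. \<Sum>b<m. T2 a b) \<le> (\<Sum>a<m. 2 * K * n * r * \<beta> a)"
    proof (rule sum_mono)
      fix a
      have "(\<Sum>b<m. T2 a b) \<le> 2 * (2 ^ a / r) * (K * D * n * \<beta> a / 2 ^ a)"
        unfolding T2_def using K D(2) \<beta>0 r1 by (intro cond_sum) auto
      also have "\<dots> = 2 * K * n * r * \<beta> a" using r1 by (simp add: rr[symmetric] field_simps)
      finally show "(\<Sum>b<m. T2 a b) \<le> 2 * K * n * r * \<beta> a" .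
    qed
    also have "\<dots> \<le> 2 * K * n * r * 4" unfolding sum_distrib_left[symmetric]
      using K r1 \<beta>_sum by (intro mult_left_mono) auto
    finally show ?thesis by simp
  qed
  have S3: "(\<Sum>b<m. \<Sum>a<m. T3 a b) \<le> 416 * n * r"
  proof -
    have "(\<Sum>b<m. \<Sum>a<m. T3 a b) \<le> (\<Sum>b<m. 16 * n * r * (6 * \<beta> b + exp (- real b)))"
    proof (rule sum_mono)
      fix b
      let ?q = "sqrt (2 ^ b)"
      have q: "1 \<le> ?q" "?q * ?q = 2 ^ b" by auto
      have aux: "2 * (r * q) * (n / (q * q) * (8 * P)) = 16 * n * r * (P / q)" if "0 < q" for q P
        using that by (simp add: field_simps)
      have "(\<Sum>a<m. T3 a b) \<le> 2 * (r * ?q) * (n / 2 ^ b * (8 * (3 * \<beta> b * (real b + 1) + exp (- real b))))"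
        unfolding T3_def using r1 \<beta>0 by (intro cond_sum) auto
      also have "\<dots> = 16 * n * r * ((3 * \<beta> b * (real b + 1) + exp (- real b)) / ?q)"
        using aux[of ?q "3 * \<beta> b * (real b + 1) + exp (- real b)", unfolded q(2)] q(1) by simp
      \<comment> \<open>The stricter limit on 2 ^ a leaves a spare factor 1 / sqrt (2 ^ b), which
        absorbs b + 1.\<close>
      also have "\<dots> \<le> 16 * n * r * (6 * \<beta> b + exp (- real b))"
      proof (rule mult_left_mono)
        have "3 * \<beta> b * (real b + 1) \<le> 3 * \<beta> b * (2 * ?q)"
          using \<beta>0 Suc_le_two_sqrt_power2[of b] by (intro mult_left_mono) auto
        moreover have "exp (- real b) * 1 \<le> exp (- real b) * ?q" using q by (intro mult_left_mono) auto
        ultimately have "3 * \<beta> b * (real b + 1) + exp (- real b) \<le> (6 * \<beta> b + exp (- real b)) * ?q"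
          by (simp only: distrib_right mult.assoc)
        then show "(3 * \<beta> b * (real b + 1) + exp (- real b)) / ?q \<le> 6 * \<beta> b + exp (- real b)"
          using q by (simp add: divide_le_eq)
      qed (use r1 in auto)
      finally show "(\<Sum>a<m. T3 a b) \<le> 16 * n * r * (6 * \<beta> b + exp (- real b))" .
    qed
    also have "\<dots> \<le> 16 * n * r * (6 * 4 + 2)"
      unfolding sum_distrib_left[symmetric] sum.distrib
      using \<beta>_sum sum_exp_neg_le_two[of m] r1 by (intro mult_left_mono add_mono) auto
    finally show ?thesis by simp
  qed
  have S4: "(\<Sum>b<m. \<Sum>a<m. T4 a b) \<le> 1352 * n * r"
  proof -
    have "(\<Sum>b<m. \<Sum>a<m. T4 a b) \<le> (\<Sum>b<m. 2 * n * r * (145 * \<beta> b + 48 * exp (- real b)))"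
    proof (rule sum_mono)
      fix b
      have "(\<Sum>a<m. T4 a b) \<le> 2 * (r * 2 ^ b) * (n / 2 ^ b * (145 * \<beta> b + 48 * exp (- real b)))"
        unfolding T4_def using r1 \<beta>0 by (intro cond_sum) auto
      also have "\<dots> = 2 * n * r * (145 * \<beta> b + 48 * exp (- real b))" by simp
      finally show "(\<Sum>a<m. T4 a b) \<le> 2 * n * r * (145 * \<beta> b + 48 * exp (- real b))" .
    qed
    also have "\<dots> \<le> 2 * n * r * (145 * 4 + 48 * 2)"
      unfolding sum_distrib_left[symmetric] sum.distrib
      using \<beta>_sum sum_exp_neg_le_two[of m] r1 by (intro mult_left_mono add_mono) auto
    finally show ?thesis by simp
  qed
  have "(\<Sum>(a, b)\<in>H. 2 ^ (a + b) * e a b) \<le> (\<Sum>(a, b)\<in>H. T1 a b + T2 a b + T3 a b + T4 a b)"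
    using step by (intro sum_mono) auto
  also have "\<dots> \<le> (\<Sum>(a, b)\<in>{..<m} \<times> {..<m}. T1 a b + T2 a b + T3 a b + T4 a b)"
    using T_nonneg by (intro sum_mono2) (auto simp: H_def intro!: add_nonneg_nonneg)
  also have "\<dots> = (\<Sum>a<m. \<Sum>b<m. T1 a b) + (\<Sum>a<m. \<Sum>b<m. T2 a b) + (\<Sum>b<m. \<Sum>a<m. T3 a b) + (\<Sum>b<m. \<Sum>a<m. T4 a b)"
    unfolding sum.cartesian_product[symmetric] sum.distrib
    using sum.swap[of T3 "{..<m}" "{..<m}"] sum.swap[of T4 "{..<m}" "{..<m}"] by simp
  \<comment> \<open>512 + 416 + 1352 = 2280; the factor 4 of \<open>main\<close> yields 9120 + 32 *
    K.\<close>
  also have "\<dots> \<le> (2280 + 8 * K) * n * r" using S1 S2 S3 S4 by (simp add: algebra_simps)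
  finally show ?thesis using main by (simp add: r_def algebra_simps)
qed

section \<open>Exponential moments and union bounds\<close>

text \<open>Exponential moments are kept as extended nonnegative integrals throughout, so Chernoff
  bounds carry no integrability conditions.\<close>

lemma (in prob_space) exp_markov:
  assumes f: "f \<in> borel_measurable M"
    and b: "(\<integral>\<^sup>+\<omega>. ennreal (exp (f \<omega>)) \<partial>M) \<le> ennreal (exp c)"
  shows "prob {\<omega> \<in> space M. t \<le> f \<omega>} \<le> exp (c - t)"
proof -
  have "emeasure M {\<omega> \<in> space M. t \<le> f \<omega>}
      \<le> ennreal (exp (- 1 * t)) * nn_integral M (\<lambda>x. ennreal (exp (1 * f x)) * indicator (space M) x)"
    using Chernoff_ineq_nn_integral_ge[of 1 "space M" M f t] f by simp
  also have "nn_integral M (\<lambda>x. ennreal (exp (1 * f x)) * indicator (space M) x) = (\<integral>\<^sup>+\<omega>. ennreal (exp (f \<omega>)) \<partial>M)"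
    by (intro nn_integral_cong) auto
  also have "ennreal (exp (- 1 * t)) * \<dots> \<le> ennreal (exp (- 1 * t)) * ennreal (exp c)"
    by (intro mult_left_mono b) auto
  also have "\<dots> = ennreal (exp (c - t))" by (simp add: ennreal_mult[symmetric] exp_add[symmetric])
  finally show ?thesis by (simp add: emeasure_eq_measure)
qed

text \<open>Independence factorises the moment. The transformation \<open>g\<close> may vary with
  the index, so that gauge, centring and test vector can be built into it.\<close>

lemma (in prob_space) mgf_sum_le:
  fixes X :: "'i \<Rightarrow> 'a \<Rightarrow> real"
  assumes ind: "indep_vars (\<lambda>_. borel) X I" and E: "finite E" "E \<subseteq> I"
    and g: "\<And>e. e \<in> E \<Longrightarrow> g e \<in> borel_measurable borel"
    and b: "\<And>e. e \<in> E \<Longrightarrow> (\<integral>\<^sup>+\<omega>. ennreal (exp (g e (X e \<omega>))) \<partial>M) \<le> ennreal (exp (c e))"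
  shows "(\<integral>\<^sup>+\<omega>. ennreal (exp (\<Sum>e\<in>E. g e (X e \<omega>))) \<partial>M) \<le> ennreal (exp (\<Sum>e\<in>E. c e))"
proof -
  have indE: "indep_vars (\<lambda>_. borel) X E" using ind E(2) by (rule indep_vars_subset)
  have "(\<integral>\<^sup>+\<omega>. ennreal (exp (\<Sum>e\<in>E. g e (X e \<omega>))) \<partial>M) = (\<integral>\<^sup>+\<omega>. (\<Prod>e\<in>E. ennreal (exp (g e (X e \<omega>)))) \<partial>M)"
    by (simp add: exp_sum E prod_ennreal)
  also have "\<dots> = (\<Prod>e\<in>E. \<integral>\<^sup>+\<omega>. ennreal (exp (g e (X e \<omega>))) \<partial>M)"
    using g by (intro indep_vars_nn_integral E(1) indep_vars_compose2[OF indE]) auto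
  also have "\<dots> \<le> (\<Prod>e\<in>E. ennreal (exp (c e)))"
    by (intro prod_mono_ennreal b)
  also have "\<dots> = ennreal (exp (\<Sum>e\<in>E. c e))" by (simp add: exp_sum E prod_ennreal)
  finally show ?thesis .
qed

text \<open>The discrete models prescribe point probabilities only; that an entry has no further
  values follows from their total mass 1.\<close>

lemma (in prob_space) AE_discrete:
  fixes X :: "'a \<Rightarrow> real"
  assumes X: "X \<in> borel_measurable M" and V: "finite V"
    and s: "(\<Sum>v\<in>V. prob {\<omega> \<in> space M. X \<omega> = v}) = 1"
  shows "prob {\<omega> \<in> space M. X \<omega> \<in> V} = 1"
proof -
  have "{\<omega> \<in> space M. X \<omega> \<in> V} = (\<Union>v\<in>V. {\<omega> \<in> space M. X \<omega> = v})" by auto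
  moreover have "prob (\<Union>v\<in>V. {\<omega> \<in> space M. X \<omega> = v}) = (\<Sum>v\<in>V. prob {\<omega> \<in> space M. X \<omega> = v})"
    using X V by (intro finite_measure_finite_Union) (auto simp: disjoint_family_on_def)
  ultimately show ?thesis using s by simp
qed

lemma (in prob_space) nn_integral_discrete:
  fixes X :: "'a \<Rightarrow> real" and f :: "real \<Rightarrow> real"
  assumes X: "X \<in> borel_measurable M" and V: "finite V"
    and s: "(\<Sum>v\<in>V. prob {\<omega> \<in> space M. X \<omega> = v}) = 1"
    and f: "\<And>x. 0 \<le> f x"
  shows "(\<integral>\<^sup>+\<omega>. ennreal (f (X \<omega>)) \<partial>M) = ennreal (\<Sum>v\<in>V. f v * prob {\<omega> \<in> space M. X \<omega> = v})"
proof -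
  have [measurable]: "V \<in> sets borel" using V by (simp add: finite_imp_closed borel_closed)
  have "{\<omega> \<in> space M. X \<omega> \<in> V} \<in> events" using X by measurable
  then have "AE \<omega> in M. X \<omega> \<in> V"
    using AE_discrete[OF X V s] by (subst (asm) prob_eq_1) auto
  then have "AE \<omega> in M. ennreal (f (X \<omega>)) = (\<Sum>v\<in>V. ennreal (f v) * indicator {\<omega> \<in> space M. X \<omega> = v} \<omega>)"
  proof (rule AE_mp, intro AE_I2 impI)
    fix \<omega> assume "\<omega> \<in> space M" "X \<omega> \<in> V"
    then have "(\<Sum>v\<in>V. ennreal (f v) * indicator {\<omega> \<in> space M. X \<omega> = v} \<omega>) = (\<Sum>v\<in>{X \<omega>}. ennreal (f v))"
      using V by (intro sum.mono_neutral_cong_right) auto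
    then show "ennreal (f (X \<omega>)) = (\<Sum>v\<in>V. ennreal (f v) * indicator {\<omega> \<in> space M. X \<omega> = v} \<omega>)" by simp
  qed
  then have "(\<integral>\<^sup>+\<omega>. ennreal (f (X \<omega>)) \<partial>M) = (\<integral>\<^sup>+\<omega>. (\<Sum>v\<in>V. ennreal (f v) * indicator {\<omega> \<in> space M. X \<omega> = v} \<omega>) \<partial>M)"
    by (rule nn_integral_cong_AE)
  also have "\<dots> = (\<Sum>v\<in>V. \<integral>\<^sup>+\<omega>. ennreal (f v) * indicator {\<omega> \<in> space M. X \<omega> = v} \<omega> \<partial>M)"
    using X by (intro nn_integral_sum) auto
  also have "\<dots> = (\<Sum>v\<in>V. ennreal (f v) * emeasure M {\<omega> \<in> space M. X \<omega> = v})"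
    using X by (intro sum.cong refl nn_integral_cmult_indicator) auto
  also have "\<dots> = ennreal (\<Sum>v\<in>V. f v * prob {\<omega> \<in> space M. X \<omega> = v})"
    using f by (simp add: emeasure_eq_measure ennreal_mult[symmetric])
  finally show ?thesis .
qed

lemma (in prob_space) union_bound:
  assumes I: "finite I" and A: "\<And>i. i \<in> I \<Longrightarrow> A i \<in> events" "\<And>i. i \<in> I \<Longrightarrow> prob (A i) \<le> b i"
  shows "\<exists>E\<in>events. 1 - (\<Sum>i\<in>I. b i) \<le> prob E \<and> (\<forall>\<omega>\<in>E. \<omega> \<in> space M \<and> (\<forall>i\<in>I. \<omega> \<notin> A i))"
proof -
  let ?U = "\<Union>i\<in>I. A i"
  have U: "?U \<in> events" using I A by auto
  have "prob ?U \<le> (\<Sum>i\<in>I. prob (A i))" using I A by (intro measure_UNION_le) auto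
  also have "\<dots> \<le> (\<Sum>i\<in>I. b i)" using A by (intro sum_mono)
  finally have "1 - (\<Sum>i\<in>I. b i) \<le> prob (space M - ?U)" using prob_compl[OF U] by simp
  then show ?thesis using U by (intro bexI[of _ "space M - ?U"]) auto
qed

lemma (in prob_space) prob_Int_ge:
  assumes "E \<in> events" "E' \<in> events" "1 - a \<le> prob E" "1 - b \<le> prob E'"
  shows "1 - (a + b) \<le> prob (E \<inter> E')"
proof -
  have "prob (E \<inter> E') = prob E + prob E' - prob (E \<union> E')"
    using assms by (simp add: finite_measure_Union' measure_Un3 fmeasurable_eq_sets)
  then show ?thesis using assms(3,4) prob_le_1[of "E \<union> E'"] by linarith
qed

text \<open>Integer vectors of norm at most \<open>2 * sqrt n\<close>; the bound on the entries only makes the set finite.\<close>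

definition int_net :: "nat \<Rightarrow> (nat \<Rightarrow> int) set" where
  "int_net n = {z \<in> {..<n} \<rightarrow>\<^sub>E {- (2 * int n)..2 * int n}. (\<Sum>i<n. (z i)\<^sup>2) \<le> 4 * int n}"

lemma finite_int_net [simp]: "finite (int_net n)"
  by (rule finite_subset[of _ "{..<n} \<rightarrow>\<^sub>E {- (2 * int n)..2 * int n}"]) (auto simp: int_net_def intro!: finite_PiE)

section \<open>Size of the integer net and the union bound over it\<close>

text \<open>As k^2 \<ge> |k| for integers, the sum is at most two geometric series, one of them
  without its first term 1.\<close>

lemma sum_exp_neg_square: "(\<Sum>k\<in>{- int m..int m}. exp (- (real_of_int k)\<^sup>2)) \<le> 3"
proof -
  have le: "exp (- (real_of_int k)\<^sup>2) \<le> exp (- real (nat \<bar>k\<bar>))" for k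
  proof -
    have "\<bar>k\<bar> \<le> \<bar>k\<bar>\<^sup>2"
    proof (cases "k = 0")
      case False
      then show ?thesis by (intro self_le_power) auto
    qed simp
    then have "\<bar>k\<bar> \<le> k\<^sup>2" by simp
    then have "real_of_int \<bar>k\<bar> \<le> real_of_int (k\<^sup>2)" by (rule of_int_le_iff[THEN iffD2])
    then show ?thesis by simp
  qed
  have "{- int m..int m} = (\<lambda>j. - int j) ` {1..m} \<union> int ` {..m}"
  proof (rule Set.set_eqI, rule iffI)
    fix x assume "x \<in> {- int m..int m}"
    then have "x = - int (nat \<bar>x\<bar>) \<and> nat \<bar>x\<bar> \<in> {1..m} \<or> x = int (nat \<bar>x\<bar>) \<and> nat \<bar>x\<bar> \<in> {..m}" by auto
    then show "x \<in> (\<lambda>j. - int j) ` {1..m} \<union> int ` {..m}" by blast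
  qed auto
  then have "(\<Sum>k\<in>{- int m..int m}. exp (- real (nat \<bar>k\<bar>)))
      \<le> (\<Sum>k\<in>(\<lambda>j. - int j) ` {1..m}. exp (- real (nat \<bar>k\<bar>))) + (\<Sum>k\<in>int ` {..m}. exp (- real (nat \<bar>k\<bar>)))"
    by (simp only:) (subst sum_Un, auto intro!: sum_nonneg)
  also have "(\<Sum>k\<in>(\<lambda>j. - int j) ` {1..m}. exp (- real (nat \<bar>k\<bar>))) = (\<Sum>j\<in>{1..m}. exp (- real j))"
    by (subst sum.reindex) (auto simp: inj_on_def)
  also have "(\<Sum>k\<in>int ` {..m}. exp (- real (nat \<bar>k\<bar>))) = (\<Sum>j\<in>{..m}. exp (- real j))"
    by (subst sum.reindex) (auto simp: inj_on_def)
  also have "(\<Sum>j\<in>{..m}. exp (- real j)) \<le> 2" using sum_exp_neg_le_two[of "Suc m"] by (simp add: lessThan_Suc_atMost)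
  also have "(\<Sum>j\<in>{1..m}. exp (- real j)) \<le> 1"
  proof -
    have "{..<Suc m} = insert 0 {1..m}" by auto
    then have "(\<Sum>j<Suc m. exp (- real j)) = 1 + (\<Sum>j\<in>{1..m}. exp (- real j))" by simp
    then show ?thesis using sum_exp_neg_le_two[of "Suc m"] by simp
  qed
  finally have "(\<Sum>k\<in>{- int m..int m}. exp (- real (nat \<bar>k\<bar>))) \<le> 3" by simp
  moreover have "(\<Sum>k\<in>{- int m..int m}. exp (- (real_of_int k)\<^sup>2)) \<le> (\<Sum>k\<in>{- int m..int m}. exp (- real (nat \<bar>k\<bar>)))"
    by (intro sum_mono le)
  ultimately show ?thesis by simp
qed

text \<open>Counting by weights: each member of the net has weight exp (4 * n - |z|^2) \<ge> 1, and
  the sum of the weights over the whole box factorises into coordinates. Each coordinate contributes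
  at most 3 \<le> exp 2, hence the exponent 4 + 2.\<close>

lemma card_int_net: "card (int_net n) \<le> exp (6 * real n)"
proof -
  let ?P = "{..<n} \<rightarrow>\<^sub>E {- (2 * int n)..2 * int n}"
  have "real (card (int_net n)) = (\<Sum>z\<in>int_net n. 1)" by simp
  also have "\<dots> \<le> (\<Sum>z\<in>int_net n. exp (4 * n - (\<Sum>i<n. (real_of_int (z i))\<^sup>2)))"
  proof (rule sum_mono)
    fix z assume "z \<in> int_net n"
    then have "real_of_int (\<Sum>i<n. (z i)\<^sup>2) \<le> real_of_int (4 * int n)"
      unfolding of_int_le_iff by (simp add: int_net_def)
    then show "1 \<le> exp (4 * n - (\<Sum>i<n. (real_of_int (z i))\<^sup>2))" by simp
  qed
  also have "\<dots> \<le> (\<Sum>z\<in>?P. exp (4 * n - (\<Sum>i<n. (real_of_int (z i))\<^sup>2)))"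
    by (intro sum_mono2) (auto simp: int_net_def intro!: finite_PiE)
  also have "\<dots> = exp (4 * n) * (\<Sum>z\<in>?P. \<Prod>i<n. exp (- (real_of_int (z i))\<^sup>2))"
    by (simp add: exp_sum[symmetric] sum_negf sum_distrib_left exp_add[symmetric])
  also have "\<dots> \<le> exp (4 * n) * exp (2 * n)"
  proof (rule mult_left_mono)
    have "(\<Sum>z\<in>?P. \<Prod>i<n. exp (- (real_of_int (z i))\<^sup>2)) = (\<Prod>i<n. \<Sum>k\<in>{- (2 * int n)..2 * int n}. exp (- (real_of_int k)\<^sup>2))"
      by (subst prod_sum_PiE) auto
    also have "\<dots> \<le> (\<Prod>i<n. exp 2)"
    proof (rule prod_mono)
      have "(3::real) \<le> exp 2" using exp_ge_add_one_self[of "2::real"] by simp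
      then show "0 \<le> (\<Sum>k\<in>{- (2 * int n)..2 * int n}. exp (- (real_of_int k)\<^sup>2)) \<and>
          (\<Sum>k\<in>{- (2 * int n)..2 * int n}. exp (- (real_of_int k)\<^sup>2)) \<le> exp 2" for i :: nat
        using sum_exp_neg_square[of "2 * n"] by (auto intro!: sum_nonneg)
    qed
    also have "\<dots> = exp (2 * n)" by (simp add: exp_of_nat_mult[symmetric] mult.commute)
    finally show "(\<Sum>z\<in>?P. \<Prod>i<n. exp (- (real_of_int (z i))\<^sup>2)) \<le> exp (2 * n)" .
  qed simp
  also have "\<dots> = exp (6 * n)" by (simp add: exp_add[symmetric])
  finally show ?thesis by simp
qed

abbreviation "upper_pairs n \<equiv> {(i, j). i < j \<and> j < (n::nat)}"

abbreviation upper_form :: "nat \<Rightarrow> (nat \<times> nat \<Rightarrow> real) \<Rightarrow> (nat \<Rightarrow> real) \<Rightarrow> real" where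
  "upper_form n w x \<equiv> \<Sum>(i, j)\<in>upper_pairs n. w (i, j) * x i * x j"

lemma finite_upper_pairs [simp]: "finite (upper_pairs n)"
  by (rule finite_subset[of _ "{..<n} \<times> {..<n}"]) auto

text \<open>For one \<open>z\<close> the moment exponent is at most (4 * n)^2 * v / (4 * n * v) = 4
  * n. At threshold 11 * n the tail is exp (- 7 * n), and the net costs exp (6 * n). The set
  \<open>L z\<close> may depend on \<open>z\<close>: all pairs for Gaussian noise, and in the sparse
  models only those whose Chernoff parameter stays at most 1 / 2.\<close>

lemma (in prob_space) light_pairs_bound:
  fixes X :: "nat \<times> nat \<Rightarrow> 'a \<Rightarrow> real" and W :: "nat \<times> nat \<Rightarrow> real \<Rightarrow> real"
    and v :: real and L :: "(nat \<Rightarrow> int) \<Rightarrow> (nat \<times> nat) set"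
  assumes ind: "indep_vars (\<lambda>_. borel) X I" and I: "upper_pairs n \<subseteq> I"
    and W [measurable]: "\<And>e. W e \<in> borel_measurable borel"
    and n: "0 < n" and v: "0 < v" and L: "\<And>z. L z \<subseteq> upper_pairs n"
    and mgf: "\<And>z i j. (i, j) \<in> L z \<Longrightarrow>
       (\<integral>\<^sup>+\<omega>. ennreal (exp (z i * z j / (2 * sqrt (n * v)) * W (i, j) (X (i, j) \<omega>))) \<partial>M)
          \<le> ennreal (exp ((z i * z j / (2 * sqrt (n * v)))\<^sup>2 * v))"
  shows "\<exists>E\<in>events. 1 - exp (- real n) \<le> prob E \<and> (\<forall>\<omega>\<in>E. \<omega> \<in> space M \<and> (\<forall>z\<in>int_net n.
     (\<Sum>(i, j)\<in>L z. W (i, j) (X (i, j) \<omega>) * z i * z j) \<le> 22 * real n * sqrt (n * v)))"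
proof -
  define r where "r = sqrt (n * v)"
  have r0: "0 < r" and rr: "r\<^sup>2 = n * v" using n v by (auto simp: r_def)
  have X [measurable]: "X e \<in> borel_measurable M" if "e \<in> I" for e
    using ind that unfolding indep_vars_def by auto
  have finL: "finite (L z)" for z by (rule finite_subset[OF L]) simp
  define f where "f z \<omega> = (\<Sum>(i, j)\<in>L z. z i * z j / (2 * r) * W (i, j) (X (i, j) \<omega>))" for z \<omega>
  define A where "A z = {\<omega> \<in> space M. 11 * real n \<le> f z \<omega>}" for z :: "nat \<Rightarrow> int"
  have fm [measurable]: "f z \<in> borel_measurable M" for z
  proof -
    have "(\<lambda>\<omega>. W e (X e \<omega>)) \<in> borel_measurable M" if "e \<in> L z" for e
      using that L[of z] I by (intro measurable_compose[OF X W]) auto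
    then show ?thesis unfolding f_def case_prod_unfold
      by (intro borel_measurable_sum borel_measurable_times borel_measurable_const) auto
  qed
  have "prob (A z) \<le> exp (- (7 * real n))" if z: "z \<in> int_net n" for z
  proof -
    have "(\<integral>\<^sup>+\<omega>. ennreal (exp (f z \<omega>)) \<partial>M)
        \<le> ennreal (exp (\<Sum>(i, j)\<in>L z. (z i * z j / (2 * r))\<^sup>2 * v))"
      using mgf_sum_le[OF ind finL[of z], of "\<lambda>(i, j) x. z i * z j / (2 * r) * W (i, j) x" "\<lambda>(i, j). (z i * z j / (2 * r))\<^sup>2 * v"]
        L[of z] I mgf[of _ _ z]
      unfolding f_def r_def by (auto simp: case_prod_unfold)
    also have "\<dots> \<le> ennreal (exp (4 * real n))"
    proof -
      have "(\<Sum>(i, j)\<in>L z. (z i * z j / (2 * r))\<^sup>2 * v) \<le> (\<Sum>(i, j)\<in>{..<n} \<times> {..<n}. (z i * z j / (2 * r))\<^sup>2 * v)"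
        using L[of z] v by (intro sum_mono2) auto
      also have "\<dots> = (\<Sum>i<n. \<Sum>j<n. (real_of_int (z i))\<^sup>2 * (real_of_int (z j))\<^sup>2) * (v / (4 * r\<^sup>2))"
        unfolding sum.cartesian_product[symmetric] sum_distrib_right
        by (intro sum.cong refl) (simp add: power_divide power_mult_distrib)
      also have "(\<Sum>i<n. \<Sum>j<n. (real_of_int (z i))\<^sup>2 * (real_of_int (z j))\<^sup>2) = (real_of_int (\<Sum>i<n. (z i)\<^sup>2))\<^sup>2"
        by (simp add: power2_eq_square[of "sum _ _"] sum_product)
      also have "(real_of_int (\<Sum>i<n. (z i)\<^sup>2))\<^sup>2 * (v / (4 * r\<^sup>2)) \<le> (real_of_int (4 * int n))\<^sup>2 * (v / (4 * r\<^sup>2))"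
      proof (intro mult_right_mono power_mono)
        show "real_of_int (\<Sum>i<n. (z i)\<^sup>2) \<le> real_of_int (4 * int n)"
          using z by (subst of_int_le_iff) (simp add: int_net_def)
      qed (use v in \<open>auto intro!: sum_nonneg\<close>)
      also have "(real_of_int (4 * int n))\<^sup>2 * (v / (4 * r\<^sup>2)) = 4 * real n"
        unfolding rr using n v by (simp add: power2_eq_square field_simps)
      finally have "(\<Sum>(i, j)\<in>L z. (z i * z j / (2 * r))\<^sup>2 * v) \<le> 4 * real n" .
      then show ?thesis by (intro ennreal_leI) simp
    qed
    finally have "prob (A z) \<le> exp (4 * real n - 11 * real n)" unfolding A_def by (intro exp_markov) auto
    then show ?thesis by simp
  qed
  moreover have "A z \<in> events" for z unfolding A_def by measurable
  ultimately obtain E where E: "E \<in> events" "1 - (\<Sum>z\<in>int_net n. exp (- (7 * real n))) \<le> prob E"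
    "\<forall>\<omega>\<in>E. \<omega> \<in> space M \<and> (\<forall>z\<in>int_net n. \<omega> \<notin> A z)"
    using union_bound[of "int_net n" A "\<lambda>_. exp (- (7 * real n))"] by auto
  have "(\<Sum>z\<in>int_net n. exp (- (7 * real n))) \<le> exp (6 * real n) * exp (- (7 * real n))"
    unfolding sum_constant by (intro mult_right_mono card_int_net[of n]) auto
  also have "\<dots> = exp (- real n)" by (simp add: exp_add[symmetric])
  finally have "1 - exp (- real n) \<le> prob E" using E(2) by linarith
  moreover have "(\<Sum>(i, j)\<in>L z. W (i, j) (X (i, j) \<omega>) * z i * z j) \<le> 22 * real n * sqrt (n * v)"
    if "\<omega> \<in> E" "z \<in> int_net n" for \<omega> z
  proof -
    have "(\<Sum>(i, j)\<in>L z. W (i, j) (X (i, j) \<omega>) * z i * z j) = 2 * r * f z \<omega>"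
      unfolding f_def sum_distrib_left using r0 by (intro sum.cong refl) (auto simp: field_simps)
    also have "\<dots> \<le> 2 * r * (11 * real n)"
    proof (rule mult_left_mono)
      have "\<not> 11 * real n \<le> f z \<omega>" using E(3) that unfolding A_def by blast
      then show "f z \<omega> \<le> 11 * real n" by simp
    qed (use r0 in simp)
    finally show ?thesis by (simp add: r_def mult.commute mult.left_commute)
  qed
  ultimately show ?thesis using E by blast
qed

section \<open>Discrepancy of the sparse random graph\<close>

text \<open>Entropy is smallest for singletons. The bound lets polynomial factors in
  \<open>n\<close> be absorbed into exponentials of the entropy.\<close>

lemma set_entropy_ge:
  assumes "0 < t" "t \<le> n"
  shows "1 + ln (real n) \<le> set_entropy n t"
proof -
  have "set_entropy n t = t * (1 + ln n - ln t)"
    using assms by (simp add: set_entropy_def ln_div ln_mult)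
  moreover have "ln (real t) \<le> real t - 1" using assms by (intro ln_le_minus_one) simp
  moreover have "(real t - 1) * (1 + ln t) \<le> (real t - 1) * (1 + ln n)"
    using assms by (intro mult_left_mono) auto
  ultimately show ?thesis by (simp add: algebra_simps)
qed

text \<open>Weight each subset by (t / n) ^ card S. Small sets weigh at least (t / n) ^ t, and all
  weights together are (1 + t / n) ^ n \<le> exp t.\<close>

lemma card_subsets_entropy:
  assumes "0 < t" "t \<le> n"
  shows "real (card {S. S \<subseteq> {..<n} \<and> card S \<le> t}) \<le> exp (set_entropy n t)"
proof -
  define x where "x = real t / n"
  have x: "0 < x" "x \<le> 1" using assms by (auto simp: x_def)
  have fin: "finite {S. S \<subseteq> {..<n} \<and> card S \<le> t}" by (rule finite_subset[of _ "Pow {..<n}"]) auto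
  have "x ^ t * real (card {S. S \<subseteq> {..<n} \<and> card S \<le> t}) = (\<Sum>S | S \<subseteq> {..<n} \<and> card S \<le> t. x ^ t)"
    by simp
  also have "\<dots> \<le> (\<Sum>S | S \<subseteq> {..<n} \<and> card S \<le> t. x ^ card S)"
    using x by (intro sum_mono power_decreasing) auto
  also have "\<dots> \<le> (\<Sum>S\<in>Pow {..<n}. x ^ card S)" using x by (intro sum_mono2) auto
  also have "\<dots> = (1 + x) ^ n"
    using prod_add[of "{..<n}" "\<lambda>_. x" "\<lambda>_. 1"] by (simp add: add.commute)
  also have "\<dots> \<le> exp x ^ n" using x exp_ge_add_one_self[of x] by (intro power_mono) auto
  also have "\<dots> = exp t" using assms by (simp add: exp_of_nat_mult[symmetric] x_def)
  finally have "real (card {S. S \<subseteq> {..<n} \<and> card S \<le> t}) \<le> exp t / x ^ t"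
    using x by (simp add: field_simps)
  also have "\<dots> = (exp 1 * n / t) ^ t"
    using assms by (simp add: x_def power_divide power_mult_distrib exp_of_nat_mult[symmetric])
  also have "\<dots> = exp (set_entropy n t)"
  proof -
    have "0 < exp 1 * n / t" using assms by simp
    then have "(exp 1 * n / t) ^ t = exp (ln (exp 1 * n / t)) ^ t" by (subst exp_ln) auto
    then show ?thesis by (simp add: set_entropy_def exp_of_nat_mult[symmetric])
  qed
  finally show ?thesis .
qed

lemma (in prob_space) mgf_bernoulli_le:
  fixes X :: "'a \<Rightarrow> real"
  assumes X [measurable]: "X \<in> borel_measurable M" and p: "prob {\<omega> \<in> space M. X \<omega> \<noteq> 0} \<le> p" and s: "0 \<le> s"
  shows "(\<integral>\<^sup>+\<omega>. ennreal (exp (s * of_bool (X \<omega> \<noteq> 0))) \<partial>M) \<le> ennreal (exp (p * (exp s - 1)))"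
proof -
  have es: "1 \<le> exp s" using s by simp
  have e1: "1 + ennreal (exp s - 1) = ennreal (exp s)" using es ennreal_plus[of 1 "exp s - 1"] by simp
  have ev: "{\<omega> \<in> space M. X \<omega> \<noteq> 0} \<in> events" by measurable
  have "(\<integral>\<^sup>+\<omega>. ennreal (exp (s * of_bool (X \<omega> \<noteq> 0))) \<partial>M)
      = (\<integral>\<^sup>+\<omega>. 1 + ennreal (exp s - 1) * indicator {\<omega> \<in> space M. X \<omega> \<noteq> 0} \<omega> \<partial>M)"
    using e1 by (intro nn_integral_cong) (auto simp: indicator_def)
  also have "\<dots> = 1 + ennreal (exp s - 1) * emeasure M {\<omega> \<in> space M. X \<omega> \<noteq> 0}"
    by (subst nn_integral_add) (auto simp: emeasure_space_1 nn_integral_cmult_indicator ev intro!: borel_measurable_indicator borel_measurable_times_ennreal ev)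
  also have "\<dots> = ennreal (1 + (exp s - 1) * prob {\<omega> \<in> space M. X \<omega> \<noteq> 0})"
    using es by (simp add: emeasure_eq_measure ennreal_mult[symmetric] flip: ennreal_plus ennreal_1)
  also have "\<dots> \<le> ennreal (1 + (exp s - 1) * p)"
    using es p by (intro ennreal_leI add_left_mono mult_left_mono) auto
  also have "\<dots> \<le> ennreal (exp (p * (exp s - 1)))"
    using exp_ge_add_one_self[of "p * (exp s - 1)"] by (intro ennreal_leI) (simp add: mult.commute)
  finally show ?thesis .
qed

text \<open>Chernoff's bound at the exponent optimal for a Poisson count gives exp (- 8 * H) with H
  the entropy of the larger set. There are at most exp (2 * H) pairs of sets for each size of the
  larger one, and n * n + 1 values of the count.\<close>

lemma (in prob_space) discrepancy_event:
  fixes X :: "nat \<times> nat \<Rightarrow> 'a \<Rightarrow> real"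
  assumes ind: "indep_vars (\<lambda>_. borel) X I" and I: "upper_pairs n \<subseteq> I" and n: "0 < n" and p: "0 < p"
    and pX: "\<And>e. e \<in> upper_pairs n \<Longrightarrow> prob {\<omega> \<in> space M. X e \<omega> \<noteq> 0} \<le> p"
  shows "\<exists>E\<in>events. 1 - 2 / real n \<le> prob E \<and>
    (\<forall>\<omega>\<in>E. \<omega> \<in> space M \<and> discrepancy n p (\<lambda>e. of_bool (X e \<omega> \<noteq> 0)))"
proof -
  define N :: "nat \<times> nat \<Rightarrow> 'a \<Rightarrow> real" where "N e \<omega> = of_bool (X e \<omega> \<noteq> 0)" for e \<omega>
  have Xm [measurable]: "X e \<in> borel_measurable M" if "e \<in> I" for e
    using ind that unfolding indep_vars_def by auto
  define F where "F S T \<omega> = sum (\<lambda>e. N e \<omega>) (edge_pairs n S T)" for S T \<omega>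
  have EI: "edge_pairs n S T \<subseteq> upper_pairs n" for S T by (auto simp: edge_pairs_def)
  have Nm: "(\<lambda>\<omega>. N e \<omega>) \<in> borel_measurable M" if "e \<in> upper_pairs n" for e
    using Xm[of e] that I unfolding N_def by auto
  have Fm [measurable]: "F S T \<in> borel_measurable M" for S T
    unfolding F_def using EI Nm by (intro borel_measurable_sum) blast
  \<comment> \<open>The second alternative of \<open>discrepancy\<close> has the random count on
    both sides. Fixing its value \<open>m\<close> makes the threshold deterministic, at the price of
    a union over \<open>m\<close>.\<close>
  define bad where "bad S T m \<longleftrightarrow> 8 * p * card S * card T < real m \<and>
     16 * set_entropy n (card T) < real m * ln (real m / (p * card S * card T))" for S T :: "nat set" and m :: nat
  define A where "A = (\<lambda>(S, T, m). if bad S T m then {\<omega> \<in> space M. real m \<le> F S T \<omega>} else {})"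
  define J where "J t = {S. S \<subseteq> {..<n} \<and> S \<noteq> {} \<and> card S \<le> t} \<times> {T. T \<subseteq> {..<n} \<and> card T = t} \<times> {..n * n}" for t
  have finJ [simp]: "finite (J t)" for t
    unfolding J_def by (intro finite_cartesian_product) (auto intro: finite_subset[of _ "Pow {..<n}"])
  have prob_A: "prob (A (S, T, m)) \<le> exp (- 8 * set_entropy n (card T))"
    if ST: "S \<subseteq> {..<n}" "S \<noteq> {}" "T \<subseteq> {..<n}" "card S \<le> card T" for S T m
  proof (cases "bad S T m")
    case True
    have fin: "finite S" "finite T" using ST by (auto intro: finite_subset)
    have s: "0 < card S" "0 < card T" using ST fin by (auto simp: card_gt_0_iff)
    define \<nu> where "\<nu> = p * card S * card T"
    have \<nu>: "0 < \<nu>" using p s by (simp add: \<nu>_def)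
    \<comment> \<open>The minimiser of exp l * \<nu> - l * m, where \<nu> bounds the mean. A bad
      \<open>m\<close> exceeds 8 * \<nu>, so l \<ge> 2 and half of the exponent m * l outweighs the
      term \<open>m\<close>.\<close>
    define l where "l = ln (real m / \<nu>)"
    have m8: "8 * \<nu> < m" "16 * set_entropy n (card T) < m * l" using True by (auto simp: bad_def \<nu>_def l_def mult.assoc)
    have m0: "0 < real m" using m8 \<nu> by linarith
    have l2: "2 \<le> l"
    proof -
      have "exp 1 ^ 2 \<le> (272 / 100 :: real)\<^sup>2" using e_less_272 by (intro power_mono) auto
      then have "exp 2 \<le> (8::real)" using exp_double[of "1::real"] by (simp add: power2_eq_square)
      also have "8 \<le> real m / \<nu>" using m8 \<nu> by (simp add: field_simps)
      finally have "ln (exp 2) \<le> l" unfolding l_def by (intro ln_mono) auto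
      then show ?thesis by simp
    qed
    have exp_l: "exp l = m / \<nu>" using m0 \<nu> by (simp add: l_def)
    have "(\<integral>\<^sup>+\<omega>. ennreal (exp (\<Sum>e\<in>edge_pairs n S T. l * N e \<omega>)) \<partial>M)
        \<le> ennreal (exp (\<Sum>e\<in>edge_pairs n S T. p * (exp l - 1)))"
      unfolding N_def using EI[of S T] I l2
      by (intro mgf_sum_le[OF ind, where g = "\<lambda>e x. l * of_bool (x \<noteq> 0)"] mgf_bernoulli_le pX Xm) auto
    also have "\<dots> \<le> ennreal (exp m)"
    proof -
      have "(\<Sum>e\<in>edge_pairs n S T. p * (exp l - 1)) = card (edge_pairs n S T) * (p * (exp l - 1))" by simp
      also have "\<dots> \<le> (card S * card T) * (p * exp l)"
        using card_edge_pairs[OF fin, of n] p l2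
        by (intro mult_mono) (auto simp flip: of_nat_mult)
      also have "\<dots> = m" unfolding exp_l \<nu>_def using p s by simp
      finally show ?thesis by (intro ennreal_leI) simp
    qed
    finally have "prob {\<omega> \<in> space M. l * m \<le> l * F S T \<omega>} \<le> exp (m - l * m)"
      by (intro exp_markov) (auto simp: F_def[symmetric] sum_distrib_left[symmetric])
    also have "{\<omega> \<in> space M. l * m \<le> l * F S T \<omega>} = A (S, T, m)"
      using True l2 by (auto simp: A_def)
    also have "exp (m - l * m) \<le> exp (- 8 * set_entropy n (card T))"
    proof -
      have "real m * 2 \<le> m * l" using l2 by (intro mult_left_mono) auto
      then have "m - l * m \<le> - (m * l) / 2" by (simp add: mult.commute)
      then show ?thesis using m8 by simp
    qed
    finally show ?thesis .
  qed (simp add: A_def)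
  have Am: "A x \<in> events" for x unfolding A_def by (cases x) auto
  have finI: "finite (Sigma {1..n} J)" by auto
  obtain E where E: "E \<in> events" "1 - (\<Sum>x\<in>Sigma {1..n} J. exp (- 8 * set_entropy n (fst x))) \<le> prob E"
    "\<And>\<omega>. \<omega> \<in> E \<Longrightarrow> \<omega> \<in> space M" "\<And>\<omega> x. \<omega> \<in> E \<Longrightarrow> x \<in> Sigma {1..n} J \<Longrightarrow> \<omega> \<notin> A (snd x)"
  proof -
    have "prob (A (snd x)) \<le> exp (- 8 * set_entropy n (fst x))" if "x \<in> Sigma {1..n} J" for x
      using prob_A that by (auto simp: J_def)
    then show ?thesis using that union_bound[OF finI, of "\<lambda>x. A (snd x)" "\<lambda>x. exp (- 8 * set_entropy n (fst x))"] Am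
      by blast
  qed
  have "(\<Sum>x\<in>Sigma {1..n} J. exp (- 8 * set_entropy n (fst x))) = (\<Sum>t\<in>{1..n}. card (J t) * exp (- 8 * set_entropy n t))"
    using sum.Sigma[of "{1..n}" J "\<lambda>t _. exp (- 8 * set_entropy n t)"] by (simp add: case_prod_unfold)
  also have "\<dots> \<le> (\<Sum>t\<in>{1..n}. 2 / (real n)\<^sup>2)"
  proof (rule sum_mono)
    fix t assume t: "t \<in> {1..n}"
    let ?c = "real (card {S. S \<subseteq> {..<n} \<and> card S \<le> t})"
    let ?H = "set_entropy n t"
    have c: "?c \<le> exp ?H" using t by (intro card_subsets_entropy) auto
    have fin: "finite {S. S \<subseteq> {..<n} \<and> card S \<le> t}" by (rule finite_subset[of _ "Pow {..<n}"]) auto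
    have "real (card (J t)) = real (card {S. S \<subseteq> {..<n} \<and> S \<noteq> {} \<and> card S \<le> t}) *
        (real (card {T. T \<subseteq> {..<n} \<and> card T = t}) * (n * n + 1))"
      unfolding J_def by (simp add: card_cartesian_product algebra_simps)
    also have "\<dots> \<le> ?c * (?c * (n * n + 1))"
      by (intro mult_mono) (auto intro!: card_mono fin)
    also have "\<dots> \<le> exp ?H * (exp ?H * (n * n + 1))" using c by (intro mult_mono) auto
    finally have "card (J t) * exp (- 8 * ?H) \<le> exp ?H * (exp ?H * (n * n + 1)) * exp (- 8 * ?H)"
      by (intro mult_right_mono) auto
    also have "\<dots> = (n * n + 1) * exp (?H + ?H + (- 8 * ?H))" by (simp only: exp_add mult_ac)
    also have "\<dots> = (n * n + 1) * exp (- 6 * ?H)" by simp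
    \<comment> \<open>H \<ge> 1 + ln n turns exp (- 6 * H) into at most n ^ (-4), against a
      quadratic number of counts.\<close>
    also have "\<dots> \<le> (2 * (real n)\<^sup>2) * exp (- 4 * ln n)"
    proof (rule mult_mono)
      show "real (n * n + 1) \<le> 2 * (real n)\<^sup>2"
        using n by (simp add: power2_eq_square) (metis One_nat_def Suc_leI mult_le_mono nat_mult_1 of_nat_1 of_nat_le_iff of_nat_mult)
      have "1 + ln (real n) \<le> ?H" using t by (intro set_entropy_ge) auto
      moreover have "0 \<le> ln (real n)" using n by simp
      ultimately show "exp (- 6 * ?H) \<le> exp (- 4 * ln (real n))" by simp
    qed auto
    also have "exp (- 4 * ln (real n)) = 1 / (real n) ^ 4"
      using n by (simp add: exp_minus inverse_eq_divide) (metis exp_ln exp_of_nat_mult of_nat_0_less_iff of_nat_numeral)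
    also have "(2 * (real n)\<^sup>2) * (1 / (real n) ^ 4) = 2 / (real n)\<^sup>2"
      using n by (simp add: field_simps power2_eq_square eval_nat_numeral)
    finally show "card (J t) * exp (- 8 * ?H) \<le> 2 / (real n)\<^sup>2" .
  qed
  also have "\<dots> = 2 / n" using n by (simp add: power2_eq_square)
  finally have "1 - 2 / n \<le> prob E" using E(2) by linarith
  moreover have "discrepancy n p (\<lambda>e. of_bool (X e \<omega> \<noteq> 0))" if "\<omega> \<in> E" for \<omega>
    unfolding discrepancy_def N_def[symmetric]
  proof (intro allI impI)
    fix S T assume ST: "S \<subseteq> {..<n}" "T \<subseteq> {..<n}" "S \<noteq> {}" "card S \<le> card T"
    have fin: "finite S" "finite T" using ST by (auto intro: finite_subset)
    have s: "0 < card S" using ST fin by (auto simp: card_gt_0_iff)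
    have sn: "card S \<le> n" "card T \<le> n" using ST card_mono[of "{..<n}"] by auto
    define m where "m = card {e \<in> edge_pairs n S T. X e \<omega> \<noteq> 0}"
    have m: "F S T \<omega> = real m" unfolding F_def N_def m_def
      by (simp add: of_bool_def sum.If_cases Int_def)
    have "m \<le> card (edge_pairs n S T)" unfolding m_def by (intro card_mono) auto
    also have "\<dots> \<le> card S * card T" using fin by (rule card_edge_pairs)
    also have "\<dots> \<le> n * n" using sn by (intro mult_mono) auto
    finally have "(card T, (S, T, m)) \<in> Sigma {1..n} J" using ST s sn by (auto simp: J_def)
    then have "\<omega> \<notin> A (S, T, m)" using E(4)[OF that] by fastforce
    then have "\<not> bad S T m" using m E(3)[OF that] by (auto simp: A_def)
    then show "(\<Sum>e\<in>edge_pairs n S T. N e \<omega>) \<le> 8 * p * card S * card T \<or>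
      (\<Sum>e\<in>edge_pairs n S T. N e \<omega>) * ln ((\<Sum>e\<in>edge_pairs n S T. N e \<omega>) / (p * card S * card T)) \<le> 16 * set_entropy n (card T)"
      unfolding F_def[symmetric] m bad_def by auto
  qed
  ultimately show ?thesis using E(1,3) by blast
qed

section \<open>Top eigenvectors and deterministic recovery\<close>

text \<open>In Gram coordinates the form is an ordinary inner product. It is needed for semidefinite
  forms, where no inverse is at hand.\<close>

lemma psd_cauchy_schwarz:
  fixes Q :: "nat \<Rightarrow> nat \<Rightarrow> real"
  assumes sym: "\<And>i j. i < n \<Longrightarrow> j < n \<Longrightarrow> Q i j = Q j i"
    and psd: "\<And>x. 0 \<le> (\<Sum>i<n. \<Sum>j<n. x i * Q i j * x j)"
  shows "(\<Sum>i<n. \<Sum>j<n. x i * Q i j * y j)\<^sup>2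
     \<le> (\<Sum>i<n. \<Sum>j<n. x i * Q i j * x j) * (\<Sum>i<n. \<Sum>j<n. y i * Q i j * y j)"
proof -
  obtain V where V: "\<And>i j. i < n \<Longrightarrow> j < n \<Longrightarrow> Q i j = (\<Sum>k<n. V k i * V k j)"
    using psd_gram[of n Q] sym psd by blast
  have form: "(\<Sum>i<n. \<Sum>j<n. x i * Q i j * y j) = (\<Sum>k<n. (\<Sum>i<n. V k i * x i) * (\<Sum>j<n. V k j * y j))" for x y
  proof -
    have "(\<Sum>i<n. \<Sum>j<n. x i * Q i j * y j) = (\<Sum>i<n. \<Sum>j<n. \<Sum>k<n. V k i * x i * (V k j * y j))"
      by (intro sum.cong refl) (simp add: V sum_distrib_left sum_distrib_right ac_simps)
    also have "\<dots> = (\<Sum>i<n. \<Sum>k<n. \<Sum>j<n. V k i * x i * (V k j * y j))"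
      by (intro sum.cong refl sum.swap)
    also have "\<dots> = (\<Sum>k<n. \<Sum>i<n. \<Sum>j<n. V k i * x i * (V k j * y j))" by (rule sum.swap)
    finally show ?thesis by (simp add: sum_product)
  qed
  show ?thesis unfolding form
    using Cauchy_Schwarz_ineq_sum[of "\<lambda>k. \<Sum>i<n. V k i * x i" "\<lambda>k. \<Sum>j<n. V k j * y j" "{..<n}"]
    by (simp add: power2_eq_square)
qed

text \<open>If the supremum \<open>\<rho>\<close> of the Rayleigh quotient were not an eigenvalue, then \<open>\<rho> I - Y\<close> would be an
  invertible positive semidefinite matrix, hence bounded below by a positive multiple of \<open>I\<close>.\<close>

lemma rayleigh_le_top_eigenvalue:
  fixes Y :: "real Matrix.mat" and x :: "nat \<Rightarrow> real"
  assumes Y: "Y \<in> carrier_mat n n" and n: "0 < n"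
    and sym: "\<And>i j. i < n \<Longrightarrow> j < n \<Longrightarrow> Y $$ (i, j) = Y $$ (j, i)"
    and top: "\<And>\<mu>. eigenvalue Y \<mu> \<Longrightarrow> \<mu> \<le> l"
  shows "(\<Sum>i<n. \<Sum>j<n. x i * Y $$ (i, j) * x j) \<le> l * (\<Sum>i<n. (x i)\<^sup>2)"
proof -
  define q where "q x = (\<Sum>i<n. \<Sum>j<n. x i * Y $$ (i, j) * x j)" for x :: "nat \<Rightarrow> real"
  define s where "s x = (\<Sum>i<n. (x i)\<^sup>2)" for x :: "nat \<Rightarrow> real"
  have form_le: "(\<Sum>i<n. \<Sum>j<n. x i * P i j * x j) \<le> (\<Sum>i<n. \<Sum>j<n. \<bar>P i j\<bar>) * s x" for P x
  proof -
    have "x i * P i j * x j \<le> \<bar>P i j\<bar> * s x" if "i < n" "j < n" for i j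
    proof -
      have "\<bar>x i * x j\<bar> \<le> ((x i)\<^sup>2 + (x j)\<^sup>2) / 2"
        using sum_squares_bound[of "x i" "x j"] sum_squares_bound[of "x i" "- x j"] by (simp add: abs_if)
      also have "\<dots> \<le> s x"
        using member_le_sum[of i "{..<n}" "\<lambda>i. (x i)\<^sup>2"] member_le_sum[of j "{..<n}" "\<lambda>i. (x i)\<^sup>2"] that
        by (simp add: s_def)
      finally have "\<bar>P i j\<bar> * \<bar>x i * x j\<bar> \<le> \<bar>P i j\<bar> * s x" by (intro mult_left_mono) auto
      moreover have "x i * P i j * x j \<le> \<bar>P i j\<bar> * \<bar>x i * x j\<bar>"
        by (metis abs_ge_self abs_mult mult.assoc mult.commute)
      ultimately show ?thesis by simp
    qed
    then show ?thesis unfolding sum_distrib_right by (intro sum_mono) auto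
  qed
  define S where "S = q ` {x. s x = 1}"
  have bdd: "bdd_above S"
    unfolding S_def
  proof (rule bdd_aboveI2)
    show "q x \<le> (\<Sum>i<n. \<Sum>j<n. \<bar>Y $$ (i, j)\<bar>)" if "x \<in> {x. s x = 1}" for x
      using form_le[of x "\<lambda>i j. Y $$ (i, j)"] that by (simp add: q_def)
  qed
  have ne: "S \<noteq> {}"
  proof -
    have "s (\<lambda>i. if i = 0 then 1 else 0) = (\<Sum>i<n. if i = 0 then 1 else 0)"
      unfolding s_def by (intro sum.cong refl) auto
    also have "\<dots> = 1" using n by simp
    finally have "q (\<lambda>i. if i = 0 then 1 else 0) \<in> S" unfolding S_def by (intro imageI) simp
    then show ?thesis by blast
  qed
  define \<rho> where "\<rho> = Sup S"
  have scale: "q (\<lambda>i. c * x i) = c\<^sup>2 * q x" "s (\<lambda>i. c * x i) = c\<^sup>2 * s x" for c x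
    unfolding q_def s_def sum_distrib_left power2_eq_square by (simp_all add: ac_simps)
  have ray: "q x \<le> t * s x" if t: "\<And>y. y \<in> S \<Longrightarrow> y \<le> t" for x t
  proof (cases "s x = 0")
    case True
    then have "x i = 0" if "i < n" for i
      using that unfolding s_def by (simp add: sum_nonneg_eq_0_iff)
    then show ?thesis using True by (simp add: q_def)
  next
    case False
    moreover have "0 \<le> s x" by (simp add: s_def sum_nonneg)
    ultimately have sp: "0 < s x" by simp
    have "s (\<lambda>i. 1 / sqrt (s x) * x i) = 1" unfolding scale using sp by (simp add: power_divide)
    then have "q (\<lambda>i. 1 / sqrt (s x) * x i) \<le> t" by (intro t) (auto simp: S_def)
    then show ?thesis unfolding scale using sp by (simp add: power_divide field_simps)
  qed
  have ray\<rho>: "q x \<le> \<rho> * s x" for x unfolding \<rho>_def by (intro ray cSup_upper bdd)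
  have "eigenvalue Y \<rho>"
  proof (rule ccontr)
    assume ne\<rho>: "\<not> eigenvalue Y \<rho>"
    define P where "P = \<rho> \<cdot>\<^sub>m 1\<^sub>m n - Y"
    have Pc: "P \<in> carrier_mat n n" unfolding P_def by (rule minus_carrier_mat[OF Y])
    have Pij: "P $$ (i, j) = (if i = j then \<rho> else 0) - Y $$ (i, j)" if "i < n" "j < n" for i j
      using that Y by (simp add: P_def)
    have "Determinant.det P \<noteq> 0"
    proof
      assume "Determinant.det P = 0"
      then obtain v where v: "v \<in> carrier_vec n" "v \<noteq> 0\<^sub>v n" "P *\<^sub>v v = 0\<^sub>v n"
        using det_0_iff_vec_prod_zero[OF Pc] by blast
      have "Y *\<^sub>v v = \<rho> \<cdot>\<^sub>v v"
      proof (rule eq_vecI)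
        fix i assume i: "i < dim_vec (\<rho> \<cdot>\<^sub>v v)"
        have "(P *\<^sub>v v) $ i = \<rho> * v $ i - (Y *\<^sub>v v) $ i"
        proof -
          have "(P *\<^sub>v v) $ i = (\<Sum>j<n. P $$ (i, j) * v $ j)"
            using i v(1) Pc by (simp add: scalar_prod_def atLeast0LessThan)
          also have "\<dots> = (\<Sum>j<n. (if i = j then \<rho> * v $ j else 0) - Y $$ (i, j) * v $ j)"
            using i v(1) by (intro sum.cong refl) (auto simp: Pij left_diff_distrib)
          also have "\<dots> = \<rho> * v $ i - (\<Sum>j<n. Y $$ (i, j) * v $ j)"
            using i v(1) by (simp add: sum_subtractf)
          also have "(\<Sum>j<n. Y $$ (i, j) * v $ j) = (Y *\<^sub>v v) $ i"
            using i v(1) Y by (simp add: scalar_prod_def atLeast0LessThan)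
          finally show ?thesis .
        qed
        then show "(Y *\<^sub>v v) $ i = (\<rho> \<cdot>\<^sub>v v) $ i" using v i by simp
      qed (use Y v in auto)
      then have "eigenvector Y v \<rho>" using v Y by (simp add: eigenvector_def)
      then show False using ne\<rho> by (auto simp: eigenvalue_def)
    qed
    then obtain N where N: "N \<in> carrier_mat n n" "P * N = 1\<^sub>m n"
      using det_non_zero_imp_unit[OF Pc] unfolding Units_def by (auto simp: ring_mat_def)
    have Pq: "(\<Sum>i<n. \<Sum>j<n. x i * P $$ (i, j) * x j) = \<rho> * s x - q x" for x
    proof -
      have "(\<Sum>i<n. \<Sum>j<n. x i * P $$ (i, j) * x j) = (\<Sum>i<n. \<Sum>j<n. (if i = j then \<rho> * (x i)\<^sup>2 else 0) - x i * Y $$ (i, j) * x j)"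
        by (intro sum.cong refl) (auto simp: Pij power2_eq_square algebra_simps)
      then show ?thesis by (simp add: sum_subtractf q_def s_def sum_distrib_left)
    qed
    have PN: "(\<Sum>j<n. P $$ (i, j) * N $$ (j, k)) = (if i = k then 1 else 0)" if "i < n" "k < n" for i k
    proof -
      have "(P * N) $$ (i, k) = (\<Sum>j<n. P $$ (i, j) * N $$ (j, k))"
        using that Pc N(1) by (simp add: scalar_prod_def atLeast0LessThan)
      then show ?thesis unfolding N(2) using that by (simp add: eq_commute)
    qed
    define C where "C = (\<Sum>i<n. \<Sum>j<n. \<bar>N $$ (i, j)\<bar>) + 1"
    have C1: "1 \<le> C" by (auto simp: C_def intro!: sum_nonneg)
    \<comment> \<open>With P y = x one has |x|^2 = \<langle>x, P y\<rangle>. Cauchy-Schwarz in the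
      form \<open>P\<close> gives |x|^4 \<le> \<langle>x, P x\<rangle> * \<langle>y, P y\<rangle>,
      and \<langle>y, P y\<rangle> = \<langle>y, x\<rangle> \<le> C * |x|^2.\<close>
    have lower: "s x \<le> C * (\<rho> * s x - q x)" for x
    proof -
      define y where "y j = (\<Sum>k<n. N $$ (j, k) * x k)" for j
      have Py: "(\<Sum>j<n. P $$ (i, j) * y j) = x i" if "i < n" for i
      proof -
        have "(\<Sum>j<n. P $$ (i, j) * y j) = (\<Sum>j<n. \<Sum>k<n. P $$ (i, j) * N $$ (j, k) * x k)"
          by (simp add: y_def sum_distrib_left mult.assoc)
        also have "\<dots> = (\<Sum>k<n. (\<Sum>j<n. P $$ (i, j) * N $$ (j, k)) * x k)"
          by (subst sum.swap) (simp add: sum_distrib_right)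
        also have "\<dots> = (\<Sum>k<n. if i = k then x k else 0)" by (intro sum.cong refl) (simp add: PN that)
        finally show ?thesis using that by simp
      qed
      have xy: "(\<Sum>i<n. \<Sum>j<n. z i * P $$ (i, j) * y j) = (\<Sum>i<n. z i * x i)" for z
      proof -
        have "(\<Sum>i<n. \<Sum>j<n. z i * P $$ (i, j) * y j) = (\<Sum>i<n. z i * (\<Sum>j<n. P $$ (i, j) * y j))"
          by (simp add: sum_distrib_left mult.assoc)
        then show ?thesis by (simp add: Py)
      qed
      have yy: "(\<Sum>i<n. y i * x i) \<le> C * s x"
      proof -
        have "(\<Sum>i<n. y i * x i) = (\<Sum>i<n. \<Sum>j<n. x i * N $$ (i, j) * x j)"
          by (simp add: y_def sum_distrib_left sum_distrib_right ac_simps)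
        also have "\<dots> \<le> (\<Sum>i<n. \<Sum>j<n. \<bar>N $$ (i, j)\<bar>) * s x" by (rule form_le)
        also have "\<dots> \<le> C * s x" by (intro mult_right_mono) (auto simp: C_def s_def sum_nonneg)
        finally show ?thesis .
      qed
      have "(\<Sum>i<n. \<Sum>j<n. x i * P $$ (i, j) * y j)\<^sup>2
          \<le> (\<Sum>i<n. \<Sum>j<n. x i * P $$ (i, j) * x j) * (\<Sum>i<n. \<Sum>j<n. y i * P $$ (i, j) * y j)"
      proof (rule psd_cauchy_schwarz)
        show "0 \<le> (\<Sum>i<n. \<Sum>j<n. x i * P $$ (i, j) * x j)" for x unfolding Pq using ray\<rho>[of x] by simp
      qed (simp add: Pij sym)
      then have "(s x)\<^sup>2 \<le> (\<rho> * s x - q x) * (\<Sum>i<n. y i * x i)"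
        unfolding xy Pq by (simp add: s_def power2_eq_square)
      also have "\<dots> \<le> (\<rho> * s x - q x) * (C * s x)" using ray\<rho> by (intro mult_left_mono yy) auto
      finally have *: "s x * s x \<le> C * (\<rho> * s x - q x) * s x" by (simp add: power2_eq_square mult_ac)
      show ?thesis
      proof (cases "s x = 0")
        case True
        then show ?thesis using ray\<rho>[of x] C1 by (simp add: mult_nonneg_nonpos)
      next
        case False
        moreover have "0 \<le> s x" by (simp add: s_def sum_nonneg)
        ultimately show ?thesis using * by (intro mult_right_le_imp_le[of "s x" "s x"]) auto
      qed
    qed
    \<comment> \<open>On unit vectors \<open>lower\<close> leaves a gap 1 / C below the supremum,
      which is absurd.\<close>
    have "\<rho> \<le> \<rho> - 1 / C" unfolding \<rho>_def
    proof (rule cSup_least[OF ne])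
      fix y assume "y \<in> S"
      then obtain x where x: "s x = 1" "y = q x" by (auto simp: S_def)
      show "y \<le> Sup S - 1 / C" using lower[of x] C1 x by (simp add: \<rho>_def field_simps)
    qed
    then show False using C1 by simp
  qed
  then have "\<rho> \<le> l" by (rule top)
  then have "\<rho> * s x \<le> l * s x" by (intro mult_right_mono) (auto simp: s_def sum_nonneg)
  then show ?thesis using ray\<rho>[of x] by (simp add: q_def s_def)
qed

section \<open>From entrywise error to wrong labels\<close>

lemma sdp_feasibleD:
  assumes Y: "Y \<in> sdp_feasible n"
  shows "Y \<in> carrier_mat n n" "\<And>i. i < n \<Longrightarrow> Y $$ (i, i) = 1"
    "\<And>i j. i < n \<Longrightarrow> j < n \<Longrightarrow> Y $$ (i, j) = Y $$ (j, i)"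
    "\<And>x. 0 \<le> (\<Sum>i<n. \<Sum>j<n. x i * Y $$ (i, j) * x j)"
proof -
  have Yc: "Y \<in> carrier_mat n n" and Yt: "transpose_mat Y = Y" and diag: "\<And>i. i < n \<Longrightarrow> Y $$ (i, i) = 1"
    and psd: "\<And>x. x \<in> carrier_vec n \<Longrightarrow> 0 \<le> scalar_prod x (Y *\<^sub>v x)"
    using Y by (auto simp: sdp_feasible_def pos_semidef_def)
  have sym: "Y $$ (i, j) = Y $$ (j, i)" if "i < n" "j < n" for i j
    using Yt Yc that by (metis carrier_matD index_transpose_mat(1))
  have psd': "0 \<le> (\<Sum>i<n. \<Sum>j<n. x i * Y $$ (i, j) * x j)" for x
  proof -
    have "scalar_prod (Matrix.vec n x) (Y *\<^sub>v Matrix.vec n x) = (\<Sum>i<n. \<Sum>j<n. x i * Y $$ (i, j) * x j)"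
      using Yc by (simp add: scalar_prod_def atLeast0LessThan sum_distrib_left mult.assoc)
    then show ?thesis using psd[of "Matrix.vec n x"] by simp
  qed
  show "Y \<in> carrier_mat n n" "\<And>i. i < n \<Longrightarrow> Y $$ (i, i) = 1"
    "\<And>i j. i < n \<Longrightarrow> j < n \<Longrightarrow> Y $$ (i, j) = Y $$ (j, i)"
    "\<And>x. 0 \<le> (\<Sum>i<n. \<Sum>j<n. x i * Y $$ (i, j) * x j)"
    by (fact Yc diag sym psd')+
qed

text \<open>The matrix \<Delta> of gauged deviations has entries in [0, 2] that sum to the error
  \<gamma>, so its squared Frobenius norm is at most 2 * \<gamma>. This controls the eigenvector
  equation directly, without comparing \<open>Y\<close> to an optimal solution.\<close>

lemma label_err_le:
  fixes Y :: "real Matrix.mat"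
  assumes Y: "Y \<in> sdp_feasible n" and n: "0 < n" and \<sigma>: "label_vec n \<sigma>" and v: "top_eigenvector Y v"
  shows "label_err n (sign_vec v) \<sigma> \<le> 12 * (entrywise_l1_norm (Y - label_mat \<sigma>) / (real n)\<^sup>2)"
proof -
  note Yc = sdp_feasibleD(1)[OF Y] and diag = sdp_feasibleD(2)[OF Y] and sym = sdp_feasibleD(3)[OF Y]
    and psd' = sdp_feasibleD(4)[OF Y]
  have \<sigma>c: "\<sigma> \<in> carrier_vec n" and \<sigma>1: "\<And>i. i < n \<Longrightarrow> \<sigma> $ i = 1 \<or> \<sigma> $ i = -1"
    using \<sigma> by (auto simp: label_vec_def)
  have \<sigma>\<sigma>: "\<sigma> $ i * \<sigma> $ i = 1" if "i < n" for i using \<sigma>1[OF that] by auto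
  define g where "g i j = \<sigma> $ i * \<sigma> $ j * Y $$ (i, j)" for i j
  define \<Delta> where "\<Delta> i j = 1 - g i j" for i j
  \<comment> \<open>Cauchy-Schwarz on two unit vectors, that is, the 2 by 2 minors. The entries
    \<Delta> i j are therefore nonnegative, and the l1 norm is their plain sum.\<close>
  have gle: "\<bar>g i j\<bar> \<le> 1" if "i < n" "j < n" for i j
  proof -
    let ?e = "\<lambda>a b::nat. if a = b then 1 else 0 :: real"
    have e: "(\<Sum>k<n. \<Sum>m<n. ?e a k * Y $$ (k, m) * ?e b m) = Y $$ (a, b)" if "a < n" "b < n" for a b
    proof -
      have "(\<Sum>k<n. \<Sum>m<n. ?e a k * Y $$ (k, m) * ?e b m) = (\<Sum>k<n. if a = k then Y $$ (k, b) else 0)"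
        using that by (intro sum.cong refl) (auto simp: if_distrib[of "(*) _"] cong: if_cong)
      then show ?thesis using that by simp
    qed
    have "(Y $$ (i, j))\<^sup>2 \<le> Y $$ (i, i) * Y $$ (j, j)"
      using psd_cauchy_schwarz[of n "\<lambda>i j. Y $$ (i, j)" "?e i" "?e j", OF sym psd'] that
      by (simp only: e)
    then have "(Y $$ (i, j))\<^sup>2 \<le> 1" using diag that by simp
    then have "\<bar>Y $$ (i, j)\<bar> \<le> 1" by (simp add: abs_square_le_1)
    then show ?thesis using \<sigma>1[OF that(1)] \<sigma>1[OF that(2)] by (auto simp: g_def abs_mult)
  qed
  have \<Delta>0: "0 \<le> \<Delta> i j" "\<Delta> i j \<le> 2" if "i < n" "j < n" for i j
    using gle[OF that] by (auto simp: \<Delta>_def)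
  define \<gamma> where "\<gamma> = (\<Sum>i<n. \<Sum>j<n. \<Delta> i j)"
  have \<gamma>: "entrywise_l1_norm (Y - label_mat \<sigma>) = \<gamma>"
  proof -
    have "\<bar>Y $$ (i, j) - \<sigma> $ i * \<sigma> $ j\<bar> = \<Delta> i j" if "i < n" "j < n" for i j
      using \<sigma>1[OF that(1)] \<sigma>1[OF that(2)] \<Delta>0[OF that] unfolding \<Delta>_def g_def by auto
    then show ?thesis
      using Yc \<sigma>c by (auto simp: entrywise_l1_norm_def label_mat_def \<gamma>_def intro!: sum.cong)
  qed
  have \<gamma>0: "0 \<le> \<gamma>" unfolding \<gamma>_def by (intro sum_nonneg) (auto simp: \<Delta>0)
  obtain l where l: "eigenvector Y v l" "\<And>\<mu>. eigenvalue Y \<mu> \<Longrightarrow> \<mu> \<le> l"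
    using v by (auto simp: top_eigenvector_def)
  have vc: "v \<in> carrier_vec n" "v \<noteq> 0\<^sub>v n" "Y *\<^sub>v v = l \<cdot>\<^sub>v v" using l(1) Yc by (auto simp: eigenvector_def)
  define D where "D h = (\<Sum>i<n. of_bool (h * sign_vec v $ i \<noteq> \<sigma> $ i) :: real)" for h :: real
  have err: "label_err n (sign_vec v) \<sigma> \<le> 1 / n * D h" if "h = 1 \<or> h = -1" for h
    unfolding label_err_def D_def using that by (intro Min_le) auto
  show ?thesis
  \<comment> \<open>If \<gamma> is large, the right-hand side is at least 1 and the claim is
    trivial.\<close>
  proof (cases "12 * \<gamma> \<le> (real n)\<^sup>2")
    case False
    have "D 1 \<le> (\<Sum>i<n. 1)" unfolding D_def by (intro sum_mono) auto
    then have "1 / n * D 1 \<le> 1" using n by (simp add: field_simps)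
    moreover have "1 \<le> 12 * (\<gamma> / (real n)\<^sup>2)" using False n by (simp add: field_simps)
    ultimately show ?thesis using err[of 1] \<gamma> by simp
  next
    case True
    define u where "u i = \<sigma> $ i * v $ i" for i
    define U where "U = (\<Sum>i<n. (u i)\<^sup>2)"
    have Upos: "0 < U"
    proof -
      have "\<exists>i<n. v $ i \<noteq> 0"
      proof (rule ccontr)
        assume "\<not> ?thesis"
        then have "v = 0\<^sub>v n" using vc(1) by (intro eq_vecI) auto
        then show False using vc by simp
      qed
      then obtain i where i: "i < n" "v $ i \<noteq> 0" by blast
      then have "0 < (u i)\<^sup>2" using \<sigma>1[of i] by (auto simp: u_def)
      also have "\<dots> \<le> U" unfolding U_def using i by (intro member_le_sum) auto
      finally show ?thesis .
    qed
    have lbound: "n - \<gamma> / n \<le> l"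
    proof -
      have "(\<Sum>i<n. \<Sum>j<n. \<sigma> $ i * Y $$ (i, j) * \<sigma> $ j) \<le> l * (\<Sum>i<n. (\<sigma> $ i)\<^sup>2)"
        by (intro rayleigh_le_top_eigenvalue Yc n sym l(2)) auto
      also have "(\<Sum>i<n. (\<sigma> $ i)\<^sup>2) = n" by (simp add: power2_eq_square \<sigma>\<sigma>)
      also have "(\<Sum>i<n. \<Sum>j<n. \<sigma> $ i * Y $$ (i, j) * \<sigma> $ j) = (\<Sum>i<n. \<Sum>j<n. 1 - \<Delta> i j)"
        by (intro sum.cong refl) (simp add: \<Delta>_def g_def)
      also have "\<dots> = n * n - \<gamma>" by (simp add: sum_subtractf \<gamma>_def)
      finally show ?thesis using n by (simp add: field_simps)
    qed
    have nn: "0 < real n" using n by simp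
    have l1: "11 / 12 * n \<le> l"
    proof -
      have "\<gamma> / n \<le> n / 12" using True nn by (simp add: field_simps power2_eq_square)
      then show ?thesis using lbound by simp
    qed
    then have l0: "0 < l" using nn by linarith
    have eig: "l * u i = (\<Sum>j<n. u j) - (\<Sum>j<n. \<Delta> i j * u j)" if "i < n" for i
    proof -
      have "l * v $ i = (Y *\<^sub>v v) $ i" using vc that by simp
      also have "\<dots> = (\<Sum>j<n. Y $$ (i, j) * v $ j)"
        using vc(1) Yc that by (simp add: scalar_prod_def atLeast0LessThan)
      finally have "l * u i = \<sigma> $ i * (\<Sum>j<n. Y $$ (i, j) * v $ j)" by (simp add: u_def)
      also have "\<dots> = (\<Sum>j<n. u j - \<Delta> i j * u j)"
        unfolding sum_distrib_left
      proof (intro sum.cong refl)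
        fix j assume "j \<in> {..<n}"
        then have "\<sigma> $ j * \<sigma> $ j = 1" using \<sigma>\<sigma> by simp
        then have "\<sigma> $ i * (Y $$ (i, j) * v $ j) = \<sigma> $ i * (Y $$ (i, j) * v $ j) * (\<sigma> $ j * \<sigma> $ j)" by simp
        then show "\<sigma> $ i * (Y $$ (i, j) * v $ j) = u j - \<Delta> i j * u j"
          by (simp add: u_def \<Delta>_def g_def algebra_simps)
      qed
      finally show ?thesis by (simp add: sum_subtractf)
    qed
    \<comment> \<open>The value that all gauged coordinates would share if \<Delta> were
      zero.\<close>
    define c where "c = (\<Sum>j<n. u j) / l"
    have dev: "(\<Sum>i<n. (u i - c)\<^sup>2) \<le> 2 * \<gamma> * U / l\<^sup>2"
    proof -
      have "(\<Sum>i<n. (u i - c)\<^sup>2) \<le> (\<Sum>i<n. (\<Sum>j<n. 2 * \<Delta> i j) * U / l\<^sup>2)"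
      proof (rule sum_mono)
        fix i assume "i \<in> {..<n}"
        then have i: "i < n" by simp
        have "(u i - c)\<^sup>2 = (\<Sum>j<n. \<Delta> i j * u j)\<^sup>2 / l\<^sup>2"
        proof -
          have "u i - c = - (\<Sum>j<n. \<Delta> i j * u j) / l" 
          proof -
            have "u i = ((\<Sum>j<n. u j) - (\<Sum>j<n. \<Delta> i j * u j)) / l"
              using eig[OF i] l0 by (simp add: eq_divide_eq mult.commute[of "u i" l])
            then show ?thesis by (simp add: c_def diff_divide_distrib)
          qed
          then show ?thesis by (simp add: power_divide)
        qed
        also have "\<dots> \<le> (\<Sum>j<n. (\<Delta> i j)\<^sup>2) * U / l\<^sup>2"
          unfolding U_def by (intro divide_right_mono Cauchy_Schwarz_ineq_sum) auto
        also have "\<dots> \<le> (\<Sum>j<n. 2 * \<Delta> i j) * U / l\<^sup>2"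
          using Upos i \<Delta>0 unfolding power2_eq_square[of "\<Delta> _ _"] by (intro divide_right_mono mult_right_mono sum_mono) auto
        finally show "(u i - c)\<^sup>2 \<le> (\<Sum>j<n. 2 * \<Delta> i j) * U / l\<^sup>2" .
      qed
      also have "\<dots> = 2 * \<gamma> * U / l\<^sup>2"
        by (simp add: \<gamma>_def sum_distrib_left sum_distrib_right sum_divide_distrib)
      finally show ?thesis .
    qed
    have dev': "(\<Sum>i<n. (u i - c)\<^sup>2) \<le> 3 * \<gamma> * U / (real n)\<^sup>2"
    proof -
      have "2 / 3 * (real n)\<^sup>2 \<le> (11 / 12 * real n)\<^sup>2" by (simp add: power2_eq_square)
      also have "\<dots> \<le> l\<^sup>2" using l1 by (intro power_mono) auto
      finally have "2 * \<gamma> * U / l\<^sup>2 \<le> 2 * \<gamma> * U / (2 / 3 * (real n)\<^sup>2)"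
        using \<gamma>0 Upos nn l0 by (intro divide_left_mono) auto
      also have "\<dots> = 3 * \<gamma> * U / (real n)\<^sup>2" using nn by (simp add: field_simps)
      finally show ?thesis using dev by linarith
    qed
    \<comment> \<open>By \<open>dev'\<close> and the case assumption the deviation from
      \<open>c\<close> is at most a quarter of the squared norm \<open>U\<close>, so the constant
      part keeps a fixed share of it.\<close>
    have cbig: "U / 4 \<le> n * c\<^sup>2"
    proof -
      have "U \<le> (\<Sum>i<n. 2 * (u i - c)\<^sup>2 + 2 * c\<^sup>2)" unfolding U_def
      proof (rule sum_mono)
        fix i
        have "0 \<le> (u i - 2 * c)\<^sup>2" by simp
        then show "(u i)\<^sup>2 \<le> 2 * (u i - c)\<^sup>2 + 2 * c\<^sup>2" by (simp add: power2_eq_square algebra_simps)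
      qed
      also have "\<dots> = 2 * (\<Sum>i<n. (u i - c)\<^sup>2) + 2 * n * c\<^sup>2" by (simp add: sum.distrib sum_distrib_left)
      also have "(\<Sum>i<n. (u i - c)\<^sup>2) \<le> U / 4"
      proof -
        have "3 * \<gamma> * U / (real n)\<^sup>2 = 12 * \<gamma> * (U / (4 * (real n)\<^sup>2))" by simp
        also have "\<dots> \<le> (real n)\<^sup>2 * (U / (4 * (real n)\<^sup>2))" using True Upos by (intro mult_right_mono) auto
        also have "\<dots> = U / 4" using nn by simp
        finally show ?thesis using dev' by simp
      qed
      finally show ?thesis by simp
    qed
    \<comment> \<open>The global sign of the estimate. Where the label is wrong, \<open>u i\<close>
      and \<open>c\<close> have product at most 0, also if v $ i = 0, so the coordinate is at
      distance at least |c| from \<open>c\<close>.\<close>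
    define h :: real where "h = (if 0 \<le> c then 1 else -1)"
    have Dle: "D h * c\<^sup>2 \<le> (\<Sum>i<n. (u i - c)\<^sup>2)"
      unfolding D_def sum_distrib_right
    proof (rule sum_mono)
      fix i assume "i \<in> {..<n}"
      then have i: "i < n" by simp
      show "of_bool (h * sign_vec v $ i \<noteq> \<sigma> $ i) * c\<^sup>2 \<le> (u i - c)\<^sup>2"
      proof (cases "h * sign_vec v $ i = \<sigma> $ i")
        case False
        have sv: "sign_vec v $ i = (if 0 \<le> v $ i then 1 else - 1)" using i vc(1) by (simp add: sign_vec_def)
        have "u i * c \<le> 0"
          using False \<sigma>1[OF i] unfolding sv h_def u_def
          by (auto simp: mult_le_0_iff split: if_splits)
        moreover have "0 \<le> (u i)\<^sup>2" by simp
        ultimately have "c\<^sup>2 \<le> (u i - c)\<^sup>2" unfolding power2_diff by linarith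
        then show ?thesis by simp
      qed simp
    qed
    have D0: "0 \<le> D h" unfolding D_def by (intro sum_nonneg) auto
    have "D h * (U / 4) \<le> D h * (n * c\<^sup>2)" by (intro mult_left_mono cbig D0)
    also have "\<dots> = n * (D h * c\<^sup>2)" by simp
    also have "\<dots> \<le> n * (3 * \<gamma> * U / (real n)\<^sup>2)"
      using Dle dev' by (intro mult_left_mono) auto
    also have "\<dots> = (12 * \<gamma> / n) * (U / 4)" using nn by (simp add: power2_eq_square field_simps)
    finally have "D h \<le> 12 * \<gamma> / n" by (rule mult_right_le_imp_le) (use Upos in simp)
    then have "1 / n * D h \<le> 12 * (\<gamma> / (real n)\<^sup>2)" using nn by (simp add: field_simps power2_eq_square)
    then show ?thesis using err[of h] \<gamma> by (simp add: h_def split: if_splits)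
  qed
qed

section \<open>Deterministic recovery from a sublevel set\<close>

text \<open>Multiplying the Gram vectors by the labels moves the truth to the all-ones matrix. The
  diagonal may be set to 0 because both matrices have diagonal 1, and the shift \<open>c\<close>
  drops out because in the balanced case both matrices have entry sum 0.\<close>

lemma sublevel_gram:
  fixes Y :: "real Matrix.mat"
  assumes Y: "Y \<in> sdp_feasible n" and \<sigma>: "label_vec n \<sigma>" and B: "B \<in> carrier_mat n n"
    and sub: "mat_inner n B (label_mat \<sigma>) \<le> mat_inner n B Y"
    and c: "c = 0 \<or> (\<Sum>i<n. \<Sum>j<n. Y $$ (i, j)) = 0 \<and> (\<Sum>i<n. \<sigma> $ i) = 0"
  obtains V where "\<And>i. i < n \<Longrightarrow> (\<Sum>k<n. (V k i)\<^sup>2) = 1"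
    "(\<Sum>i<n. \<Sum>j<n. (if i = j then 0 else \<sigma> $ i * \<sigma> $ j * (B $$ (i, j) - c)) * (1 - (\<Sum>k<n. V k i * V k j))) \<le> 0"
    "entrywise_l1_norm (Y - label_mat \<sigma>) = (\<Sum>i<n. \<Sum>j<n. 1 - (\<Sum>k<n. V k i * V k j))"
proof -
  note Yc = sdp_feasibleD(1)[OF Y] and diag = sdp_feasibleD(2)[OF Y] and sym = sdp_feasibleD(3)[OF Y]
    and psd' = sdp_feasibleD(4)[OF Y]
  have \<sigma>c: "\<sigma> \<in> carrier_vec n" and \<sigma>1: "\<And>i. i < n \<Longrightarrow> \<sigma> $ i = 1 \<or> \<sigma> $ i = -1"
    using \<sigma> by (auto simp: label_vec_def)
  have \<sigma>\<sigma>: "\<sigma> $ i * \<sigma> $ i = 1" if "i < n" for i using \<sigma>1[OF that] by auto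
  obtain V0 where V0: "\<And>i j. i < n \<Longrightarrow> j < n \<Longrightarrow> Y $$ (i, j) = (\<Sum>k<n. V0 k i * V0 k j)"
    using psd_gram[of n "\<lambda>i j. Y $$ (i, j)"] sym psd' by blast
  define V where "V k i = \<sigma> $ i * V0 k i" for k i
  have g: "(\<Sum>k<n. V k i * V k j) = \<sigma> $ i * \<sigma> $ j * Y $$ (i, j)" if "i < n" "j < n" for i j
    by (simp add: V_def V0[OF that] sum_distrib_left ac_simps)
  have unit: "(\<Sum>k<n. (V k i)\<^sup>2) = 1" if "i < n" for i
    using g[OF that that] \<sigma>\<sigma>[OF that] diag[OF that] by (simp add: power2_eq_square)
  have gle: "\<bar>\<sigma> $ i * \<sigma> $ j * Y $$ (i, j)\<bar> \<le> 1" if "i < n" "j < n" for i j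
  proof -
    have "(\<Sum>k<n. V k i * V k j)\<^sup>2 \<le> (\<Sum>k<n. (V k i)\<^sup>2) * (\<Sum>k<n. (V k j)\<^sup>2)" by (rule Cauchy_Schwarz_ineq_sum)
    then show ?thesis unfolding g[OF that] unit[OF that(1)] unit[OF that(2)] by (simp add: abs_square_le_1)
  qed
  have l1: "entrywise_l1_norm (Y - label_mat \<sigma>) = (\<Sum>i<n. \<Sum>j<n. 1 - (\<Sum>k<n. V k i * V k j))"
  proof -
    have "\<bar>Y $$ (i, j) - \<sigma> $ i * \<sigma> $ j\<bar> = 1 - (\<Sum>k<n. V k i * V k j)" if "i < n" "j < n" for i j
      using \<sigma>1[OF that(1)] \<sigma>1[OF that(2)] gle[OF that] unfolding g[OF that] by auto
    then show ?thesis
      using Yc \<sigma>c by (auto simp: entrywise_l1_norm_def label_mat_def intro!: sum.cong)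
  qed
  have shift: "c * (\<Sum>i<n. \<Sum>j<n. \<sigma> $ i * \<sigma> $ j - Y $$ (i, j)) = 0"
  proof (cases "c = 0")
    case False
    then have "(\<Sum>i<n. \<Sum>j<n. Y $$ (i, j)) = 0" "(\<Sum>i<n. \<sigma> $ i) = 0" using c by auto
    moreover have "(\<Sum>i<n. \<Sum>j<n. \<sigma> $ i * \<sigma> $ j) = (\<Sum>i<n. \<sigma> $ i) * (\<Sum>i<n. \<sigma> $ i)" by (simp add: sum_product)
    ultimately show ?thesis by (simp add: sum_subtractf)
  qed simp
  have "(\<Sum>i<n. \<Sum>j<n. (if i = j then 0 else \<sigma> $ i * \<sigma> $ j * (B $$ (i, j) - c)) * (1 - (\<Sum>k<n. V k i * V k j)))
      = (\<Sum>i<n. \<Sum>j<n. (B $$ (i, j) - c) * (\<sigma> $ i * \<sigma> $ j - Y $$ (i, j)))"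
  proof (intro sum.cong refl)
    fix i j assume "i \<in> {..<n}" "j \<in> {..<n}"
    then have ij: "i < n" "j < n" by auto
    show "(if i = j then 0 else \<sigma> $ i * \<sigma> $ j * (B $$ (i, j) - c)) * (1 - (\<Sum>k<n. V k i * V k j)) =
       (B $$ (i, j) - c) * (\<sigma> $ i * \<sigma> $ j - Y $$ (i, j))"
      unfolding g[OF ij] using \<sigma>1[OF ij(1)] \<sigma>1[OF ij(2)] diag[OF ij(1)] by (auto simp: algebra_simps)
  qed
  also have "\<dots> = (\<Sum>i<n. \<Sum>j<n. B $$ (i, j) * (\<sigma> $ i * \<sigma> $ j)) - (\<Sum>i<n. \<Sum>j<n. B $$ (i, j) * Y $$ (i, j))
      - c * (\<Sum>i<n. \<Sum>j<n. \<sigma> $ i * \<sigma> $ j - Y $$ (i, j))"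
    unfolding sum_distrib_left sum_subtractf[symmetric] by (intro sum.cong refl) (simp add: algebra_simps)
  also have "\<dots> = mat_inner n B (label_mat \<sigma>) - mat_inner n B Y"
    unfolding shift mat_inner_def using \<sigma>c by (simp add: label_mat_def)
  also have "\<dots> \<le> 0" using sub by simp
  finally show ?thesis using that[of V] unit l1 by blast
qed

text \<open>The budget is \<theta> / 4 * R: the rows contribute 4 * \<theta> * R / 32 and the
  removed ones \<theta> * R / 8. This gives R / 2, and for R \<ge> 1 halving is compensated by
  rounding down.\<close>

lemma recovery_bound:
  fixes B W V :: "nat \<Rightarrow> nat \<Rightarrow> real" and \<mu> \<theta> lam R :: real and h :: "nat \<Rightarrow> real"
  assumes unit: "\<And>i. i < n \<Longrightarrow> (\<Sum>k<m. (V k i)\<^sup>2) = 1"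
    and Bsym: "\<And>i j. i < n \<Longrightarrow> j < n \<Longrightarrow> B i j = B j i"
    and Wsym: "\<And>i j. i < n \<Longrightarrow> j < n \<Longrightarrow> W i j = W j i"
    and BW: "\<And>i j. i < n \<Longrightarrow> j < n \<Longrightarrow> B i j = (if i = j then 0 else \<mu>) + W i j"
    and \<mu>: "0 \<le> \<mu>" and n: "0 < n"
    and sub: "(\<Sum>i<n. \<Sum>j<n. B i j * (1 - (\<Sum>k<m. V k i * V k j))) \<le> 0"
    and spec: "\<And>x. (\<And>i. i < n \<Longrightarrow> i \<notin> G \<Longrightarrow> x i = 0) \<Longrightarrow>
        (\<Sum>i<n. \<Sum>j<n. W i j * x i * x j) \<le> \<theta> / 2 * (\<Sum>i<n. (x i)\<^sup>2)"
    and h: "\<And>i. i < n \<Longrightarrow> i \<notin> G \<Longrightarrow> (\<Sum>j<n. \<bar>W i j\<bar>) \<le> h i"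
    and \<theta>: "0 < \<theta>" and lam: "0 < lam" "1 \<le> \<theta> * lam" and R: "0 \<le> R"
    and S: "32 * (\<Sum>i<n. exp (lam * (\<theta> - (\<Sum>j<n. B i j)))) \<le> R"
    and bad: "{..<n} - G \<noteq> {} \<Longrightarrow> 1 \<le> R" "8 * (\<Sum>i\<in>{..<n} - G. h i) \<le> \<theta> / 8 * R"
  shows "(\<Sum>i<n. \<Sum>j<n. 1 - (\<Sum>k<m. V k i * V k j)) / n \<le> of_int \<lfloor>R\<rfloor>"
proof -
  define d where "d i = (\<Sum>j<n. B i j)" for i
  define \<gamma> where "\<gamma> = (\<Sum>i<n. \<Sum>j<n. 1 - (\<Sum>k<m. V k i * V k j)) / n"
  have core: "\<theta> / 2 * \<gamma> \<le> 4 * (\<Sum>i<n. max 0 (\<theta> - d i)) + 8 * (\<Sum>i\<in>{..<n} - G. h i)"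
    unfolding d_def \<gamma>_def using \<theta> by (intro sdp_core[OF unit Bsym Wsym BW \<mu> _ n sub spec h]) auto
  have S0: "exp (lam * (\<theta> - d i)) \<le> R / 32" if "i < n" for i
    using member_le_sum[of i "{..<n}" "\<lambda>i. exp (lam * (\<theta> - d i))"] S that by (simp add: d_def)
  have "\<gamma> \<le> of_int \<lfloor>R\<rfloor>"
  proof (cases "1 \<le> R")
    case False
    \<comment> \<open>R / 32 < 1 forces every single exponential below 1, so no row has a
      shortfall.\<close>
    have "max 0 (\<theta> - d i) = 0" if "i < n" for i
    proof -
      have "exp (lam * (\<theta> - d i)) < 1" using S0[OF that] False R by linarith
      then have "lam * (\<theta> - d i) < 0" by simp
      then show ?thesis using lam by (simp add: mult_less_0_iff)
    qed
    then have "(\<Sum>i<n. max 0 (\<theta> - d i)) = 0" by (intro sum.neutral) auto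
    moreover have "(\<Sum>i\<in>{..<n} - G. h i) = 0" using bad(1) False by (intro sum.neutral) blast
    ultimately have "\<theta> / 2 * \<gamma> \<le> 0" using core by simp
    then have "\<gamma> \<le> 0" using \<theta> by (simp add: mult_le_0_iff)
    moreover have "\<lfloor>R\<rfloor> = 0" using False R by (simp add: floor_eq_iff)
    ultimately show ?thesis by simp
  next
    case True
    \<comment> \<open>t \<le> exp t with t = lam * (\<theta> - d i); dividing by \<open>lam\<close>
      loses 1 / lam \<le> \<theta>.\<close>
    have "max 0 (\<theta> - d i) \<le> \<theta> * exp (lam * (\<theta> - d i))" for i
    proof -
      have "lam * (\<theta> - d i) \<le> exp (lam * (\<theta> - d i))" using exp_ge_add_one_self[of "lam * (\<theta> - d i)"] by linarith
      also have "\<dots> \<le> (\<theta> * lam) * exp (lam * (\<theta> - d i))" using lam(2) by (intro mult_le_cancel_right1[THEN iffD2]) auto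
      finally have "lam * (\<theta> - d i) \<le> lam * (\<theta> * exp (lam * (\<theta> - d i)))" by (simp add: mult_ac)
      then have "\<theta> - d i \<le> \<theta> * exp (lam * (\<theta> - d i))" using lam(1) by simp
      then show ?thesis using \<theta> by simp
    qed
    then have "(\<Sum>i<n. max 0 (\<theta> - d i)) \<le> \<theta> * (\<Sum>i<n. exp (lam * (\<theta> - d i)))"
      unfolding sum_distrib_left by (intro sum_mono) auto
    also have "\<dots> \<le> \<theta> * (R / 32)" using S \<theta> by (intro mult_left_mono) (auto simp: d_def)
    finally have "\<theta> / 2 * \<gamma> \<le> \<theta> / 2 * (R / 2)" using core bad(2) by (simp add: mult.commute[of \<gamma> \<theta>])
    then have "\<gamma> \<le> R / 2" by (rule mult_left_le_imp_le) (use \<theta> in simp)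
    also have "R / 2 \<le> of_int \<lfloor>R\<rfloor>" 
    proof -
      have "1 \<le> real_of_int \<lfloor>R\<rfloor>" using True by simp
      then show ?thesis using floor_correct[of R] by linarith
    qed
    finally show ?thesis .
  qed
  then show ?thesis by (simp add: \<gamma>_def)
qed

section \<open>Spectral bound for sparse noise\<close>

text \<open>A quadratic form without diagonal is affine in every coordinate, so on each cell of the integer grid it is maximal
  at a vertex. This replaces the usual net argument and keeps the support of \<open>x\<close>.\<close>

lemma multiaffine_rounding:
  fixes w :: "nat \<times> nat \<Rightarrow> real" and x :: "nat \<Rightarrow> real"
  shows "\<exists>z :: nat \<Rightarrow> int. (\<forall>i. z i = \<lfloor>x i\<rfloor> \<or> z i = \<lceil>x i\<rceil>) \<and>
    upper_form n w x \<le> (\<Sum>(i, j)\<in>upper_pairs n. w (i, j) * z i * z j)"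
proof -
  define f where "f y = upper_form n w y" for y :: "nat \<Rightarrow> real"
  have aff: "f (y(m := t)) = f (y(m := 0)) + t * (f (y(m := 1)) - f (y(m := 0)))" for y m t
    unfolding f_def sum_subtractf[symmetric] sum_distrib_left sum.distrib[symmetric]
    by (intro sum.cong refl) (auto simp: algebra_simps)
  have "\<exists>z :: nat \<Rightarrow> int. (\<forall>i. z i = \<lfloor>x i\<rfloor> \<or> z i = \<lceil>x i\<rceil>) \<and>
      f x \<le> f (\<lambda>i. if i < m then z i else x i)" for m
  proof (induction m)
    case 0
    show ?case by (intro exI[of _ "\<lambda>i. \<lfloor>x i\<rfloor>"]) simp
  next
    case (Suc m)
    then obtain z where z: "\<forall>i. z i = \<lfloor>x i\<rfloor> \<or> z i = \<lceil>x i\<rceil>" "f x \<le> f (\<lambda>i. if i < m then z i else x i)" by blast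
    define y where "y = (\<lambda>i. if i < m then real_of_int (z i) else x i)"
    define b where "b = f (y(m := 1)) - f (y(m := 0))"
    \<comment> \<open>In the coordinate \<open>m\<close> the form is affine with slope
      \<open>b\<close>, whose sign decides the direction of rounding.\<close>
    define r where "r = (if 0 \<le> b then \<lceil>x m\<rceil> else \<lfloor>x m\<rfloor>)"
    have "f y = f (y(m := x m))" by (rule arg_cong[of _ _ f]) (auto simp: y_def fun_eq_iff)
    also have "\<dots> \<le> f (y(m := real_of_int r))"
    proof -
      have "x m * b \<le> real_of_int r * b"
        unfolding r_def by (auto intro: mult_right_mono mult_right_mono_neg)
      then show ?thesis unfolding aff[of y m "x m"] aff[of y m "real_of_int r"] b_def by simp
    qed
    also have "y(m := real_of_int r) = (\<lambda>i. if i < Suc m then real_of_int ((z(m := r)) i) else x i)"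
      by (auto simp: y_def fun_eq_iff)
    finally have "f x \<le> f (\<lambda>i. if i < Suc m then real_of_int ((z(m := r)) i) else x i)"
      using z(2) by (simp add: y_def)
    moreover have "\<forall>i. (z(m := r)) i = \<lfloor>x i\<rfloor> \<or> (z(m := r)) i = \<lceil>x i\<rceil>" using z(1) by (simp add: r_def)
    ultimately show ?case by blast
  qed
  then obtain z where z: "\<forall>i. z i = \<lfloor>x i\<rfloor> \<or> z i = \<lceil>x i\<rceil>" "f x \<le> f (\<lambda>i. if i < n then z i else x i)" by blast
  have "f (\<lambda>i. if i < n then real_of_int (z i) else x i) = f (\<lambda>i. z i)"
    unfolding f_def by (intro sum.cong) auto
  with z(2) have "f x \<le> f (\<lambda>i. z i)" by (simp only:)
  with z(1) show ?thesis unfolding f_def by blast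
qed

text \<open>Scale \<open>x\<close> to squared norm \<open>n\<close> and round. Rounding at most
  doubles the squared norm and adds 2 per coordinate, which is the 4 * n in \<open>int_net\<close>.
  Zero rounds to zero, so the support in \<open>G\<close> is kept.\<close>

lemma quadratic_form_le_from_net:
  fixes w :: "nat \<times> nat \<Rightarrow> real" and x :: "nat \<Rightarrow> real"
  assumes n: "0 < n" and B: "0 \<le> B"
    and net: "\<And>z. z \<in> int_net n \<Longrightarrow> (\<And>i. i < n \<Longrightarrow> i \<notin> G \<Longrightarrow> z i = 0) \<Longrightarrow>
        (\<Sum>(i, j)\<in>upper_pairs n. w (i, j) * z i * z j) \<le> B * n"
    and x: "\<And>i. i < n \<Longrightarrow> i \<notin> G \<Longrightarrow> x i = 0"
  shows "upper_form n w x \<le> B * (\<Sum>i<n. (x i)\<^sup>2)"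
proof (cases "(\<Sum>i<n. (x i)\<^sup>2) = 0")
  case True
  then have "x i = 0" if "i < n" for i using that by (simp add: sum_nonneg_eq_0_iff)
  then have "upper_form n w x = 0" by (intro sum.neutral) auto
  then show ?thesis using True by simp
next
  case False
  define s where "s = (\<Sum>i<n. (x i)\<^sup>2)"
  have s0: "0 < s" using False unfolding s_def by (simp add: sum_nonneg order_less_le)
  define c where "c = sqrt (n / s)"
  have c2: "c * c = n / s" using s0 by (simp add: c_def)
  define y where "y i = c * x i" for i
  have y2: "(\<Sum>i<n. (y i)\<^sup>2) = n"
  proof -
    have "(\<Sum>i<n. (y i)\<^sup>2) = (c * c) * s" 
      unfolding y_def s_def sum_distrib_left by (intro sum.cong refl) (simp add: power2_eq_square ac_simps)
    then show ?thesis using s0 c2 by simp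
  qed
  obtain z0 where z0: "\<forall>i. z0 i = \<lfloor>y i\<rfloor> \<or> z0 i = \<lceil>y i\<rceil>"
    "upper_form n w y \<le> (\<Sum>(i, j)\<in>upper_pairs n. w (i, j) * z0 i * z0 j)"
    using multiaffine_rounding[where x = y and n = n and w = w] by blast
  define z where "z = restrict z0 {..<n}"
  have zsq: "(real_of_int (z0 i))\<^sup>2 \<le> 2 * (y i)\<^sup>2 + 2" for i
  proof -
    have "\<bar>real_of_int (z0 i)\<bar> \<le> \<bar>y i\<bar> + 1" using z0(1)[rule_format, of i] by (elim disjE) linarith+
    then have "\<bar>real_of_int (z0 i)\<bar>\<^sup>2 \<le> (\<bar>y i\<bar> + 1)\<^sup>2" by (intro power_mono) auto
    moreover have "0 \<le> (\<bar>y i\<bar> - 1)\<^sup>2" by simp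
    ultimately show ?thesis by (simp add: power2_sum power2_diff)
  qed
  have sumz: "(\<Sum>i<n. (real_of_int (z i))\<^sup>2) \<le> 4 * real n"
  proof -
    have "(\<Sum>i<n. (real_of_int (z i))\<^sup>2) \<le> (\<Sum>i<n. 2 * (y i)\<^sup>2 + 2)" using zsq by (intro sum_mono) (simp add: z_def)
    also have "\<dots> = 4 * real n" by (simp add: sum.distrib sum_distrib_left[symmetric] y2)
    finally show ?thesis .
  qed
  have sumz': "(\<Sum>i<n. (z i)\<^sup>2) \<le> 4 * int n"
  proof -
    have "real_of_int (\<Sum>i<n. (z i)\<^sup>2) \<le> real_of_int (4 * int n)" using sumz by simp
    then show ?thesis by (rule of_int_le_iff[THEN iffD1])
  qed
  have znet: "z \<in> int_net n"
  proof -
    have "z i \<in> {- (2 * int n)..2 * int n}" if "i < n" for i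
    proof -
      have "(z i)\<^sup>2 \<le> (\<Sum>i<n. (z i)\<^sup>2)" using that by (intro member_le_sum) auto
      also have "\<dots> \<le> 4 * int n" by (rule sumz')
      also have "\<dots> \<le> (2 * int n)\<^sup>2" using n by (simp add: power2_eq_square)
      finally have "\<bar>z i\<bar> \<le> \<bar>2 * int n\<bar>" by (rule abs_le_square_iff[THEN iffD2])
      then show ?thesis by auto
    qed
    then show ?thesis using sumz' by (auto simp: int_net_def z_def)
  qed
  have "z i = 0" if "i < n" "i \<notin> G" for i
    using x[OF that] z0(1)[rule_format, of i] that by (auto simp: z_def y_def)
  then have "(\<Sum>(i, j)\<in>upper_pairs n. w (i, j) * z i * z j) \<le> B * n" by (intro net znet)
  also have "(\<Sum>(i, j)\<in>upper_pairs n. w (i, j) * z i * z j) = (\<Sum>(i, j)\<in>upper_pairs n. w (i, j) * z0 i * z0 j)"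
    by (intro sum.cong) (auto simp: z_def)
  finally have "upper_form n w y \<le> B * n" using z0(2) by simp
  also have "upper_form n w y = (c * c) * upper_form n w x"
    by (simp add: y_def sum_distrib_left case_prod_unfold ac_simps)
  finally show ?thesis using s0 n unfolding c2 s_def[symmetric] by (simp add: field_simps)
qed

definition sym_ext :: "(nat \<times> nat \<Rightarrow> real) \<Rightarrow> nat \<Rightarrow> nat \<Rightarrow> real" where
  "sym_ext w i j = (if i < j then w (i, j) else if j < i then w (j, i) else 0)"

lemma sym_ext_commute: "sym_ext w i j = sym_ext w j i"
  by (simp add: sym_ext_def)

lemma sum_sym_ext:
  "(\<Sum>i<n. \<Sum>j<n. sym_ext w i j * x i * x j) = 2 * upper_form n w x"
proof -
  have up: "(\<Sum>i<n. \<Sum>j<n. if i < j then w (i, j) * x i * x j else 0) = upper_form n w x"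
    unfolding sum.cartesian_product by (intro sum.mono_neutral_cong_right) (auto split: if_splits)
  have "(\<Sum>i<n. \<Sum>j<n. sym_ext w i j * x i * x j) =
     (\<Sum>i<n. \<Sum>j<n. (if i < j then w (i, j) * x i * x j else 0) + (if j < i then w (j, i) * x j * x i else 0))"
    by (intro sum.cong refl) (auto simp: sym_ext_def)
  also have "\<dots> = (\<Sum>i<n. \<Sum>j<n. if i < j then w (i, j) * x i * x j else 0) +
     (\<Sum>i<n. \<Sum>j<n. if j < i then w (j, i) * x j * x i else 0)" by (simp add: sum.distrib)
  also have "(\<Sum>i<n. \<Sum>j<n. if j < i then w (j, i) * x j * x i else 0) = (\<Sum>i<n. \<Sum>j<n. if i < j then w (i, j) * x i * x j else 0)"
    by (rule sum.swap)
  finally show ?thesis by (simp add: up)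
qed

text \<open>The set of vertices of bounded degree is random, so the event is chosen before
  \<open>K\<close> and \<open>x\<close>, and the degree condition is imposed on the support of
  \<open>x\<close> afterwards. The entry bound is a condition inside the event because it holds
  almost surely only.\<close>

lemma (in prob_space) sparse_spectral_event:
  fixes X :: "nat \<times> nat \<Rightarrow> 'a \<Rightarrow> real" and W :: "nat \<times> nat \<Rightarrow> real \<Rightarrow> real"
  assumes ind: "indep_vars (\<lambda>_. borel) X I" and I: "upper_pairs n \<subseteq> I"
    and W: "\<And>e. W e \<in> borel_measurable borel"
    and n: "0 < n" and p: "0 < p" "1 \<le> n * p"
    and mgf: "\<And>e s. e \<in> upper_pairs n \<Longrightarrow> \<bar>s\<bar> \<le> 1 / 2 \<Longrightarrow>
       (\<integral>\<^sup>+\<omega>. ennreal (exp (s * W e (X e \<omega>))) \<partial>M) \<le> ennreal (exp (s\<^sup>2 * p))"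
    and pX: "\<And>e. e \<in> upper_pairs n \<Longrightarrow> prob {\<omega> \<in> space M. X e \<omega> \<noteq> 0} \<le> p"
  shows "\<exists>E\<in>events. 1 - (exp (- real n) + 2 / n) \<le> prob E \<and> (\<forall>\<omega>\<in>E. \<omega> \<in> space M \<and>
    (\<forall>K x. 0 \<le> K \<longrightarrow> (\<forall>e\<in>upper_pairs n. \<bar>W e (X e \<omega>)\<bar> \<le> of_bool (X e \<omega> \<noteq> 0) + p) \<longrightarrow>
       (\<forall>i<n. x i \<noteq> 0 \<longrightarrow> (\<Sum>e\<in>edge_pairs n {i} {..<n}. of_bool (X e \<omega> \<noteq> 0)) \<le> K * (n * p)) \<longrightarrow>
       upper_form n (\<lambda>e. W e (X e \<omega>)) x
         \<le> (9200 + 32 * K) * sqrt (n * p) * (\<Sum>i<n. (x i)\<^sup>2)))"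
proof -
  define D where "D = n * p"
  have D1: "1 \<le> D" using p by (simp add: D_def)
  \<comment> \<open>Feige and Ofek's light pairs: the Chernoff parameter z i * z j / (2 * sqrt D) is
    at most 1 / 2 exactly for them.\<close>
  define L where "L z = {(i, j) \<in> upper_pairs n. \<bar>real_of_int (z i) * z j\<bar> \<le> sqrt D}" for z :: "nat \<Rightarrow> int"
  obtain E1 where E1: "E1 \<in> events" "1 - exp (- real n) \<le> prob E1"
    "\<And>\<omega> z. \<omega> \<in> E1 \<Longrightarrow> z \<in> int_net n \<Longrightarrow>
      (\<Sum>(i, j)\<in>L z. W (i, j) (X (i, j) \<omega>) * z i * z j) \<le> 22 * real n * sqrt (n * p)"
  proof -
    have "(\<integral>\<^sup>+\<omega>. ennreal (exp (z i * z j / (2 * sqrt (n * p)) * W (i, j) (X (i, j) \<omega>))) \<partial>M)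
          \<le> ennreal (exp ((z i * z j / (2 * sqrt (n * p)))\<^sup>2 * p))" if "(i, j) \<in> L z" for z i j
    proof (rule mgf[of "(i, j)" "real_of_int (z i) * real_of_int (z j) / (2 * sqrt (real n * p))"])
      show "(i, j) \<in> upper_pairs n" using that by (simp add: L_def)
      have sq: "0 < sqrt D" using D1 by simp
      moreover have "\<bar>real_of_int (z i) * z j\<bar> \<le> sqrt D" using that by (simp add: L_def)
      ultimately have "\<bar>real_of_int (z i) * z j\<bar> / (2 * sqrt D) \<le> 1 / 2" by (simp add: field_simps)
      then show "\<bar>real_of_int (z i) * real_of_int (z j) / (2 * sqrt (real n * p))\<bar> \<le> 1 / 2"
        unfolding D_def[symmetric] abs_divide[of _ "2 * sqrt D"] abs_mult[of 2] abs_of_pos[OF sq] by simp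
    qed
    note mg = this
    have Lsub: "L z \<subseteq> upper_pairs n" for z by (auto simp: L_def)
    have "\<exists>E\<in>events. 1 - exp (- real n) \<le> prob E \<and> (\<forall>\<omega>\<in>E. \<omega> \<in> space M \<and> (\<forall>z\<in>int_net n.
     (\<Sum>(i, j)\<in>L z. W (i, j) (X (i, j) \<omega>) * z i * z j) \<le> 22 * real n * sqrt (n * p)))"
      by (rule light_pairs_bound[where I = I and W = W and X = X, OF ind I W n p(1) Lsub mg])
    then show ?thesis using that by blast
  qed
  obtain E2 where E2: "E2 \<in> events" "1 - 2 / real n \<le> prob E2"
    "\<And>\<omega>. \<omega> \<in> E2 \<Longrightarrow> \<omega> \<in> space M \<and> discrepancy n p (\<lambda>e. of_bool (X e \<omega> \<noteq> 0))"
    using discrepancy_event[OF ind I n p(1) pX] by blast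
  have pE: "1 - (exp (- real n) + 2 / n) \<le> prob (E1 \<inter> E2)"
    by (rule prob_Int_ge[OF E1(1) E2(1) E1(2) E2(2)])
  have main: "upper_form n (\<lambda>e. W e (X e \<omega>)) x
         \<le> (9200 + 32 * K) * sqrt (n * p) * (\<Sum>i<n. (x i)\<^sup>2)"
    if \<omega>: "\<omega> \<in> E1" "\<omega> \<in> E2" and K: "0 \<le> K"
      and Wb: "\<forall>e\<in>upper_pairs n. \<bar>W e (X e \<omega>)\<bar> \<le> of_bool (X e \<omega> \<noteq> 0) + p"
      and deg: "\<forall>i<n. x i \<noteq> 0 \<longrightarrow> (\<Sum>e\<in>edge_pairs n {i} {..<n}. of_bool (X e \<omega> \<noteq> 0)) \<le> K * (n * p)"
    for \<omega> K x
  proof (rule quadratic_form_le_from_net[where G = "{i. x i \<noteq> 0}" and w = "\<lambda>e. W e (X e \<omega>)", OF n])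
    show "0 \<le> (9200 + 32 * K) * sqrt (n * p)" using K p n by simp
    fix z assume z: "z \<in> int_net n" "\<And>i. i < n \<Longrightarrow> i \<notin> {i. x i \<noteq> 0} \<Longrightarrow> z i = 0"
    define N :: "nat \<times> nat \<Rightarrow> real" where "N e = of_bool (X e \<omega> \<noteq> 0)" for e
    define H where "H = {(i, j). i < j \<and> j < n \<and> sqrt D < \<bar>real_of_int (z i) * z j\<bar>}"
    have finH: "finite H" by (rule finite_subset[of _ "upper_pairs n"]) (auto simp: H_def)
    have z4: "(\<Sum>i<n. (real_of_int (z i))\<^sup>2) \<le> 4 * real n"
    proof -
      have "real_of_int (\<Sum>i<n. (z i)\<^sup>2) \<le> real_of_int (4 * int n)"
        using z(1) by (subst of_int_le_iff) (simp add: int_net_def)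
      then show ?thesis by simp
    qed
    have heavyN: "(\<Sum>(i, j)\<in>H. N (i, j) * \<bar>real_of_int (z i) * z j\<bar>) \<le> (9120 + 32 * K) * n * sqrt D"
      unfolding H_def
    proof (rule heavy_pairs_bound[where p = p])
      show "discrepancy n p N" using E2(3)[OF \<omega>(2)] unfolding N_def[abs_def] by simp
      show "D = n * p" by (simp add: D_def)
      show "sum N (edge_pairs n {i} {..<n}) \<le> K * D" if "i < n" "real_of_int (z i) \<noteq> 0" for i
        using deg z(2)[of i] that by (auto simp: N_def D_def)
      show "real_of_int (z i) = 0 \<or> 1 \<le> \<bar>real_of_int (z i)\<bar>" for i
      proof -
        have "z i = 0 \<or> 1 \<le> \<bar>z i\<bar>" by linarith
        then show ?thesis by (metis of_int_0 of_int_1_le_iff of_int_abs)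
      qed
    qed (use n D1 K z4 in \<open>auto simp: N_def\<close>)
    have sqrtD: "0 < sqrt D" "sqrt D * sqrt D = D" using D1 by auto
    \<comment> \<open>The deterministic part \<open>p\<close> of the entry bound. On heavy pairs a
      product is at most its square divided by sqrt D, and the squares sum to at most (4 *
      n)^2.\<close>
    have heavyp: "(\<Sum>(i, j)\<in>H. p * \<bar>real_of_int (z i) * z j\<bar>) \<le> 16 * real n * sqrt D"
    proof -
      have "(\<Sum>(i, j)\<in>H. p * \<bar>real_of_int (z i) * z j\<bar>) \<le> (\<Sum>(i, j)\<in>H. p / sqrt D * ((real_of_int (z i))\<^sup>2 * (real_of_int (z j))\<^sup>2))"
      proof (rule sum_mono, clarify)
        fix i j assume "(i, j) \<in> H"
        then have a: "sqrt D \<le> \<bar>real_of_int (z i) * z j\<bar>" by (simp add: H_def)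
        let ?a = "\<bar>real_of_int (z i) * z j\<bar>"
        have "?a * sqrt D \<le> ?a * ?a" using a by (intro mult_left_mono) auto
        also have "?a * ?a = (real_of_int (z i))\<^sup>2 * (real_of_int (z j))\<^sup>2"
          unfolding abs_mult_self_eq by (simp add: power2_eq_square)
        finally show "p * ?a \<le> p / sqrt D * ((real_of_int (z i))\<^sup>2 * (real_of_int (z j))\<^sup>2)"
          using sqrtD p by (simp add: field_simps)
      qed
      also have "\<dots> \<le> (\<Sum>(i, j)\<in>{..<n} \<times> {..<n}. p / sqrt D * ((real_of_int (z i))\<^sup>2 * (real_of_int (z j))\<^sup>2))"
        using p sqrtD by (intro sum_mono2) (auto simp: H_def)
      also have "\<dots> = p / sqrt D * ((\<Sum>i<n. (real_of_int (z i))\<^sup>2) * (\<Sum>i<n. (real_of_int (z i))\<^sup>2))"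
        unfolding sum_product sum.cartesian_product[symmetric] by (simp add: sum_distrib_left)
      also have "\<dots> \<le> p / sqrt D * ((4 * real n) * (4 * real n))"
        using p sqrtD by (intro mult_left_mono mult_mono z4) (auto intro!: sum_nonneg)
      also have "\<dots> = 16 * real n * (D / sqrt D)" by (simp add: D_def)
      also have "D / sqrt D = sqrt D" using sqrtD by (simp add: field_simps)
      finally show ?thesis by simp
    qed
    have "(\<Sum>(i, j)\<in>H. W (i, j) (X (i, j) \<omega>) * z i * z j) \<le>
        (\<Sum>(i, j)\<in>H. N (i, j) * \<bar>real_of_int (z i) * z j\<bar> + p * \<bar>real_of_int (z i) * z j\<bar>)"
    proof (rule sum_mono, clarify)
      fix i j assume "(i, j) \<in> H"
      then have "\<bar>W (i, j) (X (i, j) \<omega>)\<bar> \<le> N (i, j) + p" using Wb by (auto simp: H_def N_def)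
      then have "\<bar>W (i, j) (X (i, j) \<omega>)\<bar> * \<bar>real_of_int (z i) * z j\<bar> \<le> (N (i, j) + p) * \<bar>real_of_int (z i) * z j\<bar>"
        by (intro mult_right_mono) auto
      moreover have "W (i, j) (X (i, j) \<omega>) * z i * z j \<le> \<bar>W (i, j) (X (i, j) \<omega>)\<bar> * \<bar>real_of_int (z i) * z j\<bar>"
        using abs_ge_self[of "W (i, j) (X (i, j) \<omega>) * (real_of_int (z i) * z j)"] by (simp add: abs_mult mult.assoc)
      ultimately show "W (i, j) (X (i, j) \<omega>) * z i * z j \<le> N (i, j) * \<bar>real_of_int (z i) * z j\<bar> + p * \<bar>real_of_int (z i) * z j\<bar>"
        by (simp add: distrib_right)
    qed
    also have "\<dots> = (\<Sum>(i, j)\<in>H. N (i, j) * \<bar>real_of_int (z i) * z j\<bar>) + (\<Sum>(i, j)\<in>H. p * \<bar>real_of_int (z i) * z j\<bar>)"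
      by (simp add: sum.distrib case_prod_unfold)
    finally have heavy: "(\<Sum>(i, j)\<in>H. W (i, j) (X (i, j) \<omega>) * z i * z j) \<le> (9136 + 32 * K) * n * sqrt D"
      using heavyN heavyp by (simp add: algebra_simps)
    have LH: "upper_pairs n = L z \<union> H" "L z \<inter> H = {}" by (auto simp: L_def H_def)
    have finL: "finite (L z)" by (rule finite_subset[of _ "upper_pairs n"]) (auto simp: L_def)
    have "(\<Sum>(i, j)\<in>upper_pairs n. W (i, j) (X (i, j) \<omega>) * z i * z j) =
       (\<Sum>(i, j)\<in>L z. W (i, j) (X (i, j) \<omega>) * z i * z j) + (\<Sum>(i, j)\<in>H. W (i, j) (X (i, j) \<omega>) * z i * z j)"
      by (subst LH(1)) (rule sum.union_disjoint[OF finL finH LH(2)])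
    also have "\<dots> \<le> 22 * real n * sqrt D + (9136 + 32 * K) * n * sqrt D"
      using E1(3)[OF \<omega>(1) z(1)] heavy by (simp add: D_def)
    \<comment> \<open>22 + 9120 + 16 = 9158, rounded up.\<close>
    also have "\<dots> \<le> (9200 + 32 * K) * sqrt (n * p) * n" using D1 by (simp add: D_def algebra_simps)
    finally show "(\<Sum>(i, j)\<in>upper_pairs n. W (i, j) (X (i, j) \<omega>) * z i * z j) \<le> (9200 + 32 * K) * sqrt (n * p) * n" .
  qed auto
  show ?thesis
  proof (rule bexI[of _ "E1 \<inter> E2"], intro conjI ballI allI impI)
    show "E1 \<inter> E2 \<in> events" using E1(1) E2(1) by blast
    show "\<omega> \<in> space M" if "\<omega> \<in> E1 \<inter> E2" for \<omega> using E2(3) that by blast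
  qed (use pE main in \<open>simp_all only: Int_iff\<close>)
qed

section \<open>Recovery with high probability\<close>

text \<open>Rewrites a row sum of a symmetric matrix over the upper triangle, whose entries are
  independent.\<close>

lemma sum_star_edges:
  fixes f :: "nat \<Rightarrow> nat \<Rightarrow> real"
  assumes "i < n" "\<And>j. j < n \<Longrightarrow> f i j = f j i"
  shows "(\<Sum>j\<in>{..<n} - {i}. f i j) = (\<Sum>(a, b)\<in>edge_pairs n {i} {..<n}. f a b)"
  using assms
  by (intro sum.reindex_bij_witness[of _ "\<lambda>(a, b). if a = i then b else a" "\<lambda>j. if i < j then (i, j) else (j, i)"])
     (auto simp: edge_pairs_def)

text \<open>Markov's inequality for the average. Different rows share entries and are dependent, so
  only their expectations are added.\<close>

lemma (in prob_space) sum_exp_event: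
  fixes f :: "nat \<Rightarrow> 'a \<Rightarrow> real"
  assumes n: "0 < n" and f [measurable]: "\<And>i. i < n \<Longrightarrow> f i \<in> borel_measurable M"
    and b: "\<And>i. i < n \<Longrightarrow> (\<integral>\<^sup>+\<omega>. ennreal (exp (f i \<omega>)) \<partial>M) \<le> ennreal (exp (- a))"
  shows "\<exists>E\<in>events. 1 - exp (- b) \<le> prob E \<and> (\<forall>\<omega>\<in>E. \<omega> \<in> space M \<and> (\<Sum>i<n. exp (f i \<omega>)) < n * exp (b - a))"
proof -
  \<comment> \<open>The logarithm brings the average into the form required by
    \<open>exp_markov\<close>.\<close>
  define F where "F \<omega> = ln ((\<Sum>i<n. exp (f i \<omega>)) / n)" for \<omega>
  have pos: "0 < (\<Sum>i<n. exp (f i \<omega>)) / n" for \<omega> using n by (intro divide_pos_pos sum_pos) auto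
  have expF: "exp (F \<omega>) = (\<Sum>i<n. exp (f i \<omega>)) / n" for \<omega> using pos by (simp add: F_def)
  have Fm: "F \<in> borel_measurable M" unfolding F_def using f by measurable
  have fm: "(\<lambda>\<omega>. ennreal (exp (f i \<omega>))) \<in> borel_measurable M" if "i < n" for i
    using f[OF that] by measurable
  have "(\<integral>\<^sup>+\<omega>. ennreal (exp (F \<omega>)) \<partial>M) = (\<integral>\<^sup>+\<omega>. ennreal (1 / n) * (\<Sum>i<n. ennreal (exp (f i \<omega>))) \<partial>M)"
    unfolding expF by (intro nn_integral_cong) (simp add: ennreal_mult[symmetric] sum_nonneg)
  also have "\<dots> = ennreal (1 / n) * (\<integral>\<^sup>+\<omega>. (\<Sum>i<n. ennreal (exp (f i \<omega>))) \<partial>M)"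
    using fm by (intro nn_integral_cmult borel_measurable_sum) auto
  also have "(\<integral>\<^sup>+\<omega>. (\<Sum>i<n. ennreal (exp (f i \<omega>))) \<partial>M) = (\<Sum>i<n. \<integral>\<^sup>+\<omega>. ennreal (exp (f i \<omega>)) \<partial>M)"
    using fm by (intro nn_integral_sum) auto
  also have "ennreal (1 / n) * \<dots> \<le> ennreal (1 / n) * (\<Sum>i<n. ennreal (exp (- a)))"
    by (intro mult_left_mono sum_mono b) auto
  also have "\<dots> = ennreal (exp (- a))"
    using n by (simp add: ennreal_of_nat_eq_real_of_nat ennreal_mult[symmetric])
  finally have "prob {\<omega> \<in> space M. b - a \<le> F \<omega>} \<le> exp (- a - (b - a))"
    by (intro exp_markov Fm)
  moreover have ev: "{\<omega> \<in> space M. b - a \<le> F \<omega>} \<in> events" using Fm by measurable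
  ultimately have "1 - exp (- b) \<le> prob (space M - {\<omega> \<in> space M. b - a \<le> F \<omega>})"
    by (subst prob_compl) auto
  moreover have "(\<Sum>i<n. exp (f i \<omega>)) < n * exp (b - a)" if "\<omega> \<in> space M - {\<omega> \<in> space M. b - a \<le> F \<omega>}" for \<omega>
  proof -
    have "exp (F \<omega>) < exp (b - a)" using that by auto
    then show ?thesis using n unfolding expF by (simp add: field_simps)
  qed
  ultimately show ?thesis using ev by (intro bexI[of _ "space M - {\<omega> \<in> space M. b - a \<le> F \<omega>}"]) auto
qed

text \<open>\<open>c\<close> is a shift of the data that the balance constraint of the block model makes invisible to the program; it is 0
  in the other two models.\<close>

definition gauged :: "real Matrix.vec \<Rightarrow> real \<Rightarrow> real Matrix.mat \<Rightarrow> nat \<Rightarrow> nat \<Rightarrow> real" where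
  "gauged \<sigma> c B i j = (if i = j then 0 else \<sigma> $ i * \<sigma> $ j * (B $$ (i, j) - c))"

text \<open>A function of the entry value, not of the outcome, so that moment bounds for independent
  families apply to it.\<close>

definition centered :: "real Matrix.vec \<Rightarrow> real \<Rightarrow> real \<Rightarrow> nat \<times> nat \<Rightarrow> real \<Rightarrow> real" where
  "centered \<sigma> c \<mu> e x = \<sigma> $ fst e * \<sigma> $ snd e * (x - c) - \<mu>"

lemma borel_measurable_centered [measurable]: "centered \<sigma> c \<mu> e \<in> borel_measurable borel"
  unfolding centered_def by measurable

text \<open>\<open>G\<close> is the set of vertices of bounded degree; the remaining ones cost at most \<open>h\<close>.\<close>

abbreviation noise_bounded :: "nat \<Rightarrow> (nat \<times> nat \<Rightarrow> real) \<Rightarrow> real \<Rightarrow> real \<Rightarrow> bool" where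
  "noise_bounded n w \<theta> R \<equiv> \<exists>G h.
     (\<forall>x. (\<forall>i<n. i \<notin> G \<longrightarrow> x i = 0) \<longrightarrow> 2 * upper_form n w x \<le> \<theta> / 2 * (\<Sum>i<n. (x i)\<^sup>2)) \<and>
     (\<forall>i<n. i \<notin> G \<longrightarrow> (\<Sum>j\<in>{..<n} - {i}. \<bar>sym_ext w i j\<bar>) \<le> h i) \<and>
     ({..<n} - G \<noteq> {} \<longrightarrow> 1 \<le> R) \<and> 8 * (\<Sum>i\<in>{..<n} - G. h i) \<le> \<theta> / 8 * R"

text \<open>\<open>R\<close> is the target bound. If \<open>R < 1\<close>, the sum of exponential moments is below 1, so every \<open>d\<^sub>i\<close> exceeds
  \<open>\<theta>\<close> and the recovery is exact: this is what the floor in the theorem requires.\<close>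

lemma (in prob_space) common_recovery:
  fixes A :: "'a \<Rightarrow> real Matrix.mat" and \<kappa> :: "nat \<Rightarrow> nat \<Rightarrow> real" and \<mu> \<theta> lam c a b R \<delta> :: real
  assumes rm: "symmetric_random_mat M n A" and \<sigma>: "label_vec n \<sigma>" and n: "0 < n"
    and \<mu>: "0 \<le> \<mu>" and \<theta>: "0 < \<theta>" and lam: "0 < lam" "1 \<le> \<theta> * lam" and R: "0 \<le> R"
    and F: "\<And>Y. Y \<in> F n \<Longrightarrow> Y \<in> sdp_feasible n \<and> (c = 0 \<or> (\<Sum>i<n. \<Sum>j<n. Y $$ (i, j)) = 0 \<and> (\<Sum>i<n. \<sigma> $ i) = 0)"
    and spec: "\<exists>E\<in>events. 1 - \<delta> \<le> prob E \<and> (\<forall>\<omega>\<in>E. \<omega> \<in> space M \<and>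
       noise_bounded n (\<lambda>e. centered \<sigma> c \<mu> e (A \<omega> $$ e)) \<theta> R)"
    and mgf: "\<And>i j. i < j \<Longrightarrow> j < n \<Longrightarrow>
       (\<integral>\<^sup>+\<omega>. ennreal (exp (- lam * (\<sigma> $ i * \<sigma> $ j * (A \<omega> $$ (i, j) - c)))) \<partial>M) \<le> ennreal (exp (\<kappa> i j))"
    and \<kappa>sym: "\<And>i j. \<kappa> i j = \<kappa> j i"
    and \<kappa>: "\<And>i. i < n \<Longrightarrow> lam * \<theta> + (\<Sum>j\<in>{..<n} - {i}. \<kappa> i j) \<le> - a"
    and aR: "32 * (n * exp (b - a)) \<le> R"
  shows "\<exists>E\<in>events. 1 - (\<delta> + exp (- b)) \<le> prob E \<and> (\<forall>\<omega>\<in>E. \<forall>Y\<in>sdp_sublevel F n \<sigma> (A \<omega>).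
     1 / real n * entrywise_l1_norm (Y - label_mat \<sigma>) \<le> of_int \<lfloor>R\<rfloor>)"
proof -
  let ?I = "{(i, j). i \<le> j \<and> j < n}"
  have Ac: "A \<omega> \<in> carrier_mat n n" "transpose_mat (A \<omega>) = A \<omega>" if "\<omega> \<in> space M" for \<omega>
    using rm that by (auto simp: symmetric_random_mat_def)
  have Asym: "A \<omega> $$ (i, j) = A \<omega> $$ (j, i)" if "\<omega> \<in> space M" "i < n" "j < n" for \<omega> i j
    using Ac[OF that(1)] that by (metis carrier_matD index_transpose_mat(1))
  have ind: "indep_vars (\<lambda>_. borel) (\<lambda>e \<omega>. A \<omega> $$ e) ?I"
    using rm by (simp add: symmetric_random_mat_def case_prod_beta')
  have Xm [measurable]: "(\<lambda>\<omega>. A \<omega> $$ e) \<in> borel_measurable M" if "e \<in> ?I" for e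
    using ind that unfolding indep_vars_def by auto
  \<comment> \<open>The row sums written with upper entries only, whose measurability and
    independence are given; symmetry identifies them with the gauged row sums in
    \<open>d_eq\<close>.\<close>
  define d where "d i \<omega> = (\<Sum>(p, q)\<in>edge_pairs n {i} {..<n}. \<sigma> $ p * \<sigma> $ q * (A \<omega> $$ (p, q) - c))" for i \<omega>
  have EI: "edge_pairs n {i} {..<n} \<subseteq> ?I" for i by (auto simp: edge_pairs_def)
  have dm: "d i \<in> borel_measurable M" for i
    unfolding d_def case_prod_unfold
    by (intro borel_measurable_sum borel_measurable_times borel_measurable_diff borel_measurable_const Xm)
       (auto simp: edge_pairs_def)
  have d_eq: "d i \<omega> = (\<Sum>j<n. gauged \<sigma> c (A \<omega>) i j)" if "\<omega> \<in> space M" "i < n" for i \<omega>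
  proof -
    have "(\<Sum>j<n. gauged \<sigma> c (A \<omega>) i j) = (\<Sum>j\<in>{..<n} - {i}. \<sigma> $ i * \<sigma> $ j * (A \<omega> $$ (i, j) - c))"
      by (intro sum.mono_neutral_cong_right) (auto simp: gauged_def)
    also have "\<dots> = d i \<omega>" unfolding d_def
      using that Asym by (intro sum_star_edges) auto
    finally show ?thesis by simp
  qed
  obtain E0 where E0: "E0 \<in> events" "1 - \<delta> \<le> prob E0" "\<And>\<omega>. \<omega> \<in> E0 \<Longrightarrow> \<omega> \<in> space M"
    "\<And>\<omega>. \<omega> \<in> E0 \<Longrightarrow> noise_bounded n (\<lambda>e. centered \<sigma> c \<mu> e (A \<omega> $$ e)) \<theta> R"
    using spec by blast
  have "(\<integral>\<^sup>+\<omega>. ennreal (exp (lam * (\<theta> - d i \<omega>))) \<partial>M) \<le> ennreal (exp (- a))" if i: "i < n" for i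
  proof -
    have sumd: "(\<Sum>(p, q)\<in>edge_pairs n {i} {..<n}. - lam * (\<sigma> $ p * \<sigma> $ q * (A \<omega> $$ (p, q) - c))) = - lam * d i \<omega>" for \<omega>
      by (simp add: d_def sum_distrib_left case_prod_unfold)
    have "(\<integral>\<^sup>+\<omega>. ennreal (exp (lam * (\<theta> - d i \<omega>))) \<partial>M) =
       (\<integral>\<^sup>+\<omega>. ennreal (exp (lam * \<theta>)) * ennreal (exp (\<Sum>(p, q)\<in>edge_pairs n {i} {..<n}. - lam * (\<sigma> $ p * \<sigma> $ q * (A \<omega> $$ (p, q) - c)))) \<partial>M)"
      unfolding sumd by (simp add: ennreal_mult[symmetric] exp_add[symmetric] right_diff_distrib)
    also have "\<dots> = ennreal (exp (lam * \<theta>)) * (\<integral>\<^sup>+\<omega>. ennreal (exp (\<Sum>(p, q)\<in>edge_pairs n {i} {..<n}. - lam * (\<sigma> $ p * \<sigma> $ q * (A \<omega> $$ (p, q) - c)))) \<partial>M)"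
      unfolding sumd using dm[of i] by (intro nn_integral_cmult) measurable
    also have "(\<integral>\<^sup>+\<omega>. ennreal (exp (\<Sum>(p, q)\<in>edge_pairs n {i} {..<n}. - lam * (\<sigma> $ p * \<sigma> $ q * (A \<omega> $$ (p, q) - c)))) \<partial>M)
        \<le> ennreal (exp (\<Sum>(p, q)\<in>edge_pairs n {i} {..<n}. \<kappa> p q))"
    proof -
      have "(\<integral>\<^sup>+\<omega>. ennreal (exp (\<Sum>e\<in>edge_pairs n {i} {..<n}. (- lam * (\<sigma> $ fst e * \<sigma> $ snd e * (A \<omega> $$ e - c))))) \<partial>M)
        \<le> ennreal (exp (\<Sum>e\<in>edge_pairs n {i} {..<n}. \<kappa> (fst e) (snd e)))"
        by (rule mgf_sum_le[OF ind finite_edge_pairs EI, where g = "\<lambda>e x. - lam * (\<sigma> $ fst e * \<sigma> $ snd e * (x - c))"])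
           (use mgf in \<open>auto simp: edge_pairs_def\<close>)
      then show ?thesis by (simp add: case_prod_unfold)
    qed
    also have "(\<Sum>(p, q)\<in>edge_pairs n {i} {..<n}. \<kappa> p q) = (\<Sum>j\<in>{..<n} - {i}. \<kappa> i j)"
      using i \<kappa>sym by (intro sum_star_edges[symmetric]) auto
    also have "ennreal (exp (lam * \<theta>)) * ennreal (exp (\<Sum>j\<in>{..<n} - {i}. \<kappa> i j)) \<le> ennreal (exp (- a))"
      using \<kappa>[OF i] by (simp add: ennreal_mult[symmetric] exp_add[symmetric])
    finally show ?thesis by (simp add: mult_left_mono)
  qed
  then obtain E1 where E1: "E1 \<in> events" "1 - exp (- b) \<le> prob E1" "\<And>\<omega>. \<omega> \<in> E1 \<Longrightarrow> \<omega> \<in> space M"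
      "\<And>\<omega>. \<omega> \<in> E1 \<Longrightarrow> (\<Sum>i<n. exp (lam * (\<theta> - d i \<omega>))) < n * exp (b - a)"
    using sum_exp_event[OF n, of "\<lambda>i \<omega>. lam * (\<theta> - d i \<omega>)" a b] dm by auto
  have pE: "1 - (\<delta> + exp (- b)) \<le> prob (E0 \<inter> E1)"
    by (rule prob_Int_ge[OF E0(1) E1(1) E0(2) E1(2)])
  have "1 / real n * entrywise_l1_norm (Y - label_mat \<sigma>) \<le> of_int \<lfloor>R\<rfloor>"
    if \<omega>: "\<omega> \<in> E0 \<inter> E1" and Y: "Y \<in> sdp_sublevel F n \<sigma> (A \<omega>)" for \<omega> Y
  proof -
    have \<omega>': "\<omega> \<in> space M" using \<omega> E0(3) by blast
    define w where "w e = centered \<sigma> c \<mu> e (A \<omega> $$ e)" for e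
    obtain G h where Gh: "\<And>x. (\<And>i. i < n \<Longrightarrow> i \<notin> G \<Longrightarrow> x i = 0) \<Longrightarrow>
          2 * upper_form n w x \<le> \<theta> / 2 * (\<Sum>i<n. (x i)\<^sup>2)"
        "\<And>i. i < n \<Longrightarrow> i \<notin> G \<Longrightarrow> (\<Sum>j\<in>{..<n} - {i}. \<bar>sym_ext w i j\<bar>) \<le> h i"
        "{..<n} - G \<noteq> {} \<Longrightarrow> 1 \<le> R" "8 * (\<Sum>i\<in>{..<n} - G. h i) \<le> \<theta> / 8 * R"
      using E0(4)[of \<omega>] \<omega> unfolding w_def[abs_def] by blast
    have YF: "Y \<in> sdp_feasible n" "c = 0 \<or> (\<Sum>i<n. \<Sum>j<n. Y $$ (i, j)) = 0 \<and> (\<Sum>i<n. \<sigma> $ i) = 0"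
      using F[of Y] Y by (auto simp: sdp_sublevel_def)
    have Ysub: "mat_inner n (A \<omega>) (label_mat \<sigma>) \<le> mat_inner n (A \<omega>) Y" using Y by (simp add: sdp_sublevel_def)
    obtain V where V: "\<And>i. i < n \<Longrightarrow> (\<Sum>k<n. (V k i)\<^sup>2) = 1"
      "(\<Sum>i<n. \<Sum>j<n. gauged \<sigma> c (A \<omega>) i j * (1 - (\<Sum>k<n. V k i * V k j))) \<le> 0"
      "entrywise_l1_norm (Y - label_mat \<sigma>) = (\<Sum>i<n. \<Sum>j<n. 1 - (\<Sum>k<n. V k i * V k j))"
      unfolding gauged_def using sublevel_gram[OF YF(1) \<sigma> Ac(1)[OF \<omega>'] Ysub YF(2)] by blast
    have "(\<Sum>i<n. \<Sum>j<n. 1 - (\<Sum>k<n. V k i * V k j)) / n \<le> of_int \<lfloor>R\<rfloor>"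
    proof (rule recovery_bound[where B = "gauged \<sigma> c (A \<omega>)" and W = "sym_ext w" and G = G and h = h and \<theta> = \<theta> and lam = lam, OF V(1)])
      show "gauged \<sigma> c (A \<omega>) i j = gauged \<sigma> c (A \<omega>) j i" if "i < n" "j < n" for i j
        using Asym[OF \<omega>' that] by (simp add: gauged_def)
      show "sym_ext w i j = sym_ext w j i" for i j by (rule sym_ext_commute)
      show "gauged \<sigma> c (A \<omega>) i j = (if i = j then 0 else \<mu>) + sym_ext w i j" if "i < n" "j < n" for i j
        using Asym[OF \<omega>' that] by (auto simp: gauged_def sym_ext_def w_def centered_def)
      show "(\<Sum>i<n. \<Sum>j<n. sym_ext w i j * x i * x j) \<le> \<theta> / 2 * (\<Sum>i<n. (x i)\<^sup>2)"
        if "\<And>i. i < n \<Longrightarrow> i \<notin> G \<Longrightarrow> x i = 0" for x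
        unfolding sum_sym_ext using that by (rule Gh(1))
      show "(\<Sum>j<n. \<bar>sym_ext w i j\<bar>) \<le> h i" if "i < n" "i \<notin> G" for i
      proof -
        have "(\<Sum>j<n. \<bar>sym_ext w i j\<bar>) = (\<Sum>j\<in>{..<n} - {i}. \<bar>sym_ext w i j\<bar>)"
          by (intro sum.mono_neutral_right) (auto simp: sym_ext_def)
        then show ?thesis using Gh(2)[OF that] by simp
      qed
      show "32 * (\<Sum>i<n. exp (lam * (\<theta> - (\<Sum>j<n. gauged \<sigma> c (A \<omega>) i j)))) \<le> R"
      proof -
        have "(\<Sum>i<n. exp (lam * (\<theta> - (\<Sum>j<n. gauged \<sigma> c (A \<omega>) i j)))) = (\<Sum>i<n. exp (lam * (\<theta> - d i \<omega>)))"
          by (intro sum.cong refl) (simp add: d_eq[OF \<omega>'])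
        then show ?thesis using E1(4)[of \<omega>] \<omega> aR by simp
      qed
    qed (use \<mu> n V Gh(3,4) \<theta> lam R in auto)
    then show ?thesis using V(3) by simp
  qed
  then show ?thesis using pE E0(1) E1(1) by (intro bexI[of _ "E0 \<inter> E1"]) auto
qed

text \<open>\<open>e\<close> is the target accuracy, \<open>C\<close> collects the constants of a model, \<open>J\<close> is \<open>nbar * I\<close>.\<close>

definition large_enough :: "real \<Rightarrow> real \<Rightarrow> nat \<Rightarrow> real \<Rightarrow> bool" where
  "large_enough C e n J \<longleftrightarrow> 0 < n \<and> C \<le> J \<and> 16 * C \<le> e * n \<and> exp (- real n) + 2 / n \<le> e / 4 \<and>
     ln 32 + C \<le> e * J / 16 \<and> ln 12 \<le> e * J / 2 \<and> exp (- (e * J / 8)) \<le> e / 4 \<and> exp (- (J / C)) \<le> e / 4 \<and>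
     128 * (C + 5) * exp (- (J / C)) \<le> e / (8 * C) \<and> (4 * (9200 + 32 * (C + 5)) * (8 * C / e))\<^sup>2 \<le> J / C \<and>
     8 * C\<^sup>2 \<le> e * J"

section \<open>From fixed accuracy to vanishing error terms\<close>

lemma eventually_large_enough:
  assumes "1 \<le> C" "0 < e" and n: "filterlim n at_top F" and J: "filterlim J at_top F"
  shows "eventually (\<lambda>k. large_enough C e (n k) (J k)) F"
proof -
  have n': "filterlim (\<lambda>k. real (n k)) at_top F" by (rule filterlim_compose[OF filterlim_real_sequentially n])
  have lower: "eventually (\<lambda>k. a \<le> b * J k) F" if "0 < b" for a b
    using filterlim_at_top[THEN iffD1, OF J, rule_format, of "a / b"] 
    by eventually_elim (use that in \<open>simp add: field_simps\<close>)
  have small: "eventually (\<lambda>k. a * exp (- (b * J k)) \<le> d) F" if "0 < b" "0 < d" for a b d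
  proof -
    have "((\<lambda>x. a * exp (- (b * x))) \<longlongrightarrow> 0) at_top" using that by real_asymp
    then have "((\<lambda>k. a * exp (- (b * J k))) \<longlongrightarrow> 0) F" by (rule filterlim_compose[OF _ J])
    then have "eventually (\<lambda>k. a * exp (- (b * J k)) < d) F" using that(2) by (rule order_tendstoD(2))
    then show ?thesis by eventually_elim simp
  qed
  have nsmall: "eventually (\<lambda>k. exp (- real (n k)) + 2 / n k \<le> e / 4) F"
  proof -
    have "((\<lambda>x::real. exp (- x) + 2 / x) \<longlongrightarrow> 0) at_top" by real_asymp
    then have "((\<lambda>k. exp (- real (n k)) + 2 / real (n k)) \<longlongrightarrow> 0) F" by (rule filterlim_compose[OF _ n'])
    then have "eventually (\<lambda>k. exp (- real (n k)) + 2 / real (n k) < e / 4) F"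
      using assms(2) by (intro order_tendstoD(2)) auto
    then show ?thesis by eventually_elim simp
  qed
  have n1: "eventually (\<lambda>k. 1 \<le> n k) F" using n by (simp add: filterlim_at_top)
  have n2: "eventually (\<lambda>k. 16 * C / e \<le> real (n k)) F" using n' by (simp add: filterlim_at_top)
  have "eventually (\<lambda>k. C \<le> 1 * J k) F" by (rule lower) simp
  moreover have "eventually (\<lambda>k. ln 32 + C \<le> (e / 16) * J k) F" by (rule lower) (use assms in simp)
  moreover have "eventually (\<lambda>k. ln 12 \<le> (e / 2) * J k) F" by (rule lower) (use assms in simp)
  moreover have "eventually (\<lambda>k. 8 * C\<^sup>2 \<le> e * J k) F" by (rule lower) (use assms in simp)
  moreover have "eventually (\<lambda>k. (4 * (9200 + 32 * (C + 5)) * (8 * C / e))\<^sup>2 \<le> (1 / C) * J k) F"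
    by (rule lower) (use assms in simp)
  moreover have "eventually (\<lambda>k. 1 * exp (- ((e / 8) * J k)) \<le> e / 4) F" by (rule small) (use assms in simp_all)
  moreover have "eventually (\<lambda>k. 1 * exp (- ((1 / C) * J k)) \<le> e / 4) F" by (rule small) (use assms in simp_all)
  moreover have "eventually (\<lambda>k. 128 * (C + 5) * exp (- ((1 / C) * J k)) \<le> e / (8 * C)) F"
    by (rule small) (use assms in simp_all)
  ultimately show ?thesis using n1 n2 nsmall
  proof eventually_elim
    case (elim k)
    have "16 * C \<le> e * n k" using elim(10) assms(2) by (simp add: field_simps)
    then show ?case unfolding large_enough_def using elim by simp
  qed
qed

text \<open>The two bounds of the theorem for one data matrix \<open>B\<close>, with both \<open>o(1)\<close> terms replaced by \<open>e\<close>.\<close>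

definition accurate :: "(nat \<Rightarrow> real Matrix.mat set) \<Rightarrow> nat \<Rightarrow> real Matrix.vec \<Rightarrow> real Matrix.mat \<Rightarrow> real \<Rightarrow> real \<Rightarrow> bool" where
  "accurate F n \<sigma> B J e \<longleftrightarrow> (\<forall>Y\<in>sdp_sublevel F n \<sigma> B.
     1 / real n * entrywise_l1_norm (Y - label_mat \<sigma>) \<le> of_int \<lfloor>real n * exp (- (1 - e) * J)\<rfloor> \<and>
     (\<forall>v. top_eigenvector Y v \<longrightarrow> label_err n (sign_vec v) \<sigma> \<le> exp (- (1 - e) * J)))"

text \<open>The entrywise bound is assumed with e / 2; the other half of the exponent absorbs the
  factor 12 of \<open>label_err_le\<close>.\<close>

lemma accurateI:
  assumes e: "0 < e" and J: "0 \<le> J" "ln 12 \<le> e * J / 2" and n: "0 < n" and \<sigma>: "label_vec n \<sigma>"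
    and F: "\<And>Y. Y \<in> F n \<Longrightarrow> Y \<in> sdp_feasible n"
    and l1: "\<And>Y. Y \<in> sdp_sublevel F n \<sigma> B \<Longrightarrow>
      1 / real n * entrywise_l1_norm (Y - label_mat \<sigma>) \<le> of_int \<lfloor>real n * exp (- (1 - e / 2) * J)\<rfloor>"
  shows "accurate F n \<sigma> B J e"
  unfolding accurate_def
proof (intro ballI conjI allI impI)
  fix Y assume Y: "Y \<in> sdp_sublevel F n \<sigma> B"
  have "- (1 - e / 2) * J \<le> - (1 - e) * J" using e J by (intro mult_right_mono) auto
  then have "real n * exp (- (1 - e / 2) * J) \<le> real n * exp (- (1 - e) * J)" by (intro mult_left_mono) auto
  then have "\<lfloor>real n * exp (- (1 - e / 2) * J)\<rfloor> \<le> \<lfloor>real n * exp (- (1 - e) * J)\<rfloor>" by (rule floor_mono)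
  then show "1 / real n * entrywise_l1_norm (Y - label_mat \<sigma>) \<le> of_int \<lfloor>real n * exp (- (1 - e) * J)\<rfloor>"
    using l1[OF Y] by linarith
  fix v assume v: "top_eigenvector Y v"
  have "Y \<in> sdp_feasible n" using F Y by (auto simp: sdp_sublevel_def)
  then have "label_err n (sign_vec v) \<sigma> \<le> 12 * (entrywise_l1_norm (Y - label_mat \<sigma>) / (real n)\<^sup>2)"
    by (rule label_err_le[OF _ n \<sigma> v])
  also have "\<dots> = 12 / n * (1 / real n * entrywise_l1_norm (Y - label_mat \<sigma>))" by (simp add: power2_eq_square)
  also have "\<dots> \<le> 12 / n * (real n * exp (- (1 - e / 2) * J))"
    using l1[OF Y] by (intro mult_left_mono) (linarith, simp)
  also have "\<dots> = exp (ln 12 + - (1 - e / 2) * J)" using n by (simp add: exp_add)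
  also have "\<dots> \<le> exp (- (1 - e) * J)"
  proof -
    have "ln 12 + - (1 - e / 2) * J \<le> e * J / 2 + - (1 - e / 2) * J" using J by simp
    also have "\<dots> = - (1 - e) * J" by (simp add: algebra_simps)
    finally show ?thesis by simp
  qed
  finally show "label_err n (sign_vec v) \<sigma> \<le> exp (- (1 - e) * J)" .
qed

text \<open>Diagonal argument: at index \<open>k\<close> use the largest m \<le> k whose accuracy 1
  / (m + 2) is already available. One sequence then serves for the failure probability and for both
  exponents.\<close>

lemma sdp_exponential_recoveryI:
  assumes ev: "\<And>e. 0 < e \<Longrightarrow> e < 1 \<Longrightarrow> eventually (\<lambda>k. \<exists>E\<in>sets (M k). 1 - e \<le> measure (M k) E \<and>
       (\<forall>\<omega>\<in>E. accurate F (n k) (\<sigma> k) (A k \<omega>) (nbar k * I k) e)) sequentially"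
  shows "sdp_exponential_recovery F M n nbar I \<sigma> A"
proof -
  define P where "P e k \<longleftrightarrow> (\<exists>E\<in>sets (M k). 1 - e \<le> measure (M k) E \<and>
       (\<forall>\<omega>\<in>E. accurate F (n k) (\<sigma> k) (A k \<omega>) (nbar k * I k) e))" for e k
  \<comment> \<open>The 2 keeps the accuracy strictly below 1, as \<open>ev\<close> demands.\<close>
  have "\<exists>N. \<forall>k\<ge>N. P (1 / real (m + 2)) k" for m :: nat
    using ev[of "1 / real (m + 2)"] by (simp add: P_def eventually_sequentially)
  then obtain N where N: "\<And>m k. N m \<le> k \<Longrightarrow> P (1 / real (m + 2)) k" by metis
  define S where "S k = {m. m \<le> k \<and> N m \<le> k}" for k
  define r where "r k = Max (S k)" for k
  have fin: "finite (S k)" for k by (rule finite_subset[of _ "{..k}"]) (auto simp: S_def)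
  \<comment> \<open>Before any accuracy is available, \<delta> k = 1 and the empty event
    suffices.\<close>
  define \<delta> where "\<delta> k = (if S k = {} then 1 else 1 / real (r k + 2))" for k
  have ge: "m \<le> r k" "S k \<noteq> {}" if "max m (N m) \<le> k" for m k
  proof -
    have "m \<in> S k" using that by (simp add: S_def)
    then show "m \<le> r k" "S k \<noteq> {}" unfolding r_def using fin by (auto intro: Max_ge)
  qed
  have lim: "\<delta> \<longlonglongrightarrow> 0"
  proof (rule LIMSEQ_I)
    fix x :: real assume "0 < x"
    then obtain m where m: "inverse (real (Suc m)) < x" using reals_Archimedean by blast
    show "\<exists>k0. \<forall>k\<ge>k0. norm (\<delta> k - 0) < x"
    proof (intro exI allI impI)
      fix k assume "max m (N m) \<le> k"
      from ge[OF this] have "m \<le> r k" "\<delta> k = 1 / real (r k + 2)" by (auto simp: \<delta>_def)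
      moreover have "1 / real (r k + 2) \<le> 1 / real (Suc m)" using \<open>m \<le> r k\<close> by (intro divide_left_mono) auto
      ultimately show "norm (\<delta> k - 0) < x" using m by (simp add: inverse_eq_divide)
    qed
  qed
  have "\<exists>E\<in>sets (M k). 1 - \<delta> k \<le> measure (M k) E \<and>
       (\<forall>\<omega>\<in>E. accurate F (n k) (\<sigma> k) (A k \<omega>) (nbar k * I k) (\<delta> k))" for k
  proof (cases "S k = {}")
    case True
    then show ?thesis by (intro bexI[of _ "{}"]) (auto simp: \<delta>_def)
  next
    case False
    then have "r k \<in> S k" unfolding r_def using fin by (intro Max_in) auto
    then have "P (1 / real (r k + 2)) k" by (intro N) (simp add: S_def)
    then show ?thesis using False by (simp add: P_def \<delta>_def)
  qed
  then show ?thesis unfolding sdp_exponential_recovery_def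
    using lim by (intro exI[of _ \<delta>]) (auto simp: accurate_def mult.assoc)
qed

section \<open>The sparse models in a common frame\<close>

text \<open>The four comparisons of J play different roles: J1 makes large degrees rarer than exp (-
  J), J2 makes the signal beat the noise, J3 gives \<theta> * lam \<ge> 1, and J4 makes the shift by
  \<theta> cheap.\<close>

lemma (in prob_space) sparse_recovery:
  fixes A :: "'a \<Rightarrow> real Matrix.mat" and \<kappa> :: "nat \<Rightarrow> nat \<Rightarrow> real" and \<mu> lam c C e p J :: real
  assumes rm: "symmetric_random_mat M n A" and \<sigma>: "label_vec n \<sigma>"
    and C: "1 \<le> C" and e: "0 < e" "e < 1" and large: "large_enough C e n J"
    and \<mu>: "0 < \<mu>" and lam: "0 < lam" and p: "0 < p"
    and F: "\<And>Y. Y \<in> F n \<Longrightarrow> Y \<in> sdp_feasible n \<and> (c = 0 \<or> (\<Sum>i<n. \<Sum>j<n. Y $$ (i, j)) = 0 \<and> (\<Sum>i<n. \<sigma> $ i) = 0)"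
    and J1: "J \<le> C * (n * p)" and J2: "J * p \<le> C * (n * \<mu>\<^sup>2)"
    and J3: "J \<le> C * (lam * \<mu> * n)" and J4: "lam * \<mu> * n \<le> C * J"
    and mgfW: "\<And>i j s. i < j \<Longrightarrow> j < n \<Longrightarrow> \<bar>s\<bar> \<le> 1 / 2 \<Longrightarrow>
       (\<integral>\<^sup>+\<omega>. ennreal (exp (s * centered \<sigma> c \<mu> (i, j) (A \<omega> $$ (i, j)))) \<partial>M) \<le> ennreal (exp (s\<^sup>2 * p))"
    and pX: "\<And>i j. i < j \<Longrightarrow> j < n \<Longrightarrow> prob {\<omega> \<in> space M. A \<omega> $$ (i, j) \<noteq> 0} \<le> p"
    and bd: "\<And>i j. i < j \<Longrightarrow> j < n \<Longrightarrow>
       prob {\<omega> \<in> space M. \<bar>centered \<sigma> c \<mu> (i, j) (A \<omega> $$ (i, j))\<bar> \<le> of_bool (A \<omega> $$ (i, j) \<noteq> 0) + p} = 1"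
    and mgf: "\<And>i j. i < j \<Longrightarrow> j < n \<Longrightarrow>
       (\<integral>\<^sup>+\<omega>. ennreal (exp (- lam * (\<sigma> $ i * \<sigma> $ j * (A \<omega> $$ (i, j) - c)))) \<partial>M) \<le> ennreal (exp (\<kappa> i j))"
    and \<kappa>sym: "\<And>i j. \<kappa> i j = \<kappa> j i"
    and \<kappa>: "\<And>i. i < n \<Longrightarrow> (\<Sum>j\<in>{..<n} - {i}. \<kappa> i j) \<le> - J + C * (J / n + 1)"
  shows "\<exists>E\<in>events. 1 - e \<le> prob E \<and> (\<forall>\<omega>\<in>E. accurate F n \<sigma> (A \<omega>) J e)"
proof -
  note L = large[unfolded large_enough_def]
  have n: "0 < n" and nn: "0 < real n" using L by auto
  have JC: "C \<le> J" using L by blast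
  have J0: "0 < J" using JC C by linarith
  define D where "D = n * p"
  \<comment> \<open>A degree has exponential moment at most exp (2 * D), and one more D is spent in
    Markov's inequality, so the exponent is 3 - K = - (C + 2): \<open>C\<close> for the claimed rate
    and 2 to spare.\<close>
  define K where "K = C + 5"
  \<comment> \<open>Chosen so that lam * \<theta> \<le> \<eta> * C * J = e * J / 8.\<close>
  define \<eta> where "\<eta> = e / (8 * C)"
  define \<theta> where "\<theta> = \<eta> * (\<mu> * n)"
  define R where "R = n * exp (- (1 - e / 2) * J)"
  have \<eta>0: "0 < \<eta>" using e C by (simp add: \<eta>_def)
  have \<theta>0: "0 < \<theta>" using \<eta>0 \<mu> nn by (simp add: \<theta>_def)
  have R0: "0 \<le> R" by (simp add: R_def)
  have DJ: "J / C \<le> D" using J1 C by (simp add: D_def field_simps)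
  have JC1: "1 \<le> J / C" using JC C by simp
  then have D1: "1 \<le> D" using DJ by linarith
  \<comment> \<open>The squared signal exceeds the squared noise scale \<open>D\<close> by the
    factor J / C, which is what \<open>num1\<close> spends on the constants.\<close>
  have \<mu>nD: "J / C * D \<le> (\<mu> * n)\<^sup>2"
  proof -
    have "J * p * n \<le> C * (n * \<mu>\<^sup>2) * n" using J2 by (intro mult_right_mono) auto
    then show ?thesis using C by (simp add: D_def field_simps power2_eq_square)
  qed
  have \<mu>n1: "1 \<le> \<mu> * n"
  proof -
    have "1 * 1 \<le> J / C * D" using JC1 D1 by (intro mult_mono) auto
    then have "1\<^sup>2 \<le> (\<mu> * n)\<^sup>2" using \<mu>nD by simp
    then show ?thesis by (rule power2_le_imp_le) (use \<mu> in simp)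
  qed
  define q where "q = 4 * (9200 + 32 * K)"
  have num1: "q * sqrt D \<le> \<theta>"
  proof (rule power2_le_imp_le)
    have "(q / \<eta>)\<^sup>2 \<le> J / C" using L by (simp add: K_def q_def \<eta>_def)
    then have "(q / \<eta>)\<^sup>2 * D \<le> J / C * D" using D1 by (intro mult_right_mono) auto
    also have "\<dots> \<le> (\<mu> * n)\<^sup>2" by (rule \<mu>nD)
    finally have "\<eta>\<^sup>2 * ((q / \<eta>)\<^sup>2 * D) \<le> \<eta>\<^sup>2 * (\<mu> * n)\<^sup>2" by (intro mult_left_mono) auto
    then show "(q * sqrt D)\<^sup>2 \<le> \<theta>\<^sup>2"
      using \<eta>0 D1 by (simp add: \<theta>_def power_mult_distrib power_divide)
  qed (use \<theta>0 in simp)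
  have kd: "(3 - K) * D \<le> - J + - D + - D"
  proof -
    have "(3 - K) * D = - (C * D) - D - D" by (simp add: K_def algebra_simps)
    then show ?thesis using J1 by (simp add: D_def)
  qed
  have expJ: "n * exp (- J) \<le> R"
  proof -
    have "(1 - e / 2) * J \<le> 1 * J" using e J0 by (intro mult_right_mono) auto
    then have "- J \<le> - (1 - e / 2) * J" unfolding mult_minus_left by linarith
    then show ?thesis unfolding R_def by (intro mult_left_mono) auto
  qed
  have num2: "n * exp ((3 - K) * D) \<le> R"
  proof -
    have "exp ((3 - K) * D) \<le> exp (- J)" unfolding exp_le_cancel_iff using kd D1 by linarith
    then have "n * exp ((3 - K) * D) \<le> n * exp (- J)" by (intro mult_left_mono) auto
    then show ?thesis using expJ by linarith
  qed
  \<comment> \<open>One spare factor exp (- D) absorbs \<open>D\<close>, the other absorbs the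
    constant 128 * K against \<theta>.\<close>
  have num3: "128 * K * D * (n * exp ((3 - K) * D)) \<le> \<theta> * R"
  proof -
    have K0: "0 < K" using C by (simp add: K_def)
    have De: "D * exp (- D) \<le> 1" using exp_ge_add_one_self[of D] D1 by (simp add: exp_minus field_simps)
    have Ke: "128 * K * exp (- D) \<le> \<theta>"
    proof -
      have "128 * K * exp (- D) \<le> 128 * K * exp (- (J / C))" using DJ K0 by (intro mult_left_mono) auto
      also have "\<dots> \<le> \<eta> * 1" using L by (simp add: K_def \<eta>_def)
      also have "\<dots> \<le> \<theta>" unfolding \<theta>_def using \<eta>0 \<mu>n1 by (intro mult_left_mono) auto
      finally show ?thesis .
    qed
    have KD: "(128 * K * exp (- D)) * (D * exp (- D)) \<le> \<theta> * 1"
      by (rule mult_mono[OF Ke De]) (use \<theta>0 D1 in auto)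
    have "((128 * K * exp (- D)) * (D * exp (- D))) * (n * exp (- J)) \<le> (\<theta> * 1) * R"
      by (rule mult_mono[OF KD expJ]) (use \<theta>0 in auto)
    moreover have "128 * K * D * (n * exp ((3 - K) * D)) \<le> 128 * K * D * (n * exp (- J + - D + - D))"
      using kd D1 K0 by (intro mult_left_mono) auto
    moreover have "exp (- J + - D + - D) = exp (- J) * exp (- D) * exp (- D)" unfolding exp_add ..
    ultimately show ?thesis by (simp only: mult_ac mult_1_right)
  qed
  let ?I = "{(i, j). i \<le> j \<and> j < n}"
  have ind: "indep_vars (\<lambda>_. borel) (\<lambda>e \<omega>. A \<omega> $$ e) ?I"
    using rm by (simp add: symmetric_random_mat_def case_prod_beta')
  have Xm [measurable]: "(\<lambda>\<omega>. A \<omega> $$ e) \<in> borel_measurable M" if "e \<in> ?I" for e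
    using ind that unfolding indep_vars_def by auto
  have UI: "upper_pairs n \<subseteq> ?I" by auto
  define N where "N e \<omega> = (of_bool (A \<omega> $$ e \<noteq> 0) :: real)" for e \<omega>
  define deg where "deg i \<omega> = (\<Sum>e\<in>edge_pairs n {i} {..<n}. N e \<omega>)" for i \<omega>
  have EU: "edge_pairs n {i} {..<n} \<subseteq> upper_pairs n" for i by (auto simp: edge_pairs_def)
  have Nm: "N e \<in> borel_measurable M" if "e \<in> upper_pairs n" for e
    unfolding N_def[abs_def] using Xm[of e] that UI by auto
  have degm: "deg i \<in> borel_measurable M" for i
    unfolding deg_def[abs_def] using Nm EU by (intro borel_measurable_sum) blast
  have cardE: "real (card (edge_pairs n {i} {..<n})) \<le> n" for i
    using card_edge_pairs[of "{i}" "{..<n}" n] by simp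

  have pXe: "prob {\<omega> \<in> space M. A \<omega> $$ e \<noteq> 0} \<le> p" if "e \<in> upper_pairs n" for e
    using that pX[of "fst e" "snd e"] by auto
  have np1: "1 \<le> n * p" using D1 by (simp add: D_def)
  define SP where "SP \<omega> \<longleftrightarrow> (\<forall>K x. 0 \<le> K \<longrightarrow> (\<forall>e\<in>upper_pairs n. \<bar>centered \<sigma> c \<mu> e (A \<omega> $$ e)\<bar> \<le> of_bool (A \<omega> $$ e \<noteq> 0) + p) \<longrightarrow>
       (\<forall>i<n. x i \<noteq> 0 \<longrightarrow> (\<Sum>e\<in>edge_pairs n {i} {..<n}. of_bool (A \<omega> $$ e \<noteq> 0)) \<le> K * (n * p)) \<longrightarrow>
       upper_form n (\<lambda>e. centered \<sigma> c \<mu> e (A \<omega> $$ e)) x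
         \<le> (9200 + 32 * K) * sqrt (n * p) * (\<Sum>i<n. (x i)\<^sup>2))" for \<omega>
  have "\<exists>E\<in>events. 1 - (exp (- real n) + 2 / n) \<le> prob E \<and> (\<forall>\<omega>\<in>E. \<omega> \<in> space M \<and> SP \<omega>)"
    unfolding SP_def
  proof (rule sparse_spectral_event[OF ind UI borel_measurable_centered n p np1])
    fix f :: "nat \<times> nat" and s :: real assume "f \<in> upper_pairs n" "\<bar>s\<bar> \<le> 1 / 2"
    then show "(\<integral>\<^sup>+\<omega>. ennreal (exp (s * centered \<sigma> c \<mu> f (A \<omega> $$ f))) \<partial>M) \<le> ennreal (exp (s\<^sup>2 * p))"
      using mgfW[of "fst f" "snd f" s] by auto
  qed (rule pXe)
  then obtain E1 where E1: "E1 \<in> events" "1 - (exp (- real n) + 2 / n) \<le> prob E1" "\<And>\<omega>. \<omega> \<in> E1 \<Longrightarrow> \<omega> \<in> space M"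
    "\<And>\<omega>. \<omega> \<in> E1 \<Longrightarrow> SP \<omega>" by blast
  note SP = E1(4)[unfolded SP_def N_def[symmetric] deg_def[symmetric] D_def[symmetric], rule_format]

  have "(\<integral>\<^sup>+\<omega>. ennreal (exp (deg i \<omega> - K * D)) \<partial>M) \<le> ennreal (exp (- ((K - 2) * D)))" for i
  proof -
    have "(\<integral>\<^sup>+\<omega>. ennreal (exp (\<Sum>e\<in>edge_pairs n {i} {..<n}. 1 * of_bool (A \<omega> $$ e \<noteq> 0))) \<partial>M)
        \<le> ennreal (exp (\<Sum>e\<in>edge_pairs n {i} {..<n}. p * (exp 1 - 1)))"
    proof (rule mgf_sum_le[OF ind finite_edge_pairs, where g = "\<lambda>e x. 1 * of_bool (x \<noteq> 0)"])
      fix e assume "e \<in> edge_pairs n {i} {..<n}"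
      then have e: "e \<in> upper_pairs n" "e \<in> ?I" using EU UI by blast+
      show "(\<integral>\<^sup>+\<omega>. ennreal (exp (1 * of_bool (A \<omega> $$ e \<noteq> 0))) \<partial>M) \<le> ennreal (exp (p * (exp 1 - 1)))"
        by (rule mgf_bernoulli_le[OF Xm[OF e(2)] pXe[OF e(1)]]) simp
    qed (use EU UI in \<open>auto\<close>)
    also have "(\<Sum>e\<in>edge_pairs n {i} {..<n}. p * (exp 1 - 1)) \<le> 2 * D"
    proof -
      have "exp 1 - 1 \<le> (2::real)" using e_less_272 by simp
      then have "card (edge_pairs n {i} {..<n}) * (p * (exp 1 - 1)) \<le> n * (p * 2)"
        using cardE[of i] p by (intro mult_mono mult_left_mono) auto
      then show ?thesis by (simp add: D_def)
    qed
    finally have "(\<integral>\<^sup>+\<omega>. ennreal (exp (deg i \<omega>)) \<partial>M) \<le> ennreal (exp (2 * D))"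
      by (simp add: deg_def N_def ennreal_leI)
    then have "ennreal (exp (- (K * D))) * (\<integral>\<^sup>+\<omega>. ennreal (exp (deg i \<omega>)) \<partial>M) \<le> ennreal (exp (- (K * D))) * ennreal (exp (2 * D))"
      by (intro mult_left_mono) auto
    moreover have "(\<integral>\<^sup>+\<omega>. ennreal (exp (deg i \<omega> - K * D)) \<partial>M) = (\<integral>\<^sup>+\<omega>. ennreal (exp (- (K * D))) * ennreal (exp (deg i \<omega>)) \<partial>M)"
      by (simp add: ennreal_mult[symmetric] exp_add[symmetric])
    moreover have "\<dots> = ennreal (exp (- (K * D))) * (\<integral>\<^sup>+\<omega>. ennreal (exp (deg i \<omega>)) \<partial>M)"
      using degm[of i] by (intro nn_integral_cmult) measurable
    ultimately show ?thesis by (simp add: ennreal_mult[symmetric] exp_add[symmetric] algebra_simps)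
  qed
  then obtain E2 where E2: "E2 \<in> events" "1 - exp (- D) \<le> prob E2" "\<And>\<omega>. \<omega> \<in> E2 \<Longrightarrow> \<omega> \<in> space M"
      "\<And>\<omega>. \<omega> \<in> E2 \<Longrightarrow> (\<Sum>i<n. exp (deg i \<omega> - K * D)) < n * exp (D - (K - 2) * D)"
    using sum_exp_event[OF n, of "\<lambda>i \<omega>. deg i \<omega> - K * D" "(K - 2) * D" D] degm by auto
  have K3: "D - (K - 2) * D = (3 - K) * D" by (simp add: algebra_simps)

  \<comment> \<open>The entry bound is only almost sure; these finitely many null events are
    discarded.\<close>
  define Bad where "Bad e = {\<omega> \<in> space M. \<not> \<bar>centered \<sigma> c \<mu> e (A \<omega> $$ e)\<bar> \<le> N e \<omega> + p}" for e
  have Bad: "Bad e \<in> events" "prob (Bad e) \<le> 0" if e: "e \<in> upper_pairs n" for e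
  proof -
    have Xe [measurable]: "(\<lambda>\<omega>. A \<omega> $$ e) \<in> borel_measurable M" using Xm[of e] e UI by blast
    have ev: "{\<omega> \<in> space M. \<bar>centered \<sigma> c \<mu> e (A \<omega> $$ e)\<bar> \<le> N e \<omega> + p} \<in> events"
      unfolding N_def by measurable
    have "Bad e = space M - {\<omega> \<in> space M. \<bar>centered \<sigma> c \<mu> e (A \<omega> $$ e)\<bar> \<le> N e \<omega> + p}"
      by (auto simp: Bad_def)
    moreover have "prob {\<omega> \<in> space M. \<bar>centered \<sigma> c \<mu> e (A \<omega> $$ e)\<bar> \<le> N e \<omega> + p} = 1"
    proof -
      obtain i j where ij: "e = (i, j)" "i < j" "j < n" using e by auto
      then show ?thesis using bd[OF ij(2,3)] by (simp only: N_def ij(1))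
    qed
    ultimately show "Bad e \<in> events" "prob (Bad e) \<le> 0" using prob_compl[OF ev] ev by auto
  qed
  obtain E3 where E3: "E3 \<in> events" "1 - 0 \<le> prob E3" "\<And>\<omega> e. \<omega> \<in> E3 \<Longrightarrow> e \<in> upper_pairs n \<Longrightarrow> \<omega> \<notin> Bad e"
    using union_bound[of "upper_pairs n" Bad "\<lambda>_. 0"] Bad by auto

  have spec: "\<exists>E\<in>events. 1 - ((exp (- real n) + 2 / n) + (exp (- D) + 0)) \<le> prob E \<and> (\<forall>\<omega>\<in>E. \<omega> \<in> space M \<and>
       noise_bounded n (\<lambda>e. centered \<sigma> c \<mu> e (A \<omega> $$ e)) \<theta> R)"
  proof (rule bexI[of _ "E1 \<inter> (E2 \<inter> E3)"], intro conjI ballI)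
    show "E1 \<inter> (E2 \<inter> E3) \<in> events" using E1(1) E2(1) E3(1) by blast
    show "1 - ((exp (- real n) + 2 / n) + (exp (- D) + 0)) \<le> prob (E1 \<inter> (E2 \<inter> E3))"
      by (intro prob_Int_ge sets.Int E1(1,2) E2(1,2) E3(1,2))
    fix \<omega> assume \<omega>: "\<omega> \<in> E1 \<inter> (E2 \<inter> E3)"
    show \<omega>M: "\<omega> \<in> space M" using \<omega> E1(3) by blast
    have Wb: "\<bar>centered \<sigma> c \<mu> e (A \<omega> $$ e)\<bar> \<le> N e \<omega> + p" if "e \<in> upper_pairs n" for e
      using E3(3)[OF _ that, of \<omega>] \<omega> \<omega>M unfolding Bad_def by blast
    define G where "G = {i. deg i \<omega> \<le> K * D}"
    have S: "(\<Sum>i<n. exp (deg i \<omega> - K * D)) < n * exp ((3 - K) * D)" using E2(4)[of \<omega>] \<omega> unfolding K3 by blast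
    have 1: "2 * upper_form n (\<lambda>e. centered \<sigma> c \<mu> e (A \<omega> $$ e)) x \<le> \<theta> / 2 * (\<Sum>i<n. (x i)\<^sup>2)"
      if "\<forall>i<n. i \<notin> G \<longrightarrow> x i = 0" for x
    proof -
      have "upper_form n (\<lambda>e. centered \<sigma> c \<mu> e (A \<omega> $$ e)) x \<le> (9200 + 32 * K) * sqrt D * (\<Sum>i<n. (x i)\<^sup>2)"
        using \<omega> C that by (intro SP Wb) (auto simp: K_def G_def)
      moreover have "q * sqrt D * (\<Sum>i<n. (x i)\<^sup>2) \<le> \<theta> * (\<Sum>i<n. (x i)\<^sup>2)"
        by (intro mult_right_mono num1 sum_nonneg) auto
      moreover have "q * sqrt D * (\<Sum>i<n. (x i)\<^sup>2) = 4 * ((9200 + 32 * K) * sqrt D * (\<Sum>i<n. (x i)\<^sup>2))"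
        by (simp add: q_def)
      moreover have "\<theta> / 2 * (\<Sum>i<n. (x i)\<^sup>2) = (\<theta> * (\<Sum>i<n. (x i)\<^sup>2)) / 2" by simp
      ultimately show ?thesis by linarith
    qed
    have 2: "(\<Sum>j\<in>{..<n} - {i}. \<bar>sym_ext (\<lambda>e. centered \<sigma> c \<mu> e (A \<omega> $$ e)) i j\<bar>) \<le> deg i \<omega> + D" if "i < n" for i
    proof -
      have "(\<Sum>j\<in>{..<n} - {i}. \<bar>sym_ext (\<lambda>e. centered \<sigma> c \<mu> e (A \<omega> $$ e)) i j\<bar>) =
          (\<Sum>(a, b)\<in>edge_pairs n {i} {..<n}. \<bar>sym_ext (\<lambda>e. centered \<sigma> c \<mu> e (A \<omega> $$ e)) a b\<bar>)"
        using that by (intro sum_star_edges) (auto simp: sym_ext_commute)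
      also have "\<dots> \<le> (\<Sum>e\<in>edge_pairs n {i} {..<n}. N e \<omega> + p)"
      proof (rule sum_mono, clarify)
        fix a b assume "(a, b) \<in> edge_pairs n {i} {..<n}"
        then have "(a, b) \<in> upper_pairs n" "a < b" using EU by auto
        then show "\<bar>sym_ext (\<lambda>e. centered \<sigma> c \<mu> e (A \<omega> $$ e)) a b\<bar> \<le> N (a, b) \<omega> + p"
          using Wb[of "(a, b)"] by (simp add: sym_ext_def)
      qed
      also have "\<dots> = deg i \<omega> + card (edge_pairs n {i} {..<n}) * p" by (simp add: sum.distrib deg_def)
      also have "\<dots> \<le> deg i \<omega> + D" unfolding D_def using cardE[of i] p by (intro add_left_mono mult_right_mono) auto
      finally show ?thesis .
    qed
    \<comment> \<open>A removed vertex alone contributes at least 1 to the sum \<open>S\<close>, so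
      \<open>R\<close> cannot be below 1.\<close>
    have 3: "1 \<le> R" if ne: "{..<n} - G \<noteq> {}"
    proof -
      obtain i where "i \<in> {..<n} - G" using ne by blast
      then have i: "i < n" "K * D < deg i \<omega>" by (auto simp: G_def)
      have "1 \<le> exp (deg i \<omega> - K * D)" using i by simp
      also have "\<dots> \<le> (\<Sum>i<n. exp (deg i \<omega> - K * D))" using i by (intro member_le_sum) auto
      finally show ?thesis using S num2 by linarith
    qed
    have 4: "8 * (\<Sum>i\<in>{..<n} - G. deg i \<omega> + D) \<le> \<theta> / 8 * R"
    proof -
      have K1: "1 \<le> K" using C by (simp add: K_def)
      have KD: "D \<le> K * D" using K1 D1 by simp
      then have KD1: "1 \<le> K * D" using D1 by linarith
      \<comment> \<open>Beyond the threshold K * D \<ge> 1 a degree is at most K * D times the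
        exponential of its excess, by 1 + y \<le> exp y.\<close>
      have "(\<Sum>i\<in>{..<n} - G. deg i \<omega> + D) \<le> (\<Sum>i\<in>{..<n} - G. 2 * (K * D) * exp (deg i \<omega> - K * D))"
      proof (rule sum_mono)
        fix i assume "i \<in> {..<n} - G"
        then have y: "K * D < deg i \<omega>" by (auto simp: G_def)
        define y where "y = deg i \<omega> - K * D"
        have "1 * y \<le> K * D * y" using KD1 y by (intro mult_right_mono) (auto simp: y_def)
        then have "K * D + y \<le> K * D + K * D * y" by simp
        also have "\<dots> = K * D * (1 + y)" by (simp add: algebra_simps)
        also have "\<dots> \<le> K * D * exp y" using K1 D1 by (intro mult_left_mono exp_ge_add_one_self) auto
        finally have "deg i \<omega> \<le> K * D * exp (deg i \<omega> - K * D)" by (simp add: y_def)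
        then show "deg i \<omega> + D \<le> 2 * (K * D) * exp (deg i \<omega> - K * D)" using KD y by linarith
      qed
      also have "\<dots> \<le> (\<Sum>i<n. 2 * (K * D) * exp (deg i \<omega> - K * D))" using K1 D1 by (intro sum_mono2) auto
      also have "\<dots> \<le> 2 * (K * D) * (n * exp ((3 - K) * D))"
        unfolding sum_distrib_left[symmetric] using S K1 D1 by (intro mult_left_mono) auto
      finally show ?thesis using num3 by simp
    qed
    show "noise_bounded n (\<lambda>e. centered \<sigma> c \<mu> e (A \<omega> $$ e)) \<theta> R"
      using 1 2 3 4 by (intro exI[of _ G] exI[of _ "\<lambda>i. deg i \<omega> + D"] conjI allI impI) auto
  qed

  \<comment> \<open>The rate after paying for the correction term C * (J / n + 1) in the row moments
    and for the shift by \<theta>. Together with the e * J / 8 spent in Markov's inequality this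
    stays within e * J / 2.\<close>
  define a where "a = J - C * (J / n + 1) - e * J / 8"
  have \<theta>lam: "1 \<le> \<theta> * lam"
  proof -
    have "8 * C\<^sup>2 \<le> e * J" using L by blast
    also have "\<dots> \<le> e * (C * (lam * \<mu> * n))" using J3 e by (intro mult_left_mono) auto
    finally have "C * (8 * C) \<le> C * (e * (lam * \<mu> * n))" by (simp add: power2_eq_square mult_ac)
    then have "8 * C \<le> e * (lam * \<mu> * n)" using C by simp
    then show ?thesis using C by (simp add: \<theta>_def \<eta>_def field_simps)
  qed
  have \<kappa>': "lam * \<theta> + (\<Sum>j\<in>{..<n} - {i}. \<kappa> i j) \<le> - a" if "i < n" for i
  proof -
    have "lam * \<theta> = \<eta> * (lam * \<mu> * n)" by (simp add: \<theta>_def)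
    also have "\<dots> \<le> \<eta> * (C * J)" using J4 \<eta>0 by (intro mult_left_mono) auto
    also have "\<dots> = e * J / 8" using C by (simp add: \<eta>_def)
    finally show ?thesis using \<kappa>[OF that] by (simp add: a_def)
  qed
  have aR: "32 * (n * exp (e * J / 8 - a)) \<le> R"
  proof -
    have "C * (J / n) = C * J / n" by simp
    also have "\<dots> \<le> e * J / 16"
    proof -
      have "16 * C * J \<le> e * n * J" using L J0 by (intro mult_right_mono) auto
      then show ?thesis using nn by (simp add: field_simps)
    qed
    finally have "C * (J / n) \<le> e * J / 16" .
    moreover have "ln 32 + C \<le> e * J / 16" using L by blast
    moreover have "a = J - (C * (J / n) + C) - e * J / 8" "- (1 - e / 2) * J = - J + e * J / 2"
      by (simp_all add: a_def algebra_simps)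
    moreover have "0 < e * J" using e J0 by simp
    ultimately have "ln 32 + (e * J / 8 - a) \<le> - (1 - e / 2) * J" by linarith
    then have "exp (ln 32 + (e * J / 8 - a)) \<le> exp (- (1 - e / 2) * J)" by simp
    then have "32 * exp (e * J / 8 - a) \<le> exp (- (1 - e / 2) * J)" by (simp only: exp_add exp_ln[of 32] zero_less_numeral)
    then have "n * (32 * exp (e * J / 8 - a)) \<le> R" unfolding R_def by (intro mult_left_mono) auto
    then show ?thesis by simp
  qed
  have "\<exists>E\<in>events. 1 - ((exp (- real n) + 2 / n) + (exp (- D) + 0) + exp (- (e * J / 8))) \<le> prob E \<and>
    (\<forall>\<omega>\<in>E. \<forall>Y\<in>sdp_sublevel F n \<sigma> (A \<omega>). 1 / real n * entrywise_l1_norm (Y - label_mat \<sigma>) \<le> of_int \<lfloor>R\<rfloor>)"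
    by (rule common_recovery[where F = F and \<kappa> = \<kappa>, OF rm \<sigma> n less_imp_le[OF \<mu>] \<theta>0 lam \<theta>lam R0 F spec mgf \<kappa>sym \<kappa>' aR])
  then obtain E where E: "E \<in> events" "1 - ((exp (- real n) + 2 / n) + (exp (- D) + 0) + exp (- (e * J / 8))) \<le> prob E"
    "\<And>\<omega> Y. \<omega> \<in> E \<Longrightarrow> Y \<in> sdp_sublevel F n \<sigma> (A \<omega>) \<Longrightarrow> 1 / real n * entrywise_l1_norm (Y - label_mat \<sigma>) \<le> of_int \<lfloor>R\<rfloor>"
    by blast
  have "exp (- D) \<le> exp (- (J / C))" using DJ by simp
  moreover have "exp (- (J / C)) \<le> e / 4" "exp (- real n) + 2 / n \<le> e / 4" "exp (- (e * J / 8)) \<le> e / 4" using L by blast+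
  ultimately have "1 - e \<le> prob E" using E(2) e by linarith
  moreover have "accurate F n \<sigma> (A \<omega>) J e" if "\<omega> \<in> E" for \<omega>
    using E(3)[OF that] e J0 n \<sigma> F L unfolding R_def by (intro accurateI) auto
  ultimately show ?thesis using E(1) by blast
qed

section \<open>The three models\<close>

text \<open>Completing the square: tilting a normal density by exp (s * x) shifts its mean by s *
  \<tau>^2.\<close>

lemma (in prob_space) mgf_normal:
  fixes X :: "'a \<Rightarrow> real"
  assumes X: "distributed M lborel X (normal_density m \<tau>)" and \<tau>: "0 < \<tau>"
  shows "(\<integral>\<^sup>+\<omega>. ennreal (exp (s * X \<omega>)) \<partial>M) = ennreal (exp (s * m + s\<^sup>2 * \<tau>\<^sup>2 / 2))"
proof -
  have "(\<integral>\<^sup>+\<omega>. ennreal (exp (s * X \<omega>)) \<partial>M) = (\<integral>\<^sup>+x. ennreal (normal_density m \<tau> x) * ennreal (exp (s * x)) \<partial>lborel)"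
    by (rule distributed_nn_integral[OF X, symmetric]) measurable
  also have "\<dots> = (\<integral>\<^sup>+x. ennreal (exp (s * m + s\<^sup>2 * \<tau>\<^sup>2 / 2)) * ennreal (normal_density (m + s * \<tau>\<^sup>2) \<tau> x) \<partial>lborel)"
  proof (intro nn_integral_cong)
    fix x
    have "- (x - m)\<^sup>2 / (2 * \<tau>\<^sup>2) + s * x = (s * m + s\<^sup>2 * \<tau>\<^sup>2 / 2) + - (x - (m + s * \<tau>\<^sup>2))\<^sup>2 / (2 * \<tau>\<^sup>2)"
      using \<tau> by (simp add: field_simps power2_eq_square)
    then have "exp (- (x - m)\<^sup>2 / (2 * \<tau>\<^sup>2)) * exp (s * x) = exp (s * m + s\<^sup>2 * \<tau>\<^sup>2 / 2) * exp (- (x - (m + s * \<tau>\<^sup>2))\<^sup>2 / (2 * \<tau>\<^sup>2))"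
      unfolding exp_add[symmetric] by simp
    then have "normal_density m \<tau> x * exp (s * x) = exp (s * m + s\<^sup>2 * \<tau>\<^sup>2 / 2) * normal_density (m + s * \<tau>\<^sup>2) \<tau> x"
      unfolding normal_density_def by (simp add: mult_ac)
    then show "ennreal (normal_density m \<tau> x) * ennreal (exp (s * x)) =
        ennreal (exp (s * m + s\<^sup>2 * \<tau>\<^sup>2 / 2)) * ennreal (normal_density (m + s * \<tau>\<^sup>2) \<tau> x)"
      by (simp add: ennreal_mult[symmetric])
  qed
  also have "\<dots> = ennreal (exp (s * m + s\<^sup>2 * \<tau>\<^sup>2 / 2)) * (\<integral>\<^sup>+x. ennreal (normal_density (m + s * \<tau>\<^sup>2) \<tau> x) \<partial>lborel)"
    by (rule nn_integral_cmult) measurable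
  also have "(\<integral>\<^sup>+x. ennreal (normal_density (m + s * \<tau>\<^sup>2) \<tau> x) \<partial>lborel) = 1"
    using \<tau> by (subst nn_integral_eq_integral) (auto simp: normal_density_nonneg)
  finally show ?thesis by simp
qed

lemma (in prob_space) mgf_normal_sign:
  fixes X :: "'a \<Rightarrow> real"
  assumes X: "distributed M lborel X (normal_density t \<tau>)" and \<tau>: "0 < \<tau>" and t: "t * t = 1"
  shows "(\<integral>\<^sup>+\<omega>. ennreal (exp (s * (t * X \<omega> - 1))) \<partial>M) = ennreal (exp (s\<^sup>2 * (\<tau>\<^sup>2 / 2)))"
proof -
  have Xm: "X \<in> borel_measurable M" using distributed_measurable[OF X] by simp
  have "(\<integral>\<^sup>+\<omega>. ennreal (exp (s * (t * X \<omega> - 1))) \<partial>M) = (\<integral>\<^sup>+\<omega>. ennreal (exp (- s)) * ennreal (exp ((s * t) * X \<omega>)) \<partial>M)"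
    by (simp add: ennreal_mult[symmetric] exp_add[symmetric] algebra_simps)
  also have "\<dots> = ennreal (exp (- s)) * (\<integral>\<^sup>+\<omega>. ennreal (exp ((s * t) * X \<omega>)) \<partial>M)"
    using Xm by (intro nn_integral_cmult) measurable
  also have "\<dots> = ennreal (exp (- s)) * ennreal (exp ((s * t) * t + (s * t)\<^sup>2 * \<tau>\<^sup>2 / 2))"
    unfolding mgf_normal[OF X \<tau>] ..
  also have "(s * t) * t + (s * t)\<^sup>2 * \<tau>\<^sup>2 / 2 = s + s\<^sup>2 * (\<tau>\<^sup>2 / 2)"
    using t by (simp add: power2_eq_square mult.assoc)
  also have "ennreal (exp (- s)) * ennreal (exp (s + s\<^sup>2 * (\<tau>\<^sup>2 / 2))) = ennreal (exp (s\<^sup>2 * (\<tau>\<^sup>2 / 2)))"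
    by (simp add: ennreal_mult[symmetric] exp_add[symmetric])
  finally show ?thesis .
qed

text \<open>For y = - t < 0 the product (1 - t + t^2) * (1 + t + t^2 / 2) is at least 1, and its
  second factor is at most exp t.\<close>

lemma exp_le_quadratic:
  fixes y :: real
  assumes "\<bar>y\<bar> \<le> 1"
  shows "exp y \<le> 1 + y + y\<^sup>2"
proof (cases "0 \<le> y")
  case True
  then show ?thesis using assms by (intro exp_bound) auto
next
  case False
  define t where "t = - y"
  have t: "0 \<le> t" using False by (simp add: t_def)
  have l: "1 + t + t\<^sup>2 / 2 \<le> exp t" using t by (rule exp_lower_Taylor_quadratic)
  have q: "0 \<le> 1 - t + t\<^sup>2"
  proof -
    have "0 \<le> (1 - t)\<^sup>2 + t" using t by simp
    then show ?thesis by (simp add: power2_eq_square algebra_simps)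
  qed
  have "1 \<le> (1 - t + t\<^sup>2) * (1 + t + t\<^sup>2 / 2)"
  proof -
    have "(1 - t + t\<^sup>2) * (1 + t + t\<^sup>2 / 2) = 1 + t\<^sup>2 / 2 + t ^ 3 / 2 + t ^ 4 / 2"
      by (simp add: power2_eq_square power3_eq_cube power4_eq_xxxx field_simps)
    then show ?thesis using t by simp
  qed
  also have "\<dots> \<le> (1 - t + t\<^sup>2) * exp t" using q l by (intro mult_left_mono)
  finally have "exp (- t) \<le> 1 - t + t\<^sup>2" by (simp add: exp_minus field_simps)
  then show ?thesis by (simp add: t_def)
qed

text \<open>Since |s * w| \<le> 1, the exponential is at most its quadratic bound; the linear term
  has mean 0 and the quadratic one is at most s^2 * p.\<close>

lemma (in prob_space) discrete_mgf_le:
  fixes X :: "'a \<Rightarrow> real" and w :: "real \<Rightarrow> real"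
  assumes X: "X \<in> borel_measurable M" and V: "finite V"
    and total: "(\<Sum>v\<in>V. prob {\<omega> \<in> space M. X \<omega> = v}) = 1"
    and w: "\<And>v. v \<in> V \<Longrightarrow> \<bar>w v\<bar> \<le> 2"
    and mean: "(\<Sum>v\<in>V. w v * prob {\<omega> \<in> space M. X \<omega> = v}) = 0"
    and var: "(\<Sum>v\<in>V. (w v)\<^sup>2 * prob {\<omega> \<in> space M. X \<omega> = v}) \<le> p"
    and s: "\<bar>s\<bar> \<le> 1 / 2"
  shows "(\<integral>\<^sup>+\<omega>. ennreal (exp (s * w (X \<omega>))) \<partial>M) \<le> ennreal (exp (s\<^sup>2 * p))"
proof -
  let ?P = "\<lambda>v. prob {\<omega> \<in> space M. X \<omega> = v}"
  have "(\<integral>\<^sup>+\<omega>. ennreal (exp (s * w (X \<omega>))) \<partial>M) = ennreal (\<Sum>v\<in>V. exp (s * w v) * ?P v)"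
    by (rule nn_integral_discrete[OF X V total]) simp
  also have "(\<Sum>v\<in>V. exp (s * w v) * ?P v) \<le> (\<Sum>v\<in>V. (1 + s * w v + (s * w v)\<^sup>2) * ?P v)"
  proof (intro sum_mono mult_right_mono exp_le_quadratic)
    fix v assume "v \<in> V"
    then have "\<bar>s\<bar> * \<bar>w v\<bar> \<le> 1 / 2 * 2" using s w by (intro mult_mono) auto
    then show "\<bar>s * w v\<bar> \<le> 1" by (simp add: abs_mult)
  qed simp
  also have "\<dots> = (\<Sum>v\<in>V. ?P v) + s * (\<Sum>v\<in>V. w v * ?P v) + s\<^sup>2 * (\<Sum>v\<in>V. (w v)\<^sup>2 * ?P v)"
    by (simp add: sum_distrib_left sum.distrib[symmetric] power_mult_distrib algebra_simps)
  also have "\<dots> \<le> 1 + s\<^sup>2 * p" unfolding total mean using var by (simp add: mult_left_mono)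
  also have "\<dots> \<le> exp (s\<^sup>2 * p)" by (rule exp_ge_add_one_self)
  finally show ?thesis by (simp add: ennreal_leI)
qed

lemma (in prob_space) prob_eq_1_discrete:
  fixes X :: "'a \<Rightarrow> real"
  assumes X: "X \<in> borel_measurable M" and V: "finite V"
    and total: "(\<Sum>v\<in>V. prob {\<omega> \<in> space M. X \<omega> = v}) = 1"
    and Q: "\<And>v. v \<in> V \<Longrightarrow> Q v" and ev: "{\<omega> \<in> space M. Q (X \<omega>)} \<in> events"
  shows "prob {\<omega> \<in> space M. Q (X \<omega>)} = 1"
proof -
  have "prob {\<omega> \<in> space M. X \<omega> \<in> V} \<le> prob {\<omega> \<in> space M. Q (X \<omega>)}"
    using Q by (intro finite_measure_mono ev) auto
  then show ?thesis using AE_discrete[OF X V total] prob_le_1[of "{\<omega> \<in> space M. Q (X \<omega>)}"] by simp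
qed

lemma entry_measurable:
  assumes "symmetric_random_mat M n A" "i \<le> j" "j < n"
  shows "(\<lambda>\<omega>. A \<omega> $$ (i, j)) \<in> borel_measurable M"
proof -
  interpret prob_space M using assms by (simp add: symmetric_random_mat_def)
  have "indep_vars (\<lambda>_. borel) (\<lambda>e \<omega>. A \<omega> $$ e) {(i, j). i \<le> j \<and> j < n}"
    using assms by (simp add: symmetric_random_mat_def case_prod_beta')
  then show ?thesis using assms unfolding indep_vars_def by auto
qed

lemma label_vec_cases:
  assumes "label_vec n \<sigma>" "i < n" "j < n"
  shows "\<sigma> $ i * \<sigma> $ j = 1 \<or> \<sigma> $ i * \<sigma> $ j = - 1"
proof -
  have "\<sigma> $ i \<in> {-1, 1}" "\<sigma> $ j \<in> {-1, 1}" using assms by (auto simp: label_vec_def)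
  then show ?thesis by auto
qed

section \<open>Synchronization with Gaussian noise\<close>

text \<open>Gaussian moments are available for every parameter, so all pairs count as light and no
  row is removed.\<close>

lemma z2_accurate:
  fixes A :: "'w \<Rightarrow> real Matrix.mat"
  assumes model: "z2_synchronization M n \<sigma> \<tau> A" and e: "0 < e" "e < 1"
    and large: "large_enough 2 e n (real n * z2_info \<tau>)"
  shows "\<exists>E\<in>sets M. 1 - e \<le> measure M E \<and> (\<forall>\<omega>\<in>E. accurate sdp_feasible n \<sigma> (A \<omega>) (real n * z2_info \<tau>) e)"
proof -
  have \<sigma>: "label_vec n \<sigma>" and \<tau>: "0 < \<tau>" and rm: "symmetric_random_mat M n A"
    and dist: "\<And>i j. i \<le> j \<Longrightarrow> j < n \<Longrightarrow> distributed M lborel (\<lambda>\<omega>. A \<omega> $$ (i, j)) (normal_density (\<sigma> $ i * \<sigma> $ j) \<tau>)"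
    using model by (auto simp: z2_synchronization_def)
  interpret prob_space M using rm by (simp add: symmetric_random_mat_def)
  define J where "J = real n * z2_info \<tau>"
  note L = large[folded J_def, unfolded large_enough_def]
  have n: "0 < n" and nn: "0 < real n" using L by auto
  have J2: "2 \<le> J" using L by blast
  have JI: "J = n / (2 * \<tau>\<^sup>2)" by (simp add: J_def z2_info_def)
  \<comment> \<open>e / (8 * C) with C = 2, so that lam * \<theta> = e * J / 8.\<close>
  define \<eta> where "\<eta> = e / 16"
  define \<theta> where "\<theta> = \<eta> * n"
  \<comment> \<open>The minimiser of - lam + lam^2 * \<tau>^2 / 2; the minimum is minus the
    information.\<close>
  define lam where "lam = 1 / \<tau>\<^sup>2"
  define R where "R = n * exp (- (1 - e / 2) * J)"
  define a where "a = J - J / n - e * J / 8"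
  have \<eta>0: "0 < \<eta>" and \<theta>0: "0 < \<theta>" and lam0: "0 < lam" using e nn \<tau> by (auto simp: \<eta>_def \<theta>_def lam_def)
  have lam\<theta>: "lam * \<theta> = e * J / 8" using \<tau> by (simp add: lam_def \<theta>_def \<eta>_def JI)
  have sq: "(\<sigma> $ i * \<sigma> $ j) * (\<sigma> $ i * \<sigma> $ j) = 1" if "i < n" "j < n" for i j
    using label_vec_cases[OF \<sigma> that] by auto
  have sq': "(\<sigma> $ i * \<sigma> $ j)\<^sup>2 = 1" if "i < n" "j < n" for i j
    using sq[OF that] by (simp only: power2_eq_square)
  have ind: "indep_vars (\<lambda>_. borel) (\<lambda>e \<omega>. A \<omega> $$ e) {(i, j). i \<le> j \<and> j < n}"
    using rm by (simp add: symmetric_random_mat_def case_prod_beta')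
  define v where "v = \<tau>\<^sup>2 / 2"
  have v0: "0 < v" using \<tau> by (simp add: v_def)
  have "\<exists>E\<in>events. 1 - exp (- real n) \<le> prob E \<and> (\<forall>\<omega>\<in>E. \<omega> \<in> space M \<and> (\<forall>z\<in>int_net n.
     (\<Sum>(i, j)\<in>upper_pairs n. centered \<sigma> 0 1 (i, j) (A \<omega> $$ (i, j)) * z i * z j) \<le> 22 * real n * sqrt (n * v)))"
  proof (rule light_pairs_bound[where W = "centered \<sigma> 0 1" and X = "\<lambda>e \<omega>. A \<omega> $$ e" and L = "\<lambda>_. upper_pairs n", OF ind _ borel_measurable_centered n v0])
    fix z :: "nat \<Rightarrow> int" and i j assume "(i, j) \<in> upper_pairs n"
    then have ij: "i < j" "j < n" "i < n" by auto
    show "(\<integral>\<^sup>+\<omega>. ennreal (exp (real_of_int (z i) * real_of_int (z j) / (2 * sqrt (n * v)) * centered \<sigma> 0 1 (i, j) (A \<omega> $$ (i, j)))) \<partial>M)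
       \<le> ennreal (exp ((real_of_int (z i) * real_of_int (z j) / (2 * sqrt (n * v)))\<^sup>2 * v))"
      using mgf_normal_sign[OF dist \<tau> sq[OF ij(3,2)], of "real_of_int (z i) * real_of_int (z j) / (2 * sqrt (n * v))"] ij
      by (simp add: centered_def v_def)
  qed auto
  then obtain E1 where E1: "E1 \<in> events" "1 - exp (- real n) \<le> prob E1" "\<And>\<omega>. \<omega> \<in> E1 \<Longrightarrow> \<omega> \<in> space M"
    "\<And>\<omega> z. \<omega> \<in> E1 \<Longrightarrow> z \<in> int_net n \<Longrightarrow>
      (\<Sum>(i, j)\<in>upper_pairs n. centered \<sigma> 0 1 (i, j) (A \<omega> $$ (i, j)) * z i * z j) \<le> 22 * real n * sqrt (n * v)" by blast
  have num1: "4 * (22 * sqrt (n * v)) \<le> \<theta>"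
  proof (rule power2_le_imp_le)
    \<comment> \<open>J * n * v = n^2 / 4 reduces the claim to sqrt J \<ge> 704 / e, where 704 = 4 *
      22 * 16 / 2. The much larger constant of the sparse case covers it.\<close>
    have "(704 / e)\<^sup>2 \<le> (4 * (9200 + 32 * (2 + 5)) * (8 * 2 / e))\<^sup>2"
      using e by (intro power_mono) (auto simp: field_simps)
    also have "\<dots> \<le> J / 2" using L by blast
    finally have "(704 / e)\<^sup>2 \<le> J" using J2 by linarith
    then have "704\<^sup>2 \<le> e\<^sup>2 * J" using e by (simp add: power_divide field_simps)
    then have "704\<^sup>2 * (n * v) \<le> e\<^sup>2 * J * (n * v)" using v0 by (intro mult_right_mono) auto
    also have "J * (n * v) = (real n)\<^sup>2 / 4" using \<tau> by (simp add: JI v_def power2_eq_square)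
    then have "e\<^sup>2 * J * (n * v) = e\<^sup>2 * ((real n)\<^sup>2 / 4)" by (simp only: mult.assoc)
    finally show "(4 * (22 * sqrt (n * v)))\<^sup>2 \<le> \<theta>\<^sup>2"
      using v0 by (simp add: \<theta>_def \<eta>_def power_mult_distrib power_divide)
  qed (use \<theta>0 in simp)
  have spec: "\<exists>E\<in>events. 1 - exp (- real n) \<le> prob E \<and> (\<forall>\<omega>\<in>E. \<omega> \<in> space M \<and>
       noise_bounded n (\<lambda>e. centered \<sigma> 0 1 e (A \<omega> $$ e)) \<theta> R)"
  proof (rule bexI[OF _ E1(1)], intro conjI ballI)
    fix \<omega> assume \<omega>: "\<omega> \<in> E1"
    have "2 * upper_form n (\<lambda>e. centered \<sigma> 0 1 e (A \<omega> $$ e)) x \<le> \<theta> / 2 * (\<Sum>i<n. (x i)\<^sup>2)" for x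
    proof -
      have "upper_form n (\<lambda>e. centered \<sigma> 0 1 e (A \<omega> $$ e)) x \<le> 22 * sqrt (n * v) * (\<Sum>i<n. (x i)\<^sup>2)"
      proof (rule quadratic_form_le_from_net[OF n, where G = UNIV and w = "\<lambda>e. centered \<sigma> 0 1 e (A \<omega> $$ e)"])
        show "0 \<le> 22 * sqrt (n * v)" using v0 by simp
        fix z assume "z \<in> int_net n"
        then show "(\<Sum>(i, j)\<in>upper_pairs n. centered \<sigma> 0 1 (i, j) (A \<omega> $$ (i, j)) * z i * z j) \<le> 22 * sqrt (n * v) * n"
          using E1(4)[OF \<omega>, of z] by (simp add: mult_ac)
      qed simp
      moreover have "4 * (22 * sqrt (n * v)) * (\<Sum>i<n. (x i)\<^sup>2) \<le> \<theta> * (\<Sum>i<n. (x i)\<^sup>2)"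
        by (intro mult_right_mono num1 sum_nonneg) auto
      moreover have "\<theta> / 2 * (\<Sum>i<n. (x i)\<^sup>2) = (\<theta> * (\<Sum>i<n. (x i)\<^sup>2)) / 2" by simp
      ultimately show ?thesis by linarith
    qed
    moreover have "8 * (\<Sum>i\<in>{..<n} - UNIV. 0) \<le> \<theta> / 8 * R" using \<theta>0 by (simp add: R_def)
    ultimately show "noise_bounded n (\<lambda>e. centered \<sigma> 0 1 e (A \<omega> $$ e)) \<theta> R"
      by (intro exI[of _ UNIV] exI[of _ "\<lambda>_. 0"]) simp
  qed (use E1 in auto)
  have mgf: "(\<integral>\<^sup>+\<omega>. ennreal (exp (- lam * (\<sigma> $ i * \<sigma> $ j * (A \<omega> $$ (i, j) - 0)))) \<partial>M) \<le> ennreal (exp (- z2_info \<tau>))"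
    if "i < j" "j < n" for i j
  proof -
    have ij: "i \<le> j" "i < n" using that by auto
    have "(\<integral>\<^sup>+\<omega>. ennreal (exp (- lam * (\<sigma> $ i * \<sigma> $ j * (A \<omega> $$ (i, j) - 0)))) \<partial>M)
        = (\<integral>\<^sup>+\<omega>. ennreal (exp ((- lam * (\<sigma> $ i * \<sigma> $ j)) * A \<omega> $$ (i, j))) \<partial>M)" by (simp add: mult.assoc)
    also have "\<dots> = ennreal (exp ((- lam * (\<sigma> $ i * \<sigma> $ j)) * (\<sigma> $ i * \<sigma> $ j) + (- lam * (\<sigma> $ i * \<sigma> $ j))\<^sup>2 * \<tau>\<^sup>2 / 2))"
      by (rule mgf_normal[OF dist[OF ij(1) that(2)] \<tau>])
    also have "(- lam * (\<sigma> $ i * \<sigma> $ j)) * (\<sigma> $ i * \<sigma> $ j) + (- lam * (\<sigma> $ i * \<sigma> $ j))\<^sup>2 * \<tau>\<^sup>2 / 2 = - lam + lam\<^sup>2 * \<tau>\<^sup>2 / 2"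
      unfolding mult.assoc[of "- lam" "\<sigma> $ i * \<sigma> $ j"] sq[OF ij(2) that(2)] power_mult_distrib[of "- lam"] sq'[OF ij(2) that(2)] by simp
    also have "\<dots> = - z2_info \<tau>" using \<tau> by (simp add: lam_def z2_info_def field_simps power2_eq_square)
    finally show ?thesis by simp
  qed
  have \<kappa>: "lam * \<theta> + (\<Sum>j\<in>{..<n} - {i}. - z2_info \<tau>) \<le> - a" if "i < n" for i
  proof -
    have "(\<Sum>j\<in>{..<n} - {i}. - z2_info \<tau>) = - (real n - 1) * z2_info \<tau>" using that n by (simp add: of_nat_diff algebra_simps)
    also have "\<dots> = - J + J / n" using nn by (simp add: J_def algebra_simps)
    finally show ?thesis by (simp add: lam\<theta> a_def)
  qed
  have aR: "32 * (n * exp (e * J / 8 - a)) \<le> R"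
  proof -
    have "J / n \<le> e * J / 32"
    proof -
      have "16 * 2 * J \<le> e * n * J" using L J2 by (intro mult_right_mono) auto
      then show ?thesis using nn by (simp add: field_simps)
    qed
    moreover have "ln 32 + 2 \<le> e * J / 16" using L by blast
    moreover have "- (1 - e / 2) * J = - J + e * J / 2" by (simp add: algebra_simps)
    moreover have "0 < e * J" using e J2 by simp
    ultimately have "ln 32 + (e * J / 8 - a) \<le> - (1 - e / 2) * J" unfolding a_def by linarith
    then have "exp (ln 32 + (e * J / 8 - a)) \<le> exp (- (1 - e / 2) * J)" by simp
    then have "32 * exp (e * J / 8 - a) \<le> exp (- (1 - e / 2) * J)" by (simp only: exp_add exp_ln[of 32] zero_less_numeral)
    then have "n * (32 * exp (e * J / 8 - a)) \<le> R" unfolding R_def by (intro mult_left_mono) auto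
    then show ?thesis by simp
  qed
  have \<theta>lam: "1 \<le> \<theta> * lam"
  proof -
    have "8 * 2\<^sup>2 \<le> e * J" using L by blast
    then show ?thesis using lam\<theta> by (simp add: mult.commute)
  qed
  have R0: "0 \<le> R" by (simp add: R_def)
  have "\<exists>E\<in>events. 1 - (exp (- real n) + exp (- (e * J / 8))) \<le> prob E \<and>
    (\<forall>\<omega>\<in>E. \<forall>Y\<in>sdp_sublevel sdp_feasible n \<sigma> (A \<omega>). 1 / real n * entrywise_l1_norm (Y - label_mat \<sigma>) \<le> of_int \<lfloor>R\<rfloor>)"
    by (rule common_recovery[where F = sdp_feasible and \<kappa> = "\<lambda>_ _. - z2_info \<tau>" and c = 0 and \<mu> = 1,
        OF rm \<sigma> n zero_le_one \<theta>0 lam0 \<theta>lam R0 _ spec mgf _ \<kappa> aR]) auto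
  then obtain E where E: "E \<in> events" "1 - (exp (- real n) + exp (- (e * J / 8))) \<le> prob E"
    "\<And>\<omega> Y. \<omega> \<in> E \<Longrightarrow> Y \<in> sdp_sublevel sdp_feasible n \<sigma> (A \<omega>) \<Longrightarrow> 1 / real n * entrywise_l1_norm (Y - label_mat \<sigma>) \<le> of_int \<lfloor>R\<rfloor>"
    by blast
  have "exp (- real n) + 2 / n \<le> e / 4" "exp (- (e * J / 8)) \<le> e / 4" using L by blast+
  moreover have "0 \<le> 2 / real n" by simp
  ultimately have "1 - e \<le> prob E" using E(2) e by linarith
  moreover have "accurate sdp_feasible n \<sigma> (A \<omega>) J e" if "\<omega> \<in> E" for \<omega>
    using E(3)[OF that] e J2 n \<sigma> L unfolding R_def by (intro accurateI) auto
  ultimately show ?thesis using E(1) unfolding J_def by blast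
qed

section \<open>Censored block model\<close>

text \<open>The sum of the ratios that the comparisons in \<open>sparse_recovery\<close> require.
  They depend on \<epsilon> only, because \<alpha> cancels in each of them.\<close>

definition cbm_const :: "real \<Rightarrow> real" where
  "cbm_const \<epsilon> = (let s = (sqrt (1 - \<epsilon>) - sqrt \<epsilon>)\<^sup>2; l = ln ((1 - \<epsilon>) / \<epsilon>) / 2; m = 1 - 2 * \<epsilon>
     in 1 + s / m\<^sup>2 + s / (l * m) + l * m / s)"

lemma cbm_const_bounds:
  assumes \<epsilon>: "0 < \<epsilon>" "\<epsilon> < 1 / 2"
  defines "s \<equiv> (sqrt (1 - \<epsilon>) - sqrt \<epsilon>)\<^sup>2" and "l \<equiv> ln ((1 - \<epsilon>) / \<epsilon>) / 2" and "m \<equiv> 1 - 2 * \<epsilon>"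
  shows "0 < s" "s \<le> 1" "0 < l" "0 < m" "m \<le> 1" "1 \<le> cbm_const \<epsilon>" "s \<le> cbm_const \<epsilon> * m\<^sup>2"
    "s \<le> cbm_const \<epsilon> * (l * m)" "l * m \<le> cbm_const \<epsilon> * s"
proof -
  have lt: "sqrt \<epsilon> < sqrt (1 - \<epsilon>)" using \<epsilon> by simp
  then show s0: "0 < s" unfolding s_def by simp
  have "s \<le> (sqrt (1 - \<epsilon>))\<^sup>2" unfolding s_def using lt \<epsilon> by (intro power_mono) auto
  then show "s \<le> 1" using \<epsilon> by simp
  show l0: "0 < l" unfolding l_def using \<epsilon> by (simp add: field_simps)
  show m0: "0 < m" and "m \<le> 1" unfolding m_def using \<epsilon> by auto
  define a b d where "a = s / m\<^sup>2" and "b = s / (l * m)" and "d = l * m / s"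
  have C: "cbm_const \<epsilon> = 1 + a + b + d"
    by (simp add: cbm_const_def Let_def a_def b_def d_def s_def l_def m_def)
  have pos: "0 \<le> a" "0 \<le> b" "0 \<le> d" using s0 l0 m0 by (auto simp: a_def b_def d_def)
  then show "1 \<le> cbm_const \<epsilon>" by (simp add: C)
  have "s = a * m\<^sup>2" using m0 by (simp add: a_def)
  also have "\<dots> \<le> cbm_const \<epsilon> * m\<^sup>2" unfolding C using pos by (intro mult_right_mono) auto
  finally show "s \<le> cbm_const \<epsilon> * m\<^sup>2" .
  have "s = b * (l * m)" using m0 l0 by (simp add: b_def)
  also have "\<dots> \<le> cbm_const \<epsilon> * (l * m)" unfolding C using pos m0 l0 by (intro mult_right_mono) auto
  finally show "s \<le> cbm_const \<epsilon> * (l * m)" .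
  have "l * m = d * s" using s0 by (simp add: d_def)
  also have "\<dots> \<le> cbm_const \<epsilon> * s" unfolding C using pos s0 by (intro mult_right_mono) auto
  finally show "l * m \<le> cbm_const \<epsilon> * s" .
qed

text \<open>With \<open>l\<close> half the log-likelihood ratio, an entry has moment exactly 1 - I,
  hence at most exp (- I). The row has n - 1 entries, which costs J / n.\<close>

lemma cbm_accurate:
  fixes A :: "'w \<Rightarrow> real Matrix.mat"
  assumes model: "censored_block_model M n \<sigma> \<alpha> \<epsilon> A" and e: "0 < e" "e < 1"
    and large: "large_enough (cbm_const \<epsilon>) e n (real n * cbm_info \<alpha> \<epsilon>)"
  shows "\<exists>E\<in>sets M. 1 - e \<le> measure M E \<and> (\<forall>\<omega>\<in>E. accurate sdp_feasible n \<sigma> (A \<omega>) (real n * cbm_info \<alpha> \<epsilon>) e)"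
proof -
  have \<sigma>: "label_vec n \<sigma>" and \<alpha>: "0 < \<alpha>" "\<alpha> \<le> 1" and \<epsilon>: "0 < \<epsilon>" "\<epsilon> < 1 / 2" and rm: "symmetric_random_mat M n A"
    and P: "\<And>i j. i \<le> j \<Longrightarrow> j < n \<Longrightarrow> measure M {\<omega> \<in> space M. A \<omega> $$ (i, j) = \<sigma> $ i * \<sigma> $ j} = \<alpha> * (1 - \<epsilon>)"
      "\<And>i j. i \<le> j \<Longrightarrow> j < n \<Longrightarrow> measure M {\<omega> \<in> space M. A \<omega> $$ (i, j) = - (\<sigma> $ i * \<sigma> $ j)} = \<alpha> * \<epsilon>"
      "\<And>i j. i \<le> j \<Longrightarrow> j < n \<Longrightarrow> measure M {\<omega> \<in> space M. A \<omega> $$ (i, j) = 0} = 1 - \<alpha>"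
    using model by (auto simp: censored_block_model_def)
  interpret prob_space M using rm by (simp add: symmetric_random_mat_def)
  define s where "s = (sqrt (1 - \<epsilon>) - sqrt \<epsilon>)\<^sup>2"
  define l where "l = ln ((1 - \<epsilon>) / \<epsilon>) / 2"
  define m where "m = 1 - 2 * \<epsilon>"
  define \<mu> where "\<mu> = \<alpha> * m"
  define C where "C = cbm_const \<epsilon>"
  note cb = cbm_const_bounds[OF \<epsilon>, folded s_def l_def m_def C_def]
  define J where "J = real n * cbm_info \<alpha> \<epsilon>"
  have info: "cbm_info \<alpha> \<epsilon> = \<alpha> * s"
  proof -
    have "cbm_info \<alpha> \<epsilon> = (sqrt \<alpha> * (sqrt (1 - \<epsilon>) - sqrt \<epsilon>))\<^sup>2"
      unfolding cbm_info_def real_sqrt_mult by (simp only: right_diff_distrib)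
    then show ?thesis using \<alpha> by (simp add: power_mult_distrib s_def)
  qed
  have Js: "J = n * (\<alpha> * s)" by (simp add: J_def info)
  note L = large[folded J_def C_def]
  have n: "0 < n" and nn: "0 < real n" using L by (auto simp: large_enough_def)
  have J0: "0 \<le> J" using \<alpha> cb by (simp add: Js)
  have \<mu>0: "0 < \<mu>" and \<mu>\<alpha>: "\<mu> \<le> \<alpha>" using \<alpha> cb by (auto simp: \<mu>_def)
  have dist: "finite V" "(\<Sum>v\<in>V. f v * prob {\<omega> \<in> space M. A \<omega> $$ (i, j) = v}) =
      f t * (\<alpha> * (1 - \<epsilon>)) + f (- t) * (\<alpha> * \<epsilon>) + f 0 * (1 - \<alpha>)"
    if "i < j" "j < n" "t = \<sigma> $ i * \<sigma> $ j" "V = {t, - t, 0}" for i j t V and f :: "real \<Rightarrow> real"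
  proof -
    have "t = 1 \<or> t = - 1" using label_vec_cases[OF \<sigma>, of i j] that by auto
    then have ne: "t \<noteq> - t" "t \<noteq> 0" by auto
    show "(\<Sum>v\<in>V. f v * prob {\<omega> \<in> space M. A \<omega> $$ (i, j) = v}) =
      f t * (\<alpha> * (1 - \<epsilon>)) + f (- t) * (\<alpha> * \<epsilon>) + f 0 * (1 - \<alpha>)"
      using ne P[of i j] that(1,2) unfolding that(4) by (simp add: that(3))
  qed (use that in auto)
  have total: "(\<Sum>v\<in>V. prob {\<omega> \<in> space M. A \<omega> $$ (i, j) = v}) = 1"
    if "i < j" "j < n" "t = \<sigma> $ i * \<sigma> $ j" "V = {t, - t, 0}" for i j t V
    using dist(2)[OF that, of "\<lambda>_. 1"] by (simp add: algebra_simps)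
  have t1: "\<sigma> $ i * \<sigma> $ j = 1 \<or> \<sigma> $ i * \<sigma> $ j = - 1" if "i < j" "j < n" for i j
    using label_vec_cases[OF \<sigma>, of i j] that by auto
  have "\<exists>E\<in>events. 1 - e \<le> prob E \<and> (\<forall>\<omega>\<in>E. accurate sdp_feasible n \<sigma> (A \<omega>) J e)"
  proof (rule sparse_recovery[where C = C and \<mu> = \<mu> and lam = l and p = \<alpha> and c = 0 and \<kappa> = "\<lambda>_ _. - cbm_info \<alpha> \<epsilon>",
        OF rm \<sigma> cb(6) e L \<mu>0 cb(3) \<alpha>(1)])
    show "J \<le> C * (n * \<alpha>)"
    proof -
      have "(n * \<alpha>) * s \<le> (n * \<alpha>) * C" using \<alpha> cb by (intro mult_left_mono) auto
      then show ?thesis by (simp add: Js mult_ac)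
    qed
    show "J * \<alpha> \<le> C * (n * \<mu>\<^sup>2)"
    proof -
      have "(n * \<alpha>\<^sup>2) * s \<le> (n * \<alpha>\<^sup>2) * (C * m\<^sup>2)" using cb by (intro mult_left_mono) auto
      then show ?thesis by (simp add: Js \<mu>_def power2_eq_square mult_ac)
    qed
    show "J \<le> C * (l * \<mu> * n)"
    proof -
      have "(n * \<alpha>) * s \<le> (n * \<alpha>) * (C * (l * m))" using \<alpha> cb by (intro mult_left_mono) auto
      then show ?thesis by (simp add: Js \<mu>_def mult_ac)
    qed
    show "l * \<mu> * n \<le> C * J"
    proof -
      have "(n * \<alpha>) * (l * m) \<le> (n * \<alpha>) * (C * s)" using \<alpha> cb by (intro mult_left_mono) auto
      then show ?thesis by (simp add: Js \<mu>_def mult_ac)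
    qed
    fix i j assume ij: "i < j" "j < n"
    define t where "t = \<sigma> $ i * \<sigma> $ j"
    define V where "V = {t, - t, 0}"
    note D = dist[OF ij t_def V_def] and T = total[OF ij t_def V_def]
    have X: "(\<lambda>\<omega>. A \<omega> $$ (i, j)) \<in> borel_measurable M" using entry_measurable[OF rm, of i j] ij by simp
    have tt: "t * t = 1" "t = 1 \<or> t = - 1" using t1[OF ij] by (auto simp: t_def)
    have w: "centered \<sigma> 0 \<mu> (i, j) t = 1 - \<mu>" "centered \<sigma> 0 \<mu> (i, j) (- t) = - 1 - \<mu>" "centered \<sigma> 0 \<mu> (i, j) 0 = - \<mu>"
      using tt(1) by (simp_all add: centered_def t_def[symmetric])
    show "(\<integral>\<^sup>+\<omega>. ennreal (exp (r * centered \<sigma> 0 \<mu> (i, j) (A \<omega> $$ (i, j)))) \<partial>M) \<le> ennreal (exp (r\<^sup>2 * \<alpha>))"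
      if r: "\<bar>r\<bar> \<le> 1 / 2" for r
    proof (rule discrete_mgf_le[OF X D(1) T _ _ _ r])
      show "\<bar>centered \<sigma> 0 \<mu> (i, j) v\<bar> \<le> 2" if "v \<in> V" for v
        using that \<mu>0 \<mu>\<alpha> \<alpha> unfolding V_def by (auto simp: w)
      show "(\<Sum>v\<in>V. centered \<sigma> 0 \<mu> (i, j) v * prob {\<omega> \<in> space M. A \<omega> $$ (i, j) = v}) = 0"
        unfolding D(2) w by (simp add: \<mu>_def m_def algebra_simps)
      \<comment> \<open>The variance of the gauged entry: second moment \<alpha> minus squared
        mean.\<close>
      have "(1 - \<mu>)\<^sup>2 * (\<alpha> * (1 - \<epsilon>)) + (- 1 - \<mu>)\<^sup>2 * (\<alpha> * \<epsilon>) + (- \<mu>)\<^sup>2 * (1 - \<alpha>) = \<alpha> - \<mu>\<^sup>2"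
        by (simp add: \<mu>_def m_def power2_eq_square algebra_simps)
      then show "(\<Sum>v\<in>V. (centered \<sigma> 0 \<mu> (i, j) v)\<^sup>2 * prob {\<omega> \<in> space M. A \<omega> $$ (i, j) = v}) \<le> \<alpha>"
        unfolding D(2) w by simp
    qed
    show "prob {\<omega> \<in> space M. A \<omega> $$ (i, j) \<noteq> 0} \<le> \<alpha>"
    proof -
      have "{\<omega> \<in> space M. A \<omega> $$ (i, j) = 0} \<in> events" using X by measurable
      moreover have "{\<omega> \<in> space M. A \<omega> $$ (i, j) \<noteq> 0} = space M - {\<omega> \<in> space M. A \<omega> $$ (i, j) = 0}" by auto
      ultimately show ?thesis using P(3)[of i j] ij by (simp add: prob_compl)
    qed
    show "prob {\<omega> \<in> space M. \<bar>centered \<sigma> 0 \<mu> (i, j) (A \<omega> $$ (i, j))\<bar> \<le> of_bool (A \<omega> $$ (i, j) \<noteq> 0) + \<alpha>} = 1"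
    proof (rule prob_eq_1_discrete[OF X D(1) T])
      show "\<bar>centered \<sigma> 0 \<mu> (i, j) v\<bar> \<le> of_bool (v \<noteq> 0) + \<alpha>" if "v \<in> V" for v
      proof -
        have tn: "t \<noteq> 0" using tt by auto
        have "v = t \<or> v = - t \<or> v = 0" using that by (simp add: V_def)
        then show ?thesis
        proof (elim disjE)
          assume "v = t"
          then show ?thesis using w(1) tn \<mu>0 \<mu>\<alpha> \<alpha> by simp
        next
          assume "v = - t"
          then show ?thesis using w(2) tn \<mu>0 \<mu>\<alpha> \<alpha> by simp
        next
          assume "v = 0"
          then show ?thesis using w(3) \<mu>0 \<mu>\<alpha> by simp
        qed
      qed
      show "{\<omega> \<in> space M. \<bar>centered \<sigma> 0 \<mu> (i, j) (A \<omega> $$ (i, j))\<bar> \<le> of_bool (A \<omega> $$ (i, j) \<noteq> 0) + \<alpha>} \<in> events"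
        using X by measurable
    qed
    show "(\<integral>\<^sup>+\<omega>. ennreal (exp (- l * (\<sigma> $ i * \<sigma> $ j * (A \<omega> $$ (i, j) - 0)))) \<partial>M) \<le> ennreal (exp (- cbm_info \<alpha> \<epsilon>))"
    proof -
      \<comment> \<open>u = exp l balances the two nonzero outcomes: both contribute \<alpha> * sqrt
        (\<epsilon> * (1 - \<epsilon>)).\<close>
      define u where "u = sqrt ((1 - \<epsilon>) / \<epsilon>)"
      have u0: "0 < u" using \<epsilon> by (simp add: u_def)
      have q: "(1 - \<epsilon>) / u = sqrt \<epsilon> * sqrt (1 - \<epsilon>)" "\<epsilon> * u = sqrt \<epsilon> * sqrt (1 - \<epsilon>)"
      proof -
        have gen: "(a * a) / (a / b) = b * a" "(b * b) * (a / b) = b * a" if "0 < a" "0 < b" for a b :: real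
          using that by (simp_all add: field_simps)
        have "u = sqrt (1 - \<epsilon>) / sqrt \<epsilon>" by (simp add: u_def real_sqrt_divide)
        then show "(1 - \<epsilon>) / u = sqrt \<epsilon> * sqrt (1 - \<epsilon>)" "\<epsilon> * u = sqrt \<epsilon> * sqrt (1 - \<epsilon>)"
          using gen[of "sqrt (1 - \<epsilon>)" "sqrt \<epsilon>"] \<epsilon> real_sqrt_mult_self[of "1 - \<epsilon>"] real_sqrt_mult_self[of \<epsilon>]
          by (simp_all only: abs_of_nonneg less_imp_le real_sqrt_gt_zero diff_gt_0_iff_gt)
      qed
      have eu: "exp l = u" unfolding l_def u_def using \<epsilon> by (simp add: ln_sqrt[symmetric])
      have "(\<integral>\<^sup>+\<omega>. ennreal (exp (- l * (t * (A \<omega> $$ (i, j) - 0)))) \<partial>M)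
         = ennreal (\<Sum>v\<in>V. exp (- l * (t * (v - 0))) * prob {\<omega> \<in> space M. A \<omega> $$ (i, j) = v})"
        by (rule nn_integral_discrete[OF X D(1) T]) simp
      also have "(\<Sum>v\<in>V. exp (- l * (t * (v - 0))) * prob {\<omega> \<in> space M. A \<omega> $$ (i, j) = v}) =
          \<alpha> * ((1 - \<epsilon>) / u) + \<alpha> * (\<epsilon> * u) + (1 - \<alpha>)"
        unfolding D(2) using tt(1) by (simp add: exp_minus eu divide_inverse)
      also have "(1 - \<epsilon>) / u = sqrt \<epsilon> * sqrt (1 - \<epsilon>)" by (rule q(1))
      also have "\<epsilon> * u = sqrt \<epsilon> * sqrt (1 - \<epsilon>)" by (rule q(2))
      also have "\<alpha> * (sqrt \<epsilon> * sqrt (1 - \<epsilon>)) + \<alpha> * (sqrt \<epsilon> * sqrt (1 - \<epsilon>)) + (1 - \<alpha>) = 1 + - cbm_info \<alpha> \<epsilon>"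
        unfolding info s_def power2_diff using \<epsilon> by (simp add: algebra_simps)
      also have "1 + - cbm_info \<alpha> \<epsilon> \<le> exp (- cbm_info \<alpha> \<epsilon>)" by (rule exp_ge_add_one_self)
      finally show ?thesis by (simp add: t_def ennreal_leI)
    qed
  next
    fix i assume "i < n"
    then have "(\<Sum>j\<in>{..<n} - {i}. - cbm_info \<alpha> \<epsilon>) = - J + J / n"
      using nn by (simp add: J_def of_nat_diff algebra_simps)
    also have "\<dots> \<le> - J + C * (J / n + 1)"
    proof -
      have "1 * (J / n) \<le> C * (J / n)" using cb(6) J0 by (intro mult_right_mono) auto
      then show ?thesis using cb(6) by (simp add: algebra_simps)
    qed
    finally show "(\<Sum>j\<in>{..<n} - {i}. - cbm_info \<alpha> \<epsilon>) \<le> - J + C * (J / n + 1)" .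
  qed auto
  then show ?thesis by (simp add: J_def)
qed

section \<open>Stochastic block model\<close>

text \<open>The logarithm pays for the missing diagonal entry of a row, and the other two terms for
  the upper bounds on the information and on the Chernoff exponent.\<close>

definition sbm_const :: "real \<Rightarrow> real \<Rightarrow> real" where
  "sbm_const c\<^sub>0 c\<^sub>1 = 1 + ln (1 / c\<^sub>1) + 2 * ((1 + 1 / c\<^sub>1) / c\<^sub>1) + 2 * (1 / c\<^sub>0 + 1 / c\<^sub>1)"

text \<open>\<open>h\<close> is the order of magnitude of the information, and \<open>l\<close> the optimal Chernoff exponent.\<close>

lemma sbm_info_bounds:
  fixes p q :: real
  assumes c: "0 < c\<^sub>0" "c\<^sub>0 < 1" "0 < c\<^sub>1" "c\<^sub>1 < 1" and pq: "c\<^sub>0 * p \<le> q" "q < p" "p \<le> 1 - c\<^sub>1" and p0: "0 < p"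
  defines "h \<equiv> (p - q)\<^sup>2 / p" and "l \<equiv> ln (p * (1 - q) / (q * (1 - p))) / 2"
  shows "h / 4 \<le> sbm_info p q" "sbm_info p q \<le> (1 + 1 / c\<^sub>1) / c\<^sub>1 * h"
    "(p - q) / (2 * p) \<le> l" "l \<le> (1 / c\<^sub>0 + 1 / c\<^sub>1) / 2 * ((p - q) / p)" "0 < l"
proof -
  have q0: "0 < q" using c p0 pq(1) by (meson less_le_trans mult_pos_pos)
  have p1: "p < 1" "c\<^sub>1 \<le> 1 - p" using pq c by auto
  have q1: "q < 1" "c\<^sub>1 \<le> 1 - q" using pq p1 by auto
  \<comment> \<open>The Bhattacharyya coefficient of the two Bernoulli laws, bounded away from 0 by
    \<open>c\<^sub>1\<close>.\<close>
  define x where "x = sqrt (p * q) + sqrt ((1 - p) * (1 - q))"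
  have xc: "c\<^sub>1 \<le> x"
  proof -
    have "c\<^sub>1 * c\<^sub>1 \<le> (1 - p) * (1 - q)" using c p1 q1 by (intro mult_mono) auto
    then have "sqrt (c\<^sub>1 * c\<^sub>1) \<le> sqrt ((1 - p) * (1 - q))" by (rule real_sqrt_le_mono)
    then have "c\<^sub>1 \<le> sqrt ((1 - p) * (1 - q))" using c by simp
    moreover have "0 \<le> sqrt (p * q)" using p0 q0 by simp
    ultimately show ?thesis unfolding x_def by linarith
  qed
  then have x0: "0 < x" using c by linarith
  have info: "sbm_info p q = - 2 * ln x" by (simp add: sbm_info_def x_def)
  have diff_sqrt: "(sqrt a - sqrt b)\<^sup>2 = (a - b)\<^sup>2 / (sqrt a + sqrt b)\<^sup>2" if "0 < a" "0 < b" for a b :: real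
  proof -
    have s: "0 < sqrt a + sqrt b" using that by (intro add_pos_pos) auto
    have "(sqrt a - sqrt b) * (sqrt a + sqrt b) = a - b"
      using that by (simp add: algebra_simps)
    then have "sqrt a - sqrt b = (a - b) / (sqrt a + sqrt b)" using s by (simp add: eq_divide_eq)
    then show ?thesis by (simp add: power_divide)
  qed
  have sq_le: "(sqrt a - sqrt b)\<^sup>2 \<le> (a - b)\<^sup>2 / a" if "0 < a" "0 < b" for a b :: real
  proof -
    have "(sqrt a)\<^sup>2 \<le> (sqrt a + sqrt b)\<^sup>2" using that by (intro power_mono) auto
    then have "a \<le> (sqrt a + sqrt b)\<^sup>2" using that by simp
    moreover have "0 < sqrt a + sqrt b" using that by (intro add_pos_pos) auto
    ultimately show ?thesis unfolding diff_sqrt[OF that] using that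
      by (intro divide_left_mono mult_pos_pos zero_less_power) auto
  qed
  \<comment> \<open>The squared Hellinger distance, which is comparable to the information because
    \<open>x\<close> is bounded below.\<close>
  have split: "2 * (1 - x) = (sqrt p - sqrt q)\<^sup>2 + (sqrt (1 - q) - sqrt (1 - p))\<^sup>2"
    using p0 q0 p1 q1 by (simp add: x_def power2_diff real_sqrt_mult)
  show "h / 4 \<le> sbm_info p q"
  proof -
    have "h / 4 \<le> (sqrt p - sqrt q)\<^sup>2"
    proof -
      have "(sqrt p + sqrt q)\<^sup>2 \<le> (2 * sqrt p)\<^sup>2" using p0 q0 pq by (intro power_mono) auto
      also have "\<dots> = 4 * p" using p0 by (simp add: power_mult_distrib)
      finally have "(p - q)\<^sup>2 / (4 * p) \<le> (p - q)\<^sup>2 / (sqrt p + sqrt q)\<^sup>2"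
        using p0 q0 by (intro divide_left_mono) (auto intro!: mult_pos_pos zero_less_power add_pos_pos)
      then show ?thesis unfolding diff_sqrt[OF p0 q0] by (simp add: h_def mult.commute)
    qed
    also have "\<dots> \<le> 2 * (1 - x)" unfolding split by simp
    also have "\<dots> \<le> - 2 * ln x" using ln_le_minus_one[OF x0] by simp
    finally show ?thesis by (simp add: info)
  qed
  show "sbm_info p q \<le> (1 + 1 / c\<^sub>1) / c\<^sub>1 * h"
  proof -
    have h0: "0 \<le> h" using p0 by (simp add: h_def)
    have "- ln x = ln (1 / x)" using x0 by (simp add: ln_div)
    also have "\<dots> \<le> 1 / x - 1" using x0 by (intro ln_le_minus_one) auto
    also have "\<dots> = (1 - x) / x" using x0 by (simp add: diff_divide_distrib)
    finally have "- 2 * ln x \<le> 2 * ((1 - x) / x)" by linarith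
    then have "sbm_info p q \<le> 2 * (1 - x) / x" unfolding info by simp
    also have "\<dots> \<le> ((1 + 1 / c\<^sub>1) * h) / x"
    proof (rule divide_right_mono)
      have "(sqrt (1 - q) - sqrt (1 - p))\<^sup>2 \<le> (p - q)\<^sup>2 / (1 - q)"
        using sq_le[of "1 - q" "1 - p"] p1 q1 by simp
      also have "\<dots> \<le> (p - q)\<^sup>2 / c\<^sub>1" using c q1 by (intro divide_left_mono) auto
      also have "\<dots> = p * h / c\<^sub>1" using p0 by (simp add: h_def)
      also have "\<dots> \<le> 1 * h / c\<^sub>1" using p1 h0 c by (intro divide_right_mono mult_right_mono) auto
      finally have "(sqrt (1 - q) - sqrt (1 - p))\<^sup>2 \<le> h / c\<^sub>1" by simp
      moreover have "(sqrt p - sqrt q)\<^sup>2 \<le> h" unfolding h_def by (rule sq_le[OF p0 q0])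
      ultimately show "2 * (1 - x) \<le> (1 + 1 / c\<^sub>1) * h" unfolding split by (simp add: algebra_simps)
    qed (use x0 in simp)
    also have "\<dots> \<le> ((1 + 1 / c\<^sub>1) * h) / c\<^sub>1" using xc x0 c h0 by (intro divide_left_mono) auto
    finally show ?thesis by simp
  qed
  define X where "X = ln (p / q)"
  define Y where "Y = ln ((1 - q) / (1 - p))"
  define d where "d = (p - q) / p"
  have l: "l = (X + Y) / 2"
    unfolding l_def X_def Y_def using p0 q0 p1 q1 by (simp add: ln_mult ln_div)
  have Y0: "0 \<le> Y" unfolding Y_def using p1 q1 pq by (intro ln_ge_zero) (simp add: field_simps)
  have d: "d = 1 - q / p" using p0 by (simp add: d_def field_simps)
  have "d \<le> X"
    unfolding d X_def using ln_le_minus_one[of "q / p"] p0 q0 by (simp add: ln_div)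
  then have "d \<le> X + Y" using Y0 by (rule add_increasing2[rotated])
  then have "d / 2 \<le> l" unfolding l by (rule divide_right_mono) simp
  then show low: "(p - q) / (2 * p) \<le> l" by (simp add: d_def)
  have "0 < (p - q) / (2 * p)" using p0 pq by simp
  then show "0 < l" using low by linarith
  have "X \<le> p / q - 1" unfolding X_def using p0 q0 by (intro ln_le_minus_one) auto
  also have "\<dots> = (p - q) / q" using q0 by (simp add: field_simps)
  also have "\<dots> \<le> (p - q) / (c\<^sub>0 * p)" using pq c p0 q0 by (intro divide_left_mono) auto
  finally have X: "X \<le> 1 / c\<^sub>0 * d" by (simp add: d_def)
  have "Y \<le> (1 - q) / (1 - p) - 1" unfolding Y_def using p1 q1 by (intro ln_le_minus_one) auto
  also have "\<dots> = (p - q) / (1 - p)" using p1 by (simp add: field_simps)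
  also have "\<dots> \<le> (p - q) / (c\<^sub>1 * p)"
  proof (rule divide_left_mono)
    have "c\<^sub>1 * p \<le> c\<^sub>1 * 1" using c p1 by (intro mult_left_mono) auto
    then show "c\<^sub>1 * p \<le> 1 - p" using p1 by simp
  qed (use pq p0 p1 c in auto)
  finally have "Y \<le> 1 / c\<^sub>1 * d" by (simp add: d_def)
  with X have "(X + Y) / 2 \<le> (1 / c\<^sub>0 * d + 1 / c\<^sub>1 * d) / 2" by (intro divide_right_mono add_mono) auto
  also have "\<dots> = (1 / c\<^sub>0 + 1 / c\<^sub>1) / 2 * d" by (simp add: distrib_right)
  finally show "l \<le> (1 / c\<^sub>0 + 1 / c\<^sub>1) / 2 * ((p - q) / p)" unfolding l d_def .
qed

lemma sbm_const_bounds: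
  assumes c: "0 < c\<^sub>0" "0 < c\<^sub>1" "c\<^sub>1 < 1"
  shows "1 \<le> sbm_const c\<^sub>0 c\<^sub>1" "2 * ((1 + 1 / c\<^sub>1) / c\<^sub>1) \<le> sbm_const c\<^sub>0 c\<^sub>1"
    "2 * (1 / c\<^sub>0 + 1 / c\<^sub>1) \<le> sbm_const c\<^sub>0 c\<^sub>1" "ln (1 / c\<^sub>1) \<le> sbm_const c\<^sub>0 c\<^sub>1"
proof -
  define k1 where "k1 = (1 + 1 / c\<^sub>1) / c\<^sub>1"
  define k2 where "k2 = 1 / c\<^sub>0 + 1 / c\<^sub>1"
  have lnc: "0 \<le> ln (1 / c\<^sub>1)" using c by (intro ln_ge_zero) simp
  have k: "0 < k1" "0 < k2" using c by (auto simp: k1_def k2_def intro!: divide_pos_pos add_pos_pos)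
  show "1 \<le> sbm_const c\<^sub>0 c\<^sub>1" "2 * ((1 + 1 / c\<^sub>1) / c\<^sub>1) \<le> sbm_const c\<^sub>0 c\<^sub>1"
    "2 * (1 / c\<^sub>0 + 1 / c\<^sub>1) \<le> sbm_const c\<^sub>0 c\<^sub>1" "ln (1 / c\<^sub>1) \<le> sbm_const c\<^sub>0 c\<^sub>1"
    using lnc k unfolding sbm_const_def k1_def[symmetric] k2_def[symmetric] by auto
qed

text \<open>Subtracting the midpoint m = (p + q) / 2 gives all gauged entries the same mean \<mu>.
  The moments within and across the communities still differ; only their product is exp (- I), and
  the balance of the labels pairs them up, which produces the effective size n / 2.\<close>

lemma sbm_accurate:
  fixes A :: "'w \<Rightarrow> real Matrix.mat"
  assumes c: "0 < c\<^sub>0" "c\<^sub>0 < 1" "0 < c\<^sub>1" "c\<^sub>1 < 1"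
    and model: "stochastic_block_model M n \<sigma> p q A" and cq: "c\<^sub>0 * p \<le> q" and pc: "p \<le> 1 - c\<^sub>1"
    and e: "0 < e" "e < 1"
    and large: "large_enough (sbm_const c\<^sub>0 c\<^sub>1) e n (real n / 2 * sbm_info p q)"
  shows "\<exists>E\<in>sets M. 1 - e \<le> measure M E \<and>
    (\<forall>\<omega>\<in>E. accurate balanced_sdp_feasible n \<sigma> (A \<omega>) (real n / 2 * sbm_info p q) e)"
proof -
  have \<sigma>: "label_vec n \<sigma>" and bal: "(\<Sum>i<n. \<sigma> $ i) = 0" and q0: "0 < q" and qp: "q < p" and p1: "p < 1"
    and rm: "symmetric_random_mat M n A"
    using model by (auto simp: stochastic_block_model_def)
  have p0: "0 < p" using q0 qp by simp
  interpret prob_space M using rm by (simp add: symmetric_random_mat_def)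
  define C where "C = sbm_const c\<^sub>0 c\<^sub>1"
  define h where "h = (p - q)\<^sup>2 / p"
  define l where "l = ln (p * (1 - q) / (q * (1 - p))) / 2"
  define m where "m = (p + q) / 2"
  define \<mu> where "\<mu> = (p - q) / 2"
  define I where "I = sbm_info p q"
  define J where "J = real n / 2 * I"
  note b = sbm_info_bounds[OF c cq qp pc p0, folded h_def l_def I_def]
  note L = large[folded I_def, folded J_def C_def]
  have n: "0 < n" and nn: "0 < real n" using L by (auto simp: large_enough_def)
  have h0: "0 < h" using qp p0 by (simp add: h_def)
  have I0: "0 < I" using b(1) h0 by linarith
  have J0: "0 < J" using I0 nn by (simp add: J_def)
  define k1 where "k1 = (1 + 1 / c\<^sub>1) / c\<^sub>1"
  define k2 where "k2 = 1 / c\<^sub>0 + 1 / c\<^sub>1"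
  have k: "0 < k1" "0 < k2" using c by (auto simp: k1_def k2_def intro!: divide_pos_pos add_pos_pos)
  note C = sbm_const_bounds[OF c(1,3,4), folded C_def k1_def k2_def]
  have \<mu>0: "0 < \<mu>" using qp by (simp add: \<mu>_def)
  have Jh: "J \<le> n / 2 * (k1 * h)" unfolding J_def using b(2) by (intro mult_left_mono) (auto simp: k1_def)
  have hp: "h \<le> p"
  proof -
    have "(p - q)\<^sup>2 \<le> p\<^sup>2" using q0 qp by (intro power_mono) auto
    then show ?thesis using p0 by (simp add: h_def power2_eq_square field_simps)
  qed
  define f1 where "f1 = exp (l * m) * (p * exp (- l) + (1 - p))"
  define f2 where "f2 = exp (- (l * m)) * (q * exp l + (1 - q))"
  have f1c: "c\<^sub>1 \<le> f1"
  proof -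
    have "1 * (1 - p) \<le> exp (l * m) * (p * exp (- l) + (1 - p))"
      using b(5) p0 q0 p1 by (intro mult_mono) (auto simp: m_def)
    then show ?thesis using pc by (simp add: f1_def)
  qed
  have f1: "0 < f1" using f1c c by linarith
  have f2: "0 < f2" using q0 qp p1 by (auto simp: f2_def intro!: mult_pos_pos add_pos_pos)
  \<comment> \<open>The shifts by \<open>m\<close> cancel. At the optimal \<open>l\<close> both
    mixed terms equal r * t, so the product is the square of the Bhattacharyya coefficient.\<close>
  have ff: "f1 * f2 = exp (- I)"
  proof -
    define r where "r = sqrt (p * q)"
    define t where "t = sqrt ((1 - p) * (1 - q))"
    have q1: "q < 1" using qp p1 by simp
    have r: "0 < r" "r * r = p * q" using p0 q0 by (auto simp: r_def)
    have t: "0 < t" "t * t = (1 - p) * (1 - q)" using p1 q1 by (auto simp: t_def)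
    define u where "u = exp l"
    have u0: "0 < u" by (simp add: u_def)
    have uu: "u * u = p * (1 - q) / (q * (1 - p))"
    proof -
      have "u * u = exp (ln (p * (1 - q) / (q * (1 - p))))" by (simp add: u_def exp_add[symmetric] l_def)
      then show ?thesis using p0 q0 p1 q1 by simp
    qed
    have ut: "u * (q * (1 - p)) = r * t"
    proof (rule power2_eq_imp_eq)
      have "(u * (q * (1 - p)))\<^sup>2 = (u * u) * (q * (1 - p)) * (q * (1 - p))" by (simp add: power2_eq_square)
      also have "\<dots> = p * (1 - q) * (q * (1 - p))" unfolding uu using q0 p1 by simp
      also have "\<dots> = (r * r) * (t * t)" unfolding r t by simp
      finally show "(u * (q * (1 - p)))\<^sup>2 = (r * t)\<^sup>2" by (simp add: power2_eq_square mult_ac)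
    qed (use u0 q0 p1 r t in auto)
    have ut': "p * (1 - q) / u = r * t"
    proof -
      have "p * (1 - q) = (u * u) * (q * (1 - p))" unfolding uu using q0 p1 by simp
      then have "p * (1 - q) / u = u * (q * (1 - p))" using u0 by simp
      then show ?thesis using ut by simp
    qed
    have "f1 * f2 = (p / u + (1 - p)) * (q * u + (1 - q))"
      by (simp add: f1_def f2_def u_def exp_minus divide_inverse)
    also have "\<dots> = p * q + p * (1 - q) / u + u * (q * (1 - p)) + (1 - p) * (1 - q)"
      using u0 by (simp add: field_simps)
    also have "\<dots> = (r + t)\<^sup>2" unfolding ut ut' r(2)[symmetric] t(2)[symmetric] by (simp add: power2_eq_square algebra_simps)
    also have "\<dots> = exp (ln (r + t) + ln (r + t))" 
    proof -
      have "0 < r + t" using r t by simp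
      then show ?thesis unfolding exp_add by (simp add: power2_eq_square)
    qed
    also have "ln (r + t) + ln (r + t) = - I" by (simp add: I_def sbm_info_def r_def t_def)
    finally show ?thesis .
  qed
  have lnff: "ln f1 + ln f2 = - I" 
  proof -
    have "ln (f1 * f2) = ln f1 + ln f2" using f1 f2 by (simp add: ln_mult)
    then show ?thesis unfolding ff by simp
  qed
  \<comment> \<open>The affine function of the label product with value ln f1 at 1 and ln f2 at -1;
    its linear part sums to 0 over a full row.\<close>
  define \<kappa> where "\<kappa> i j = (ln f1 + ln f2) / 2 + (ln f1 - ln f2) / 2 * (\<sigma> $ i * \<sigma> $ j)" for i j
  have r1: "\<sigma> $ i * \<sigma> $ j = 1 \<or> \<sigma> $ i * \<sigma> $ j = - 1" if "i < j" "j < n" for i j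
    using label_vec_cases[OF \<sigma>, of i j] that by auto
  have P: "prob {\<omega> \<in> space M. A \<omega> $$ (i, j) = 1} = (if \<sigma> $ i * \<sigma> $ j = 1 then p else q)"
    "prob {\<omega> \<in> space M. A \<omega> $$ (i, j) = 0} = 1 - (if \<sigma> $ i * \<sigma> $ j = 1 then p else q)"
    if "i < j" "j < n" for i j
    using model that unfolding stochastic_block_model_def Let_def by auto
  have "\<exists>E\<in>events. 1 - e \<le> prob E \<and> (\<forall>\<omega>\<in>E. accurate balanced_sdp_feasible n \<sigma> (A \<omega>) J e)"
  proof (rule sparse_recovery[where C = C and \<mu> = \<mu> and lam = l and p = p and c = m and \<kappa> = \<kappa>,
        OF rm \<sigma> C(1) e L \<mu>0 b(5) p0])
    show "Y \<in> sdp_feasible n \<and> (m = 0 \<or> (\<Sum>i<n. \<Sum>j<n. Y $$ (i, j)) = 0 \<and> (\<Sum>i<n. \<sigma> $ i) = 0)"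
      if "Y \<in> balanced_sdp_feasible n" for Y
      using that bal by (simp add: balanced_sdp_feasible_def)
    show "J \<le> C * (n * p)"
    proof -
      have "n / 2 * (k1 * h) \<le> n / 2 * (C * p)" using C k hp h0 p0 by (intro mult_left_mono mult_mono) auto
      also have "\<dots> \<le> C * (n * p)" using C p0 by simp
      finally show ?thesis using Jh by linarith
    qed
    show "J * p \<le> C * (n * \<mu>\<^sup>2)"
    proof -
      have hpp: "h * p = (p - q)\<^sup>2" using p0 by (simp add: h_def)
      have "J * p \<le> n / 2 * (k1 * h) * p" using Jh p0 by (intro mult_right_mono) auto
      also have "\<dots> = (2 * k1) * (n * \<mu>\<^sup>2)" using hpp by (simp add: \<mu>_def power_divide mult.assoc)
      also have "\<dots> \<le> C * (n * \<mu>\<^sup>2)" using C by (intro mult_right_mono) auto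
      finally show ?thesis .
    qed
    have eq: "(p - q) / p * \<mu> * n = h / 2 * n" by (simp add: h_def \<mu>_def power2_eq_square)
    show "J \<le> C * (l * \<mu> * n)"
    proof -
      have "J \<le> n / 2 * (k1 * h)" by (rule Jh)
      also have "\<dots> = k1 * ((p - q) / p * \<mu> * n)" unfolding eq by simp
      also have "\<dots> = 2 * k1 * ((p - q) / (2 * p) * \<mu> * n)" by simp
      also have "\<dots> \<le> C * (l * \<mu> * n)"
        using C k b(3) \<mu>0 qp p0 by (intro mult_mono mult_right_mono) (auto intro!: mult_nonneg_nonneg)
      finally show ?thesis .
    qed
    show "l * \<mu> * n \<le> C * J"
    proof -
      have "l * \<mu> * n \<le> k2 / 2 * ((p - q) / p) * \<mu> * n" using b(4) \<mu>0 by (intro mult_right_mono) (auto simp: k2_def)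
      also have "\<dots> = k2 / 2 * (h / 2 * n)" unfolding eq[symmetric] by simp
      also have "\<dots> \<le> k2 / 2 * (4 * I / 2 * n)" using b(1) k by (intro mult_left_mono mult_right_mono) auto
      also have "\<dots> = 2 * k2 * J" by (simp add: J_def)
      also have "\<dots> \<le> C * J" using C J0 by (intro mult_right_mono) auto
      finally show ?thesis .
    qed
    show "\<kappa> i j = \<kappa> j i" for i j by (simp add: \<kappa>_def mult.commute[of "\<sigma> $ i"])
    show "(\<Sum>j\<in>{..<n} - {i}. \<kappa> i j) \<le> - J + C * (J / n + 1)" if i: "i < n" for i
    proof -
      have ss: "\<sigma> $ i * \<sigma> $ i = 1"
        using \<sigma> i unfolding label_vec_def by auto
      have "(\<Sum>j<n. \<kappa> i j) = n * ((ln f1 + ln f2) / 2) + (ln f1 - ln f2) / 2 * (\<sigma> $ i * (\<Sum>j<n. \<sigma> $ j))"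
        by (simp add: \<kappa>_def sum.distrib sum_distrib_left)
      also have "\<dots> = - J" unfolding bal lnff by (simp add: J_def)
      finally have all: "(\<Sum>j<n. \<kappa> i j) = - J" .
      \<comment> \<open>The row sum omits the diagonal. The correction is bounded because f1 \<ge> 1
        - p \<ge> \<open>c\<^sub>1\<close>.\<close>
      have "\<kappa> i i = ln f1" unfolding \<kappa>_def ss by (simp add: field_simps)
      then have "(\<Sum>j\<in>{..<n} - {i}. \<kappa> i j) = - J - ln f1" using all i by (simp add: sum_diff1)
      moreover have "- ln f1 \<le> ln (1 / c\<^sub>1)" using f1c f1 c by (simp add: ln_div)
      moreover have "0 \<le> C * (J / n)" using C J0 by simp
      moreover have "C * (J / n + 1) = C * (J / n) + C" by (simp add: distrib_left)
      ultimately show ?thesis using C(4) by linarith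
    qed
    fix i j assume ij: "i < j" "j < n"
    define t where "t = \<sigma> $ i * \<sigma> $ j"
    define r where "r = (if t = 1 then p else q)"
    have r01: "0 < r" "r \<le> p" "r < 1" using q0 qp p1 by (auto simp: r_def)
    have tt: "t = 1 \<or> t = - 1" using r1[OF ij] by (simp add: t_def)
    have X: "(\<lambda>\<omega>. A \<omega> $$ (i, j)) \<in> borel_measurable M" using entry_measurable[OF rm, of i j] ij by simp
    have D: "(\<Sum>v\<in>{1, 0}. f v * prob {\<omega> \<in> space M. A \<omega> $$ (i, j) = v}) = f 1 * r + f 0 * (1 - r)" for f :: "real \<Rightarrow> real"
      using P[OF ij] by (simp add: r_def t_def)
    have T: "(\<Sum>v\<in>{1, 0 :: real}. prob {\<omega> \<in> space M. A \<omega> $$ (i, j) = v}) = 1" using D[of "\<lambda>_. 1"] by simp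
    have fin: "finite {1, 0 :: real}" by simp
    have w: "centered \<sigma> m \<mu> (i, j) v = t * (v - r)" for v
      using tt by (auto simp: centered_def t_def[symmetric] r_def m_def \<mu>_def field_simps)
    have wabs: "\<bar>centered \<sigma> m \<mu> (i, j) v\<bar> = \<bar>v - r\<bar>" for v using tt by (auto simp: w abs_mult)
    have wsq: "(centered \<sigma> m \<mu> (i, j) v)\<^sup>2 = (v - r)\<^sup>2" for v
      using wabs[of v] by (metis power2_abs)
    show "(\<integral>\<^sup>+\<omega>. ennreal (exp (s * centered \<sigma> m \<mu> (i, j) (A \<omega> $$ (i, j)))) \<partial>M) \<le> ennreal (exp (s\<^sup>2 * p))"
      if s: "\<bar>s\<bar> \<le> 1 / 2" for s
    proof (rule discrete_mgf_le[OF X fin T _ _ _ s])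
      show "\<bar>centered \<sigma> m \<mu> (i, j) v\<bar> \<le> 2" if "v \<in> {1, 0}" for v
        unfolding wabs using that r01 by auto
      show "(\<Sum>v\<in>{1, 0}. centered \<sigma> m \<mu> (i, j) v * prob {\<omega> \<in> space M. A \<omega> $$ (i, j) = v}) = 0"
        unfolding D w by (simp add: algebra_simps)
      have "(1 - r)\<^sup>2 * r + (0 - r)\<^sup>2 * (1 - r) = r - r * r" by (simp add: power2_eq_square algebra_simps)
      then show "(\<Sum>v\<in>{1, 0}. (centered \<sigma> m \<mu> (i, j) v)\<^sup>2 * prob {\<omega> \<in> space M. A \<omega> $$ (i, j) = v}) \<le> p"
        unfolding wsq D using r01 by (simp add: add_increasing2 le_diff_eq diff_le_eq)
    qed
    show "prob {\<omega> \<in> space M. A \<omega> $$ (i, j) \<noteq> 0} \<le> p"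
    proof -
      have "{\<omega> \<in> space M. A \<omega> $$ (i, j) = 0} \<in> events" using X by measurable
      moreover have "{\<omega> \<in> space M. A \<omega> $$ (i, j) \<noteq> 0} = space M - {\<omega> \<in> space M. A \<omega> $$ (i, j) = 0}" by auto
      ultimately show ?thesis using P(2)[OF ij] r01 by (simp add: prob_compl r_def t_def)
    qed
    show "prob {\<omega> \<in> space M. \<bar>centered \<sigma> m \<mu> (i, j) (A \<omega> $$ (i, j))\<bar> \<le> of_bool (A \<omega> $$ (i, j) \<noteq> 0) + p} = 1"
    proof (rule prob_eq_1_discrete[OF X fin T])
      show "\<bar>centered \<sigma> m \<mu> (i, j) v\<bar> \<le> of_bool (v \<noteq> 0) + p" if "v \<in> {1, 0}" for v
        unfolding wabs using that r01 p0 by auto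
      show "{\<omega> \<in> space M. \<bar>centered \<sigma> m \<mu> (i, j) (A \<omega> $$ (i, j))\<bar> \<le> of_bool (A \<omega> $$ (i, j) \<noteq> 0) + p} \<in> events"
        using X by measurable
    qed
    show "(\<integral>\<^sup>+\<omega>. ennreal (exp (- l * (\<sigma> $ i * \<sigma> $ j * (A \<omega> $$ (i, j) - m)))) \<partial>M) \<le> ennreal (exp (\<kappa> i j))"
    proof -
      have "(\<integral>\<^sup>+\<omega>. ennreal (exp (- l * (t * (A \<omega> $$ (i, j) - m)))) \<partial>M)
         = ennreal (\<Sum>v\<in>{1, 0}. exp (- l * (t * (v - m))) * prob {\<omega> \<in> space M. A \<omega> $$ (i, j) = v})"
        by (rule nn_integral_discrete[OF X fin T]) simp
      also have "(\<Sum>v\<in>{1, 0}. exp (- l * (t * (v - m))) * prob {\<omega> \<in> space M. A \<omega> $$ (i, j) = v}) = (if t = 1 then f1 else f2)"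
      proof (cases "t = 1")
        case True
        then show ?thesis unfolding D r_def f1_def by (simp add: exp_add[symmetric] exp_diff exp_minus algebra_simps divide_inverse)
      next
        case False
        then have "t = - 1" using tt by simp
        then show ?thesis unfolding D r_def f2_def by (simp add: exp_add[symmetric] exp_diff exp_minus algebra_simps divide_inverse)
      qed
      also have "\<dots> = exp (\<kappa> i j)"
      proof (cases "t = 1")
        case True
        then have "\<kappa> i j = ln f1" unfolding \<kappa>_def t_def[symmetric] by (simp add: field_simps)
        then show ?thesis using True f1 by simp
      next
        case False
        then have "t = - 1" using tt by simp
        then have "\<kappa> i j = ln f2" unfolding \<kappa>_def t_def[symmetric] by (simp add: field_simps)
        then show ?thesis using False f2 by simp
      qed
      finally show ?thesis by (simp add: t_def)
    qed
  qed
  then show ?thesis by (simp add: J_def I_def)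
qed

theorem corollary1:
  fixes c\<^sub>0 c\<^sub>1 :: real
    and n :: "nat \<Rightarrow> nat"
    and M :: "nat \<Rightarrow> 'w measure"
    and A :: "nat \<Rightarrow> 'w \<Rightarrow> real Matrix.mat"
    and \<sigma> :: "nat \<Rightarrow> real Matrix.vec"
  assumes "0 < c\<^sub>0" "c\<^sub>0 < 1" "0 < c\<^sub>1" "c\<^sub>1 < 1"
    and "filterlim n at_top sequentially"
  shows
    "(\<forall>\<tau> :: nat \<Rightarrow> real.
        (\<forall>k. z2_synchronization (M k) (n k) (\<sigma> k) (\<tau> k) (A k)) \<and>
        filterlim (\<lambda>k. real (n k) * z2_info (\<tau> k)) at_top sequentially \<longrightarrow>
        sdp_exponential_recovery sdp_feasible M n
          (\<lambda>k. real (n k)) (\<lambda>k. z2_info (\<tau> k)) \<sigma> A) \<and>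
     (\<forall>(\<alpha> :: nat \<Rightarrow> real) (\<epsilon> :: real).
        (\<forall>k. censored_block_model (M k) (n k) (\<sigma> k) (\<alpha> k) \<epsilon> (A k)) \<and>
        filterlim (\<lambda>k. real (n k) * cbm_info (\<alpha> k) \<epsilon>) at_top sequentially \<longrightarrow>
        sdp_exponential_recovery sdp_feasible M n
          (\<lambda>k. real (n k)) (\<lambda>k. cbm_info (\<alpha> k) \<epsilon>) \<sigma> A) \<and>
     (\<forall>p q :: nat \<Rightarrow> real.
        (\<forall>k. stochastic_block_model (M k) (n k) (\<sigma> k) (p k) (q k) (A k) \<and>
             0 < c\<^sub>0 * p k \<and> c\<^sub>0 * p k \<le> q k \<and> q k < p k \<and> p k \<le> 1 - c\<^sub>1) \<and>
        filterlim (\<lambda>k. real (n k) * sbm_info (p k) (q k)) at_top sequentially \<longrightarrow>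
        sdp_exponential_recovery balanced_sdp_feasible M n
          (\<lambda>k. real (n k) / 2) (\<lambda>k. sbm_info (p k) (q k)) \<sigma> A)"
proof (intro conjI allI impI; elim conjE)
  fix \<tau> :: "nat \<Rightarrow> real"
  assume model: "\<forall>k. z2_synchronization (M k) (n k) (\<sigma> k) (\<tau> k) (A k)"
    and J: "filterlim (\<lambda>k. real (n k) * z2_info (\<tau> k)) at_top sequentially"
  show "sdp_exponential_recovery sdp_feasible M n (\<lambda>k. real (n k)) (\<lambda>k. z2_info (\<tau> k)) \<sigma> A"
  proof (rule sdp_exponential_recoveryI)
    fix e :: real assume e: "0 < e" "e < 1"
    have "eventually (\<lambda>k. large_enough 2 e (n k) (real (n k) * z2_info (\<tau> k))) sequentially"
      using e by (intro eventually_large_enough assms(5) J) auto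
    then show "eventually (\<lambda>k. \<exists>E\<in>sets (M k). 1 - e \<le> measure (M k) E \<and>
       (\<forall>\<omega>\<in>E. accurate sdp_feasible (n k) (\<sigma> k) (A k \<omega>) (real (n k) * z2_info (\<tau> k)) e)) sequentially"
      by (rule eventually_mono) (use z2_accurate model e in blast)
  qed
next
  fix \<alpha> :: "nat \<Rightarrow> real" and \<epsilon> :: real
  assume model: "\<forall>k. censored_block_model (M k) (n k) (\<sigma> k) (\<alpha> k) \<epsilon> (A k)"
    and J: "filterlim (\<lambda>k. real (n k) * cbm_info (\<alpha> k) \<epsilon>) at_top sequentially"
  \<comment> \<open>The constant of the model is fixed along the sequence because \<epsilon> does
    not depend on \<open>k\<close>; its range is read off from index 0.\<close>
  have "0 < \<epsilon>" "\<epsilon> < 1 / 2" using model[rule_format, of 0] by (auto simp: censored_block_model_def)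
  then have C: "1 \<le> cbm_const \<epsilon>" by (rule cbm_const_bounds)
  show "sdp_exponential_recovery sdp_feasible M n (\<lambda>k. real (n k)) (\<lambda>k. cbm_info (\<alpha> k) \<epsilon>) \<sigma> A"
  proof (rule sdp_exponential_recoveryI)
    fix e :: real assume e: "0 < e" "e < 1"
    have "eventually (\<lambda>k. large_enough (cbm_const \<epsilon>) e (n k) (real (n k) * cbm_info (\<alpha> k) \<epsilon>)) sequentially"
      using e C by (intro eventually_large_enough assms(5) J) auto
    then show "eventually (\<lambda>k. \<exists>E\<in>sets (M k). 1 - e \<le> measure (M k) E \<and>
       (\<forall>\<omega>\<in>E. accurate sdp_feasible (n k) (\<sigma> k) (A k \<omega>) (real (n k) * cbm_info (\<alpha> k) \<epsilon>) e)) sequentially"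
      by (rule eventually_mono) (use cbm_accurate model e in blast)
  qed
next
  fix p q :: "nat \<Rightarrow> real"
  assume model: "\<forall>k. stochastic_block_model (M k) (n k) (\<sigma> k) (p k) (q k) (A k) \<and>
             0 < c\<^sub>0 * p k \<and> c\<^sub>0 * p k \<le> q k \<and> q k < p k \<and> p k \<le> 1 - c\<^sub>1"
    and J: "filterlim (\<lambda>k. real (n k) * sbm_info (p k) (q k)) at_top sequentially"
  \<comment> \<open>The hypothesis is stated with \<open>n\<close>, the rate with n / 2; the factor
    does not affect divergence.\<close>
  have J': "filterlim (\<lambda>k. real (n k) / 2 * sbm_info (p k) (q k)) at_top sequentially"
    using filterlim_tendsto_pos_mult_at_top[OF tendsto_const[of "1 / 2 :: real"] _ J] by simp
  have C: "1 \<le> sbm_const c\<^sub>0 c\<^sub>1" using assms by (intro sbm_const_bounds)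
  show "sdp_exponential_recovery balanced_sdp_feasible M n (\<lambda>k. real (n k) / 2) (\<lambda>k. sbm_info (p k) (q k)) \<sigma> A"
  proof (rule sdp_exponential_recoveryI)
    fix e :: real assume e: "0 < e" "e < 1"
    have "eventually (\<lambda>k. large_enough (sbm_const c\<^sub>0 c\<^sub>1) e (n k) (real (n k) / 2 * sbm_info (p k) (q k))) sequentially"
      using e C by (intro eventually_large_enough assms(5) J') auto
    then show "eventually (\<lambda>k. \<exists>E\<in>sets (M k). 1 - e \<le> measure (M k) E \<and>
       (\<forall>\<omega>\<in>E. accurate balanced_sdp_feasible (n k) (\<sigma> k) (A k \<omega>) (real (n k) / 2 * sbm_info (p k) (q k)) e)) sequentially"
      by (rule eventually_mono) (use sbm_accurate[OF assms(1-4)] model e in blast)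
  qed
qed

end
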